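(* Let $K$ be a field, let $A=\{\mathbf{t}^{\mathbf{a}_1},\ldots,\mathbf{t}^{\mathbf{a}_n}\}$ be a configuration of $K[t_1,\ldots,t_d]$ all of whose monomials have the same total degree $r$ and such that every variable $t_i$ divides at least one monomial of $A$, and for each $1\le i\le d$ let $B_i=\{m^{(i)}_1,\ldots,m^{(i)}_{\lambda_i}\}$ be a configuration of a polynomial ring $K[\mathbf{u}^{(i)}]$. Let $\mathcal{G}_0$ be a Gröbner basis of $I_A\subset K[y_1,\ldots,y_n]$ consisting of binomials, with respect to a monomial order $<_0$, and for each $1\le i\le d$ let $\mathcal{G}_i$ be a Gröbner basis of $I_{B_i}\subset K[z^{(i)}_1,\ldots,z^{(i)}_{\lambda_i}]$ consisting of binomials, with respect to a monomial order $<_i$. Then there is a monomial order on $K[\mathbf{x}]$ with respect to which $I_{A(B_1,\ldots,B_d)}$ has a Gröbner basis consisting of all the following binomials, the initial monomial of each being its first (underlined) monomial: (1) $$\underline{\prod_{\ell=1}^p x^{(k_\ell)}_{(i_{(\ell-1)r+1},j_{(\ell-1)r+1})\cdots(i_{\ell r},j_{\ell r})}}-\prod_{\ell=1}^p x^{(k'_\ell)}_{(i'_{(\ell-1)r+1},j'_{(\ell-1)r+1})\cdots(i'_{\ell r},j'_{\ell r})},$$ where $\underline{y_{k_1}\cdots y_{k_p}}-y_{k'_1}\cdots y_{k'_p}\in\mathcal{G}_0$ (initial monomial underlined) and $\mathrm{sort}((i_1,j_1)\cdots(i_{pr},j_{pr}))=\mathrm{sort}((i'_1,j'_1)\cdots(i'_{pr},j'_{pr}))$.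 (2) $$\underline{x^{(k)}_{(i_1,j_1)\cdots(i_r,j_r)}\,x^{(k)}_{(i_{r+1},j_{r+1})\cdots(i_{2r},j_{2r})}}-x^{(k)}_{(i'_1,j'_1)(i'_3,j'_3)\cdots(i'_{2r-1},j'_{2r-1})}\,x^{(k)}_{(i'_2,j'_2)(i'_4,j'_4)\cdots(i'_{2r},j'_{2r})},$$ where $\mathrm{sort}((i_1,j_1)\cdots(i_{2r},j_{2r}))=(i'_1,j'_1)\cdots(i'_{2r},j'_{2r})$. (3) $$\underline{x^{(k)}_{(i_1,j_1)\cdots(i_\ell,j_\ell)\cdots(i_r,j_r)}\,x^{(k')}_{(i'_1,j'_1)\cdots(i'_{\ell'},j'_{\ell'})\cdots(i'_r,j'_r)}}-x^{(k)}_{(i_1,j_1)\cdots(i'_{\ell'},j'_{\ell'})\cdots(i_r,j_r)}\,x^{(k')}_{(i'_1,j'_1)\cdots(i_\ell,j_\ell)\cdots(i'_r,j'_r)},$$ where $k<k'$, $i_\ell=i'_{\ell'}$ and $j_\ell>j'_{\ell'}$ (the two letters $(i_\ell,j_\ell)$ and $(i'_{\ell'},j'_{\ell'})$ are interchanged). (4) $$\underline{\prod_{\ell=1}^p x^{(k_\ell)}_{M_\ell(i,j_{\ell,1})\cdots(i,j_{\ell,q_\ell})M'_\ell}}-\prod_{\ell=1}^p x^{(k_\ell)}_{M_\ell(i,j'_{\ell,1})\cdots(i,j'_{\ell,q_\ell})M'_\ell},$$ where $1\le i\le d$, $q_1,\ldots,q_p\ge1$, the $M_\ell,M'_\ell$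 are strings of letters, and the binomial $$0\ne\underline{\prod_{\ell=1}^p z^{(i)}_{j_{\ell,1}}\cdots z^{(i)}_{j_{\ell,q_\ell}}}-\prod_{\ell=1}^p z^{(i)}_{j'_{\ell,1}}\cdots z^{(i)}_{j'_{\ell,q_\ell}}$$ (initial monomial underlined) belongs to $\mathcal{G}_i$. In particular, the initial monomial of each binomial of type (4) is squarefree (resp. quadratic) if the corresponding monomial $\prod_{\ell=1}^p z^{(i)}_{j_{\ell,1}}\cdots z^{(i)}_{j_{\ell,q_\ell}}$ is squarefree (resp. quadratic).
   Context: A configuration of a polynomial ring $K[t_1,\ldots,t_d]$ is a finite set $A=\{\mathbf{t}^{\mathbf{a}_1},\ldots,\mathbf{t}^{\mathbf{a}_n}\}$ of (distinct) monomials such that there is $\mathbf{w}\in\mathbb{R}^d$ with $\mathbf{w}\cdot\mathbf{a}_i=1$ for all $i$. The toric ideal $I_A\subset K[y_1,\ldots,y_n]$ is the kernel of $y_k\mapsto\mathbf{t}^{\mathbf{a}_k}$; $I_{B_i}$ is the kernel of $z^{(i)}_j\mapsto m^{(i)}_j$. A binomial is a difference of two monomials. Nested configuration: the rings $K[\mathbf{u}^{(1)}],\ldots,K[\mathbf{u}^{(d)}]$ have pairwise disjoint sets of variables, and $$A(B_1,\ldots,B_d)=\{m^{(i_1)}_{j_1}\cdots m^{(i_r)}_{j_r} : t_{i_1}\cdots t_{i_r}\in A,\ 1\le j_k\le\lambda_{i_k}\text{ for }1\le k\le r\}\subset K[\mathbf{u}^{(1)},\ldots,\mathbf{u}^{(d)}].$$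 Variables of $K[\mathbf{x}]$: there is one variable for each element of $A(B_1,\ldots,B_d)$. For letters $(i_1,j_1),\ldots,(i_r,j_r)$ with $1\le i_s\le d$, $1\le j_s\le\lambda_{i_s}$ and $t_{i_1}\cdots t_{i_r}=\mathbf{t}^{\mathbf{a}_k}\in A$, the symbol $x^{(k)}_{(i_1,j_1)\cdots(i_r,j_r)}$ denotes the variable corresponding to $m^{(i_1)}_{j_1}\cdots m^{(i_r)}_{j_r}$ (so the order of the letters in a label is immaterial, and two labels giving the same monomial denote the same variable). The symbols in the binomials are required to be such variables. $I_{A(B_1,\ldots,B_d)}$ is the kernel of $K[\mathbf{x}]\to K[\mathbf{u}^{(1)},\ldots,\mathbf{u}^{(d)}]$, $x^{(k)}_{(i_1,j_1)\cdots(i_r,j_r)}\mapsto m^{(i_1)}_{j_1}\cdots m^{(i_r)}_{j_r}$. Standard labels: a label $(i_1,j_1)\cdots(i_r,j_r)$ is standard if for every $1\le j\le d$ the monomial $\prod_{1\le\ell\le r,\ i_\ell=j}z^{(j)}_{j_\ell}$ is a standard monomial with respect to $\mathcal{G}_j$, i.e. is not divisible by the $<_j$-initial monomial of any element of $\mathcal{G}_j$. Every variable has exactly one standard label (up to order of letters). In the underlined monomials of (1)–(4) every variable is written with its standard label; labels in the second monomials may be arbitrary. Sorting: $\mathrm{sort}$ takes a string of letters over the alphabet $\{(i,j):1\le i\le d,\ 1\le j\le\lambda_i\}$ and rearranges it in the order $(1,1)\succ(1,2)\succ\cdots\succ(1,\lambda_1)\succ(2,1)\succ\cdots\succ(d,\lambda_d)$,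 $(1,1)$ coming first. Expressions of type (2) in which the two monomials coincide (giving $0$) are discarded.
   Formalization: As stated, a type (4) initial monomial need not be squarefree when its z-monomial is (e.g. x_{12}^2 x_{34} from z_1z_2z_3). Proved instead: a squarefree monomial in the same variables is the initial monomial of a type (4) binomial from the same element of G_i. *)

theory Defs
  imports
    Complex_Main
    "HOL-Library.Poly_Mapping"
    "HOL-Library.Product_Lexorder"
    "HOL-Library.Disjoint_Sets"
    "HOL-Algebra.Ideal"
begin

section \<open>Polynomial rings, monomial orders, Groebner bases\<close>

text \<open>
  A monomial is its exponent vector and a polynomial is a finitely supported map from monomials
  to coefficients. Multiplication of monomials is thus addition of exponent vectors.
  The polynomial ring \<open>K[v : v \<in> V]\<close> is \<open>poly_ring V\<close>.
\<close>

type_synonym 'v mon = "'v \<Rightarrow>\<^sub>0 nat"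
type_synonym ('v, 'k) mpoly = "('v \<Rightarrow>\<^sub>0 nat) \<Rightarrow>\<^sub>0 'k"

definition mons :: "'v set \<Rightarrow> 'v mon set" where
  "mons V = {s. Poly_Mapping.keys s \<subseteq> V}"

definition poly_ring :: "'v set \<Rightarrow> ('v, 'k::comm_ring_1) mpoly ring" where
  "poly_ring V = \<lparr>carrier = {p. Poly_Mapping.keys p \<subseteq> mons V},
     mult = (*), one = 1, zero = 0, add = (+)\<rparr>"

abbreviation var :: "'v \<Rightarrow> 'v mon" where
  "var v \<equiv> Poly_Mapping.single v 1"

abbreviation mono_poly :: "'v mon \<Rightarrow> ('v, 'k::comm_ring_1) mpoly" where
  "mono_poly s \<equiv> Poly_Mapping.single s 1"

definition mon_dvd :: "'v mon \<Rightarrow> 'v mon \<Rightarrow> bool" where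
  "mon_dvd s t \<longleftrightarrow> (\<exists>u. t = s + u)"

definition mon_degree :: "'v mon \<Rightarrow> nat" where
  "mon_degree s = (\<Sum>v\<in>Poly_Mapping.keys s. Poly_Mapping.lookup s v)"

definition squarefree_mon :: "'v mon \<Rightarrow> bool" where
  "squarefree_mon s \<longleftrightarrow> (\<forall>v. Poly_Mapping.lookup s v \<le> 1)"

text \<open>\<open>(s, t) \<in> ord\<close> means \<open>s \<le> t\<close>.\<close>

definition monomial_order :: "'v set \<Rightarrow> 'v mon rel \<Rightarrow> bool" where
  "monomial_order V ord \<longleftrightarrow>
     linear_order_on (mons V) ord \<and>
     (\<forall>s\<in>mons V. (0, s) \<in> ord) \<and>
     (\<forall>s\<in>mons V. \<forall>t\<in>mons V. \<forall>u\<in>mons V. (s, t) \<in> ord \<longrightarrow> (s + u, t + u) \<in> ord)"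

definition init_mon :: "'v mon rel \<Rightarrow> ('v, 'k::comm_ring_1) mpoly \<Rightarrow> 'v mon" where
  "init_mon ord f = (THE s. s \<in> Poly_Mapping.keys f \<and> (\<forall>t\<in>Poly_Mapping.keys f. (t, s) \<in> ord))"

definition init_ideal :: "'v set \<Rightarrow> 'v mon rel \<Rightarrow> ('v, 'k::comm_ring_1) mpoly set
    \<Rightarrow> ('v, 'k) mpoly set" where
  "init_ideal V ord I = Idl\<^bsub>poly_ring V\<^esub> ((\<lambda>f. mono_poly (init_mon ord f)) ` (I - {0}))"

definition groebner_basis :: "'v set \<Rightarrow> 'v mon rel \<Rightarrow> ('v, 'k::comm_ring_1) mpoly set
    \<Rightarrow> ('v, 'k) mpoly set \<Rightarrow> bool" where
  "groebner_basis V ord I B \<longleftrightarrow>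
     finite B \<and> B \<subseteq> I - {0} \<and>
     init_ideal V ord I = Idl\<^bsub>poly_ring V\<^esub> ((\<lambda>g. mono_poly (init_mon ord g)) ` B)"

definition binomial_poly :: "('v, 'k::comm_ring_1) mpoly \<Rightarrow> bool" where
  "binomial_poly f \<longleftrightarrow> (\<exists>s t. f = mono_poly s - mono_poly t)"

text \<open>
  \<open>marked_in ord B s t\<close>: the nonzero binomial \<open>s - t\<close>, with initial monomial \<open>s\<close>, belongs to \<open>B\<close>.
  An element of \<open>B\<close> is only required to be a difference of monomials, so the initial monomial
  may carry the coefficient \<open>-1\<close> there; hence membership is up to sign.
\<close>

definition marked_in :: "'v mon rel \<Rightarrow> ('v, 'k::comm_ring_1) mpoly set
    \<Rightarrow> 'v mon \<Rightarrow> 'v mon \<Rightarrow> bool" where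
  "marked_in ord B s t \<longleftrightarrow>
     s \<noteq> t \<and>
     (mono_poly s - mono_poly t \<in> B \<or> mono_poly t - mono_poly s \<in> B) \<and>
     init_mon ord (mono_poly s - mono_poly t :: ('v, 'k) mpoly) = s"


section \<open>Configurations and toric ideals\<close>

definition configuration :: "'v set \<Rightarrow> 'v mon set \<Rightarrow> bool" where
  "configuration V S \<longleftrightarrow>
     finite V \<and> finite S \<and> S \<subseteq> mons V \<and>
     (\<exists>w :: 'v \<Rightarrow> real. \<forall>s\<in>S. (\<Sum>v\<in>V. w v * real (Poly_Mapping.lookup s v)) = 1)"

definition subst :: "('x \<Rightarrow> ('v, 'k::comm_ring_1) mpoly) \<Rightarrow> ('x, 'k) mpoly \<Rightarrow> ('v, 'k) mpoly" where
  "subst h p = (\<Sum>s\<in>Poly_Mapping.keys p.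
     Poly_Mapping.single 0 (Poly_Mapping.lookup p s) *
     (\<Prod>x\<in>Poly_Mapping.keys s. h x ^ Poly_Mapping.lookup s x))"

text \<open>The kernel of \<open>K[x : x \<in> X] \<rightarrow> K[v : v \<in> V]\<close>, \<open>x \<mapsto> \<phi> x\<close>, for a map \<open>\<phi>\<close> to monomials.\<close>

definition toric_ideal :: "'x set \<Rightarrow> 'v set \<Rightarrow> ('x \<Rightarrow> 'v mon) \<Rightarrow> ('x, 'k::comm_ring_1) mpoly set" where
  "toric_ideal X V \<phi> = a_kernel (poly_ring X) (poly_ring V) (subst (\<lambda>x. mono_poly (\<phi> x)))"


section \<open>Nested configurations\<close>

text \<open>
  The variable \<open>t\<^sub>i\<close> is the number \<open>i \<in> {1..d}\<close>, \<open>a k\<close> is the \<open>k\<close>-th monomial of \<open>A\<close> (for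
  \<open>k \<in> {1..n}\<close>), \<open>lam i\<close> is \<open>\<lambda>\<^sub>i\<close> and \<open>m i j\<close> is \<open>m\<^sup>(\<^sup>i\<^sup>)\<^sub>j\<close>. A letter is a pair \<open>(i, j)\<close>, a label is a
  list of letters; the library order on \<open>nat \<times> nat\<close> used by \<open>sort\<close> is lexicographic, with
  \<open>(1,1)\<close> first.
\<close>

type_synonym letter = "nat \<times> nat"

definition letters :: "nat \<Rightarrow> (nat \<Rightarrow> nat) \<Rightarrow> letter set" where
  "letters d lam = {(i, j). i \<in> {1..d} \<and> j \<in> {1..lam i}}"

definition t_mon :: "letter list \<Rightarrow> nat mon" where
  "t_mon w = (\<Sum>(i, j)\<leftarrow>w. var i)"

definition u_mon :: "(nat \<Rightarrow> nat \<Rightarrow> 'u mon) \<Rightarrow> letter list \<Rightarrow> 'u mon" where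
  "u_mon m w = (\<Sum>(i, j)\<leftarrow>w. m i j)"

definition z_mon :: "nat \<Rightarrow> letter list \<Rightarrow> nat mon" where
  "z_mon i w = (\<Sum>(i', j)\<leftarrow>filter (\<lambda>(i', j). i' = i) w. var j)"

definition nested_configuration :: "nat \<Rightarrow> (nat \<Rightarrow> nat) \<Rightarrow> nat mon set
    \<Rightarrow> (nat \<Rightarrow> nat \<Rightarrow> 'u mon) \<Rightarrow> 'u mon set" where
  "nested_configuration d lam A m = {u_mon m w | w. set w \<subseteq> letters d lam \<and> t_mon w \<in> A}"

text \<open>
  The variables of \<open>K[x]\<close> are the elements of the nested configuration themselves, so that the
  variable \<open>x\<^sup>(\<^sup>k\<^sup>)\<^sub>w\<close> with label \<open>w\<close> is \<open>u_mon m w\<close>; the superscript \<open>k\<close> is recorded by \<open>label\<close>.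
\<close>

definition label :: "nat \<Rightarrow> nat \<Rightarrow> (nat \<Rightarrow> nat mon) \<Rightarrow> (nat \<Rightarrow> nat) \<Rightarrow> nat \<Rightarrow> letter list \<Rightarrow> bool" where
  "label d n a lam k w \<longleftrightarrow> k \<in> {1..n} \<and> set w \<subseteq> letters d lam \<and> t_mon w = a k"

definition std_label :: "nat \<Rightarrow> nat \<Rightarrow> (nat \<Rightarrow> nat mon) \<Rightarrow> (nat \<Rightarrow> nat)
    \<Rightarrow> (nat \<Rightarrow> nat mon rel) \<Rightarrow> (nat \<Rightarrow> (nat, 'k::comm_ring_1) mpoly set)
    \<Rightarrow> nat \<Rightarrow> letter list \<Rightarrow> bool" where
  "std_label d n a lam ord G k w \<longleftrightarrow>
     label d n a lam k w \<and>
     (\<forall>i\<in>{1..d}. \<forall>g\<in>G i. \<not> mon_dvd (init_mon (ord i) g) (z_mon i w))"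

abbreviation x_var :: "(nat \<Rightarrow> nat \<Rightarrow> 'u mon) \<Rightarrow> letter list \<Rightarrow> 'u mon mon" where
  "x_var m w \<equiv> var (u_mon m w)"

text \<open>
  The four families of binomials of \<open>K[x]\<close>, given as pairs (underlined monomial, second monomial).
  Products over \<open>\<ell> = 1, \<dots>, p\<close> are indexed by \<open>\<ell> < p\<close>.
\<close>

definition type1 :: "nat \<Rightarrow> nat \<Rightarrow> (nat \<Rightarrow> nat mon) \<Rightarrow> (nat \<Rightarrow> nat) \<Rightarrow> (nat \<Rightarrow> nat \<Rightarrow> 'u mon)
    \<Rightarrow> nat mon rel \<Rightarrow> (nat, 'k::comm_ring_1) mpoly set
    \<Rightarrow> (nat \<Rightarrow> nat mon rel) \<Rightarrow> (nat \<Rightarrow> (nat, 'k) mpoly set)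
    \<Rightarrow> ('u mon mon \<times> 'u mon mon) set" where
  "type1 d n a lam m ord0 G0 ord G =
     {(\<Sum>l<p. x_var m (w l), \<Sum>l<p. x_var m (w' l)) | p k k' w w'.
        (\<forall>l<p. std_label d n a lam ord G (k l) (w l)) \<and>
        (\<forall>l<p. label d n a lam (k' l) (w' l)) \<and>
        marked_in ord0 G0 (\<Sum>l<p. var (k l)) (\<Sum>l<p. var (k' l)) \<and>
        sort (concat (map w [0..<p])) = sort (concat (map w' [0..<p]))}"

definition type2 :: "nat \<Rightarrow> nat \<Rightarrow> nat \<Rightarrow> (nat \<Rightarrow> nat mon) \<Rightarrow> (nat \<Rightarrow> nat) \<Rightarrow> (nat \<Rightarrow> nat \<Rightarrow> 'u mon)
    \<Rightarrow> (nat \<Rightarrow> nat mon rel) \<Rightarrow> (nat \<Rightarrow> (nat, 'k::comm_ring_1) mpoly set)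
    \<Rightarrow> ('u mon mon \<times> 'u mon mon) set" where
  "type2 d n r a lam m ord G =
     {(x_var m w1 + x_var m w2,
       x_var m (map (\<lambda>l. v ! (2 * l)) [0..<r]) + x_var m (map (\<lambda>l. v ! (2 * l + 1)) [0..<r]))
       | k w1 w2 v.
        std_label d n a lam ord G k w1 \<and> std_label d n a lam ord G k w2 \<and>
        v = sort (w1 @ w2) \<and>
        x_var m w1 + x_var m w2 \<noteq>
          x_var m (map (\<lambda>l. v ! (2 * l)) [0..<r]) + x_var m (map (\<lambda>l. v ! (2 * l + 1)) [0..<r])}"

definition type3 :: "nat \<Rightarrow> nat \<Rightarrow> (nat \<Rightarrow> nat mon) \<Rightarrow> (nat \<Rightarrow> nat) \<Rightarrow> (nat \<Rightarrow> nat \<Rightarrow> 'u mon)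
    \<Rightarrow> (nat \<Rightarrow> nat mon rel) \<Rightarrow> (nat \<Rightarrow> (nat, 'k::comm_ring_1) mpoly set)
    \<Rightarrow> ('u mon mon \<times> 'u mon mon) set" where
  "type3 d n a lam m ord G =
     {(x_var m w + x_var m w', x_var m (w[l := w' ! l']) + x_var m (w'[l' := w ! l]))
       | k k' w w' l l'.
        std_label d n a lam ord G k w \<and> std_label d n a lam ord G k' w' \<and> k < k' \<and>
        l < length w \<and> l' < length w' \<and>
        fst (w ! l) = fst (w' ! l') \<and> snd (w ! l) > snd (w' ! l')}"

text \<open>
  \<open>type4 \<dots> i z z' s t\<close>: the pair \<open>(s, t)\<close> arises from the binomial \<open>z - z'\<close> of \<open>G i\<close>. The strings
  \<open>M l\<close>, \<open>M' l\<close> may themselves contain letters \<open>(i, j)\<close>. In particular one variable can occur for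
  several \<open>l\<close> with different letters singled out: if \<open>z = z\<^sub>1 z\<^sub>2 z\<^sub>3\<close> and \<open>x, x'\<close> have the standard labels
  \<open>(i,1)(i,2)\<close> and \<open>(i,3)(i,4)\<close>, then \<open>s\<close> can be \<open>x\<^sup>2 x'\<close> besides \<open>x x'\<close>. So \<open>s\<close> need not be squarefree
  when \<open>z\<close> is; the squarefree monomial with the same variables then arises from \<open>z - z'\<close> too.
\<close>

definition type4 :: "nat \<Rightarrow> nat \<Rightarrow> (nat \<Rightarrow> nat mon) \<Rightarrow> (nat \<Rightarrow> nat) \<Rightarrow> (nat \<Rightarrow> nat \<Rightarrow> 'u mon)
    \<Rightarrow> (nat \<Rightarrow> nat mon rel) \<Rightarrow> (nat \<Rightarrow> (nat, 'k::comm_ring_1) mpoly set)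
    \<Rightarrow> nat \<Rightarrow> nat mon \<Rightarrow> nat mon \<Rightarrow> 'u mon mon \<Rightarrow> 'u mon mon \<Rightarrow> bool" where
  "type4 d n a lam m ord G i z z' s t \<longleftrightarrow>
     i \<in> {1..d} \<and> marked_in (ord i) (G i) z z' \<and>
     (\<exists>(p::nat) k M M' q j j'.
        (\<forall>l<p. q l \<ge> 1 \<and> length (j l) = q l \<and> length (j' l) = q l) \<and>
        (\<forall>l<p. std_label d n a lam ord G (k l) (M l @ map (Pair i) (j l) @ M' l)) \<and>
        (\<forall>l<p. label d n a lam (k l) (M l @ map (Pair i) (j' l) @ M' l)) \<and>
        z = (\<Sum>l<p. \<Sum>c\<leftarrow>j l. var c) \<and> z' = (\<Sum>l<p. \<Sum>c\<leftarrow>j' l. var c) \<and>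
        s = (\<Sum>l<p. x_var m (M l @ map (Pair i) (j l) @ M' l)) \<and>
        t = (\<Sum>l<p. x_var m (M l @ map (Pair i) (j' l) @ M' l)))"

definition nested_marked_binomials :: "nat \<Rightarrow> nat \<Rightarrow> nat \<Rightarrow> (nat \<Rightarrow> nat mon) \<Rightarrow> (nat \<Rightarrow> nat)
    \<Rightarrow> (nat \<Rightarrow> nat \<Rightarrow> 'u mon) \<Rightarrow> nat mon rel \<Rightarrow> (nat, 'k::comm_ring_1) mpoly set
    \<Rightarrow> (nat \<Rightarrow> nat mon rel) \<Rightarrow> (nat \<Rightarrow> (nat, 'k) mpoly set)
    \<Rightarrow> ('u mon mon \<times> 'u mon mon) set" where
  "nested_marked_binomials d n r a lam m ord0 G0 ord G =
     type1 d n a lam m ord0 G0 ord G \<union> type2 d n r a lam m ord G \<union> type3 d n a lam m ord G \<union>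
     {(s, t) | s t. \<exists>i z z'. type4 d n a lam m ord G i z z' s t}"

end

theory Submission
  imports Defs "HOL-Library.Multiset"
begin

text \<open>
  Writing every variable of \<open>K[x]\<close> with its standard label, a monomial \<open>s\<close> of \<open>K[x]\<close> determines the
  product \<open>Z\<^sub>i(s)\<close> of all letters \<open>z\<^sup>(\<^sup>i\<^sup>)\<^sub>j\<close> in its labels and the product \<open>Y(s)\<close> of the \<open>y\<^sub>k\<close>. Compare
  monomials first by \<open>Z\<^sub>1, \<dots>, Z\<^sub>d\<close> with respect to \<open><\<^sub>1, \<dots>, <\<^sub>d\<close>, then by \<open>Y\<close> with respect to \<open><\<^sub>0\<close>, then by
  a weight that decreases when a larger letter moves to a larger superscript, and then by the sum
  over all variables and all intervals of letters of the squared number of letters in the interval,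
  which decreases under sorting. Passing to standard labels never increases any \<open>Z\<^sub>i\<close>, so types (4),
  (1), (3) and (2) strictly decrease at these four stages.

  The four families generate the initial ideal because a monomial \<open>s\<close> divisible by none of the
  underlined monomials is determined by its image: by type (4) each \<open>Z\<^sub>i(s)\<close> is standard, which
  determines all letters; by type (1) the superscripts are determined; by type (3) the letters
  occurring with each superscript are determined; by type (2) the labels with a fixed superscript
  are pairwise sorted, and a pairwise sorted family of words is determined by its letters.
\<close>

text \<open>The obstacle is that the second monomials of (1)-(4) carry arbitrary labels, so their
  position in the order cannot be read off from the letters as written. What saves the argument is a
  dichotomy. Replacing labels by standard ones can only lower the \<open>Z\<close> components. If it
  lowers one of them, the comparison is already decided at the first stage; if it lowers none, every
  label was standard to begin with, and the later stages may be evaluated on the labels as they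
  stand. The four stages only have to be compatible preorders, since a monomial order refining their
  lexicographic product keeps its strict inequalities.

  For toric ideals, standardness is treated as minimality in a fibre of the map on monomials.
  Configurations make every fibre finite, so minima exist, and the Groebner property reduces to
  uniqueness: a non-minimal monomial that avoids all initial monomials would share its fibre with
  the minimum, which avoids them too.\<close>

declare One_nat_def [simp del]

section \<open>Monomials as multisets of variables\<close>

text \<open>Divisibility of monomials becomes inclusion of multisets, and distributing the factors
  of a monomial becomes splitting a multiset.\<close>

definition mon_mset :: "'v mon \<Rightarrow> 'v multiset" where
  "mon_mset s = Abs_multiset (Poly_Mapping.lookup s)"

text \<open>The additive extension of \<open>\<phi>\<close> from variables to monomials. With
  monomial values it is the exponent map of a substitution, with integer values a weight.\<close>

definition lin :: "('x \<Rightarrow> 'b::comm_monoid_add) \<Rightarrow> 'x mon \<Rightarrow> 'b" where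
  "lin \<phi> s = (\<Sum>x\<in>#mon_mset s. \<phi> x)"

lemma count_mon_mset [simp]: "count (mon_mset s) v = Poly_Mapping.lookup s v"
proof -
  have "finite {v. 0 < Poly_Mapping.lookup s v}"
    using finite_lookup[of s] by simp
  then show ?thesis by (simp add: mon_mset_def Abs_multiset_inverse)
qed

lemma mon_mset_0 [simp]: "mon_mset 0 = {#}"
  by (rule multiset_eqI) simp

lemma mon_mset_plus [simp]: "mon_mset (s + t) = mon_mset s + mon_mset t"
  by (rule multiset_eqI) (simp add: lookup_add)

lemma mon_mset_var [simp]: "mon_mset (var v) = {#v#}"
  by (rule multiset_eqI) (simp add: lookup_single when_def)

lemma mon_mset_inject: "mon_mset s = mon_mset t \<longleftrightarrow> s = t"
  by (metis count_mon_mset poly_mapping_eqI)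

lemma set_mon_mset [simp]: "set_mset (mon_mset s) = Poly_Mapping.keys s"
  by (auto simp: set_mset_def in_keys_iff)

lemma mon_mset_sum_list: "mon_mset (sum_list ss) = (\<Sum>s\<leftarrow>ss. mon_mset s)"
  by (induction ss) auto

lemma mon_mset_sum_mset: "mon_mset (\<Sum>x\<in>#M. f x) = (\<Sum>x\<in>#M. mon_mset (f x))"
  by (induction M) auto

lemma mon_mset_vars [simp]: "mon_mset (\<Sum>x\<in>#M. var x) = M"
  by (induction M) auto

lemma vars_mon_mset [simp]: "(\<Sum>x\<in>#mon_mset s. var x) = s"
  by (simp add: mon_mset_inject[symmetric])

lemma mon_degree_eq_size: "mon_degree s = size (mon_mset s)"
  by (simp add: mon_degree_def size_multiset_overloaded_eq)

lemma mon_dvd_iff: "mon_dvd s t \<longleftrightarrow> mon_mset s \<subseteq># mon_mset t"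
  unfolding mon_dvd_def mset_subset_eq_exists_conv
  by (metis mon_mset_inject mon_mset_plus mon_mset_vars)

lemma mons_iff: "s \<in> mons V \<longleftrightarrow> set_mset (mon_mset s) \<subseteq> V"
  by (simp add: mons_def)

lemma zero_in_mons [simp]: "0 \<in> mons V"
  by (simp add: mons_iff del: set_mon_mset)

lemma plus_in_mons_iff: "s + t \<in> mons V \<longleftrightarrow> s \<in> mons V \<and> t \<in> mons V"
  by (simp add: mons_iff del: set_mon_mset)

lemma var_in_mons_iff [simp]: "var v \<in> mons V \<longleftrightarrow> v \<in> V"
  by (simp add: mons_iff del: set_mon_mset)

lemma sum_mset_in_mons: "(\<And>x. x \<in># M \<Longrightarrow> f x \<in> mons V) \<Longrightarrow> (\<Sum>x\<in>#M. f x) \<in> mons V"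
  by (induction M) (auto simp: plus_in_mons_iff)

lemma lin_0 [simp]: "lin \<phi> 0 = 0"
  by (simp add: lin_def)

lemma lin_plus [simp]: "lin \<phi> (s + t) = lin \<phi> s + lin \<phi> t"
  by (simp add: lin_def)

lemma lin_var [simp]: "lin \<phi> (var v) = \<phi> v"
  by (simp add: lin_def)

lemma lin_sum_mset: "lin \<phi> (\<Sum>x\<in>#M. f x) = (\<Sum>x\<in>#M. lin \<phi> (f x))"
  by (induction M) auto

lemma lin_variables [simp]: "lin var s = s"
  by (simp add: lin_def)

lemma lin_cong: "(\<And>x. x \<in> Poly_Mapping.keys s \<Longrightarrow> \<phi> x = \<psi> x) \<Longrightarrow> lin \<phi> s = lin \<psi> s"
  unfolding lin_def by (rule arg_cong[where f=sum_mset], rule image_mset_cong) simp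

lemma finite_mons_degree_le:
  assumes "finite V"
  shows "finite {s \<in> mons V. mon_degree s \<le> n}"
proof -
  have "finite {M. set_mset M \<subseteq> V \<and> size M \<le> n}"
  proof -
    have "{M. set_mset M \<subseteq> V \<and> size M \<le> n} \<subseteq> mset ` {xs. set xs \<subseteq> V \<and> length xs \<le> n}"
      by (clarsimp, metis (mono_tags, lifting) ex_mset image_iff mem_Collect_eq set_mset_mset size_mset)
    then show ?thesis using finite_lists_length_le[OF assms] finite_surj by blast
  qed
  moreover have "mon_mset ` {s \<in> mons V. mon_degree s \<le> n} \<subseteq> {M. set_mset M \<subseteq> V \<and> size M \<le> n}"
    by (auto simp: mons_iff mon_degree_eq_size)
  moreover have "inj_on mon_mset {s \<in> mons V. mon_degree s \<le> n}"
    by (simp add: inj_on_def mon_mset_inject)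
  ultimately show ?thesis by (meson finite_imageD finite_subset)
qed

lemma mon_degree_plus [simp]: "mon_degree (s + t) = mon_degree s + mon_degree t"
  by (simp add: mon_degree_eq_size)

lemma mon_degree_var [simp]: "mon_degree (var v) = 1"
  by (simp add: mon_degree_eq_size)

lemma mon_degree_0 [simp]: "mon_degree 0 = 0"
  by (simp add: mon_degree_eq_size)


section \<open>Toric ideals\<close>

lemma subst_monomials:
  fixes p :: "('x, 'k::comm_ring_1) mpoly" and \<phi> :: "'x \<Rightarrow> 'v mon"
  shows "subst (\<lambda>x. mono_poly (\<phi> x)) p =
     (\<Sum>s\<in>Poly_Mapping.keys p. Poly_Mapping.single (lin \<phi> s) (Poly_Mapping.lookup p s))"
proof -
  have "(\<Prod>x\<in>Poly_Mapping.keys s. mono_poly (\<phi> x) ^ Poly_Mapping.lookup s x)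
      = (mono_poly (lin \<phi> s) :: ('v, 'k) mpoly)" for s
  proof -
    have "(\<Prod>x\<in>Poly_Mapping.keys s. mono_poly (\<phi> x) ^ Poly_Mapping.lookup s x)
      = prod_mset (image_mset (\<lambda>x. mono_poly (\<phi> x) :: ('v, 'k) mpoly) (mon_mset s))"
      by (simp add: image_prod_mset_multiplicity)
    also have "prod_mset (image_mset (\<lambda>x. mono_poly (\<phi> x) :: ('v, 'k) mpoly) M)
       = mono_poly (sum_mset (image_mset \<phi> M))" for M
      by (induction M) (auto simp: mult_single)
    finally show ?thesis by (simp add: lin_def)
  qed
  then show ?thesis by (simp add: subst_def mult_single)
qed

text \<open>Substituting monomials for variables merges exactly the terms in one fibre of
  \<open>lin \<phi>\<close>, so the kernel condition is cancellation of coefficients fibre by fibre.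
  Everything said later about toric ideals rests on this criterion.\<close>

lemma toric_ideal_iff:
  "p \<in> toric_ideal X V \<phi> \<longleftrightarrow> Poly_Mapping.keys p \<subseteq> mons X \<and>
     (\<forall>t. (\<Sum>s | s \<in> Poly_Mapping.keys p \<and> lin \<phi> s = t. Poly_Mapping.lookup p s) = 0)"
proof -
  have "Poly_Mapping.lookup (subst (\<lambda>x. mono_poly (\<phi> x)) p) t
     = (\<Sum>s | s \<in> Poly_Mapping.keys p \<and> lin \<phi> s = t. Poly_Mapping.lookup p s)" for t
    by (simp add: subst_monomials lookup_sum lookup_single when_def sum.If_cases Int_def)
  then show ?thesis
    by (simp add: toric_ideal_def a_kernel_def' poly_ring_def poly_mapping_eq_iff fun_eq_iff)
qed

lemma keys_binomial: "s \<noteq> t \<Longrightarrow>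
    Poly_Mapping.keys (mono_poly s - mono_poly t :: ('v, 'k::comm_ring_1) mpoly) = {s, t}"
  by (auto simp: in_keys_iff lookup_minus lookup_single when_def split: if_splits)

lemma binomial_in_toric_ideal_iff:
  assumes "s \<noteq> t"
  shows "(mono_poly s - mono_poly t :: ('v, 'k::comm_ring_1) mpoly) \<in> toric_ideal X V \<phi> \<longleftrightarrow>
     s \<in> mons X \<and> t \<in> mons X \<and> lin \<phi> s = lin \<phi> t" (is "?p \<in> _ \<longleftrightarrow> _")
proof -
  have l: "Poly_Mapping.lookup ?p s = 1" "Poly_Mapping.lookup ?p t = -1"
    using assms by (auto simp: lookup_minus lookup_single when_def)
  have *: "{x. x \<in> {s,t} \<and> lin \<phi> x = u} =
     (if lin \<phi> s = u then {s} else {}) \<union> (if lin \<phi> t = u then {t} else {})" for u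
    by auto
  have "(\<forall>u. (\<Sum>x | x \<in> {s,t} \<and> lin \<phi> x = u. Poly_Mapping.lookup ?p x) = 0) \<longleftrightarrow> lin \<phi> s = lin \<phi> t"
    unfolding * using assms by (auto simp: l split: if_splits)
  then show ?thesis
    unfolding toric_ideal_iff keys_binomial[OF assms] by auto
qed

text \<open>A term alone in its fibre would have nothing to cancel against.\<close>

lemma toric_ideal_other_term:
  assumes "f \<in> toric_ideal X V \<phi>" "s \<in> Poly_Mapping.keys f"
  shows "\<exists>t\<in>Poly_Mapping.keys f. t \<noteq> s \<and> lin \<phi> t = lin \<phi> s"
proof (rule ccontr)
  assume "\<not> ?thesis"
  then have "{t. t \<in> Poly_Mapping.keys f \<and> lin \<phi> t = lin \<phi> s} = {s}" using assms(2) by auto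
  then have "(\<Sum>t | t \<in> Poly_Mapping.keys f \<and> lin \<phi> t = lin \<phi> s. Poly_Mapping.lookup f t) = Poly_Mapping.lookup f s"
    by simp
  then have "Poly_Mapping.lookup f s = 0" using assms(1) unfolding toric_ideal_iff by simp
  then show False using assms(2) by (simp add: in_keys_iff)
qed


section \<open>Initial monomials and Groebner bases\<close>

lemma monomial_order_refl: "monomial_order V ord \<Longrightarrow> s \<in> mons V \<Longrightarrow> (s, s) \<in> ord"
  by (auto simp: monomial_order_def linear_order_on_def partial_order_on_def preorder_on_def refl_on_def)

lemma monomial_order_trans: "monomial_order V ord \<Longrightarrow> (s, t) \<in> ord \<Longrightarrow> (t, u) \<in> ord \<Longrightarrow> (s, u) \<in> ord"
  by (auto simp: monomial_order_def linear_order_on_def partial_order_on_def preorder_on_def dest: transD)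

lemma monomial_order_antisym: "monomial_order V ord \<Longrightarrow> (s, t) \<in> ord \<Longrightarrow> (t, s) \<in> ord \<Longrightarrow> s = t"
  by (auto simp: monomial_order_def linear_order_on_def partial_order_on_def dest: antisymD)

lemma monomial_order_total:
  "monomial_order V ord \<Longrightarrow> s \<in> mons V \<Longrightarrow> t \<in> mons V \<Longrightarrow> (s, t) \<in> ord \<or> (t, s) \<in> ord"
  by (cases "s = t") (auto simp: monomial_order_refl, auto simp: monomial_order_def linear_order_on_def total_on_def)

lemma monomial_order_plus:
  "monomial_order V ord \<Longrightarrow> (s, t) \<in> ord \<Longrightarrow> s \<in> mons V \<Longrightarrow> t \<in> mons V \<Longrightarrow> u \<in> mons V
    \<Longrightarrow> (s + u, t + u) \<in> ord"
  by (simp add: monomial_order_def)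

lemma monomial_order_has_max:
  assumes "monomial_order V ord" "finite S" "S \<noteq> {}" "S \<subseteq> mons V"
  shows "\<exists>s\<in>S. \<forall>t\<in>S. (t, s) \<in> ord"
  using assms(2-4)
proof (induction S rule: finite_ne_induct)
  case (singleton x)
  then show ?case using monomial_order_refl[OF assms(1)] by auto
next
  case (insert x F)
  then obtain s where s: "s \<in> F" "\<forall>t\<in>F. (t, s) \<in> ord" by auto
  have "(s, x) \<in> ord \<or> (x, s) \<in> ord"
    using monomial_order_total[OF assms(1)] insert.prems s(1) by auto
  then show ?case
  proof
    assume "(s, x) \<in> ord"
    then show ?thesis
      using s monomial_order_trans[OF assms(1)] monomial_order_refl[OF assms(1)] insert.prems by blast
  next
    assume "(x, s) \<in> ord"
    then show ?thesis using s by blast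
  qed
qed

lemma monomial_order_has_min:
  assumes "monomial_order V ord" "finite S" "S \<noteq> {}" "S \<subseteq> mons V"
  shows "\<exists>s\<in>S. \<forall>t\<in>S. (s, t) \<in> ord"
  using assms(2-4)
proof (induction S rule: finite_ne_induct)
  case (singleton x)
  then show ?case using monomial_order_refl[OF assms(1)] by auto
next
  case (insert x F)
  then obtain s where s: "s \<in> F" "\<forall>t\<in>F. (s, t) \<in> ord" by auto
  have "(s, x) \<in> ord \<or> (x, s) \<in> ord"
    using monomial_order_total[OF assms(1)] insert.prems s(1) by auto
  then show ?case
  proof
    assume "(x, s) \<in> ord"
    then show ?thesis
      using s monomial_order_trans[OF assms(1)] monomial_order_refl[OF assms(1)] insert.prems by blast
  next
    assume "(s, x) \<in> ord"
    then show ?thesis using s by blast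
  qed
qed

lemma init_mon_eqI:
  assumes "monomial_order V ord" "s \<in> Poly_Mapping.keys f"
    and "\<And>t. t \<in> Poly_Mapping.keys f \<Longrightarrow> (t, s) \<in> ord"
  shows "init_mon ord f = s"
  unfolding init_mon_def
  using assms by (intro the_equality) (auto intro: monomial_order_antisym)

lemma init_mon_max:
  assumes "monomial_order V ord" "Poly_Mapping.keys f \<subseteq> mons V" "f \<noteq> 0"
  shows "init_mon ord f \<in> Poly_Mapping.keys f"
    and "t \<in> Poly_Mapping.keys f \<Longrightarrow> (t, init_mon ord f) \<in> ord"
proof -
  have "Poly_Mapping.keys f \<noteq> {}"
    using assms(3) by (metis ex_in_conv in_keys_iff lookup_zero poly_mapping_eqI)
  then obtain s where "s \<in> Poly_Mapping.keys f" "\<forall>t\<in>Poly_Mapping.keys f. (t, s) \<in> ord"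
    using monomial_order_has_max[OF assms(1) _ _ assms(2)] by auto
  then show "init_mon ord f \<in> Poly_Mapping.keys f"
    "t \<in> Poly_Mapping.keys f \<Longrightarrow> (t, init_mon ord f) \<in> ord"
    using init_mon_eqI[OF assms(1), of s f] by auto
qed

lemma init_mon_binomial:
  assumes "monomial_order V ord" "s \<noteq> t" "s \<in> mons V" "(t, s) \<in> ord"
  shows "init_mon ord (mono_poly s - mono_poly t :: ('v, 'k::comm_ring_1) mpoly) = s"
  using assms keys_binomial[OF assms(2), where 'k='k]
  by (intro init_mon_eqI[OF assms(1)]) (auto intro: monomial_order_refl)

section \<open>Initial ideals as monomial ideals\<close>

lemma cring_poly_ring: "cring (poly_ring V :: ('v, 'k::comm_ring_1) mpoly ring)"
proof (rule cringI)
  let ?R = "poly_ring V :: ('v, 'k) mpoly ring"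
  have car: "carrier ?R = {p. Poly_Mapping.keys p \<subseteq> mons V}" by (simp add: poly_ring_def)
  have pl: "Poly_Mapping.keys (p + q) \<subseteq> mons V"
    if "Poly_Mapping.keys p \<subseteq> mons V" "Poly_Mapping.keys q \<subseteq> mons V" for p q :: "('v, 'k) mpoly"
    using that keys_add[of p q] by blast
  have mu: "Poly_Mapping.keys (p * q) \<subseteq> mons V"
    if "Poly_Mapping.keys p \<subseteq> mons V" "Poly_Mapping.keys q \<subseteq> mons V" for p q :: "('v, 'k) mpoly"
    using that keys_mult[of p q] by (fastforce simp: plus_in_mons_iff)
  show "abelian_group ?R"
  proof (rule abelian_groupI)
    fix p assume "p \<in> carrier ?R"
    then show "\<exists>q\<in>carrier ?R. q \<oplus>\<^bsub>?R\<^esub> p = \<zero>\<^bsub>?R\<^esub>"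
      by (intro bexI[of _ "-p"]) (auto simp: poly_ring_def in_keys_iff subset_iff)
  qed (auto simp: poly_ring_def ac_simps intro: pl[THEN subsetD])
  show "comm_monoid ?R"
    by (rule comm_monoidI) (auto simp: poly_ring_def ac_simps intro: mu[THEN subsetD] split: if_splits)
  fix p q t assume "p \<in> carrier ?R" "q \<in> carrier ?R" "t \<in> carrier ?R"
  show "(p \<oplus>\<^bsub>?R\<^esub> q) \<otimes>\<^bsub>?R\<^esub> t = p \<otimes>\<^bsub>?R\<^esub> t \<oplus>\<^bsub>?R\<^esub> q \<otimes>\<^bsub>?R\<^esub> t"
    by (simp add: poly_ring_def distrib_right)
qed

lemma poly_ring_minus:
  assumes "p \<in> carrier (poly_ring V)"
  shows "\<ominus>\<^bsub>poly_ring V\<^esub> p = (- p :: ('v, 'k::comm_ring_1) mpoly)"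
proof -
  interpret cring "poly_ring V :: ('v, 'k) mpoly ring" by (rule cring_poly_ring)
  have "- p \<in> carrier (poly_ring V)" "- p \<oplus>\<^bsub>poly_ring V\<^esub> p = \<zero>\<^bsub>poly_ring V\<^esub>"
    using assms by (auto simp: poly_ring_def in_keys_iff subset_iff)
  then show ?thesis using assms minus_equality by blast
qed

text \<open>The polynomials all of whose terms are multiples of some \<open>init_mon ord g\<close>
  with \<open>g \<in> B\<close> form an ideal \<open>?J\<close>. It contains the generators coming
  from \<open>B\<close>, hence the whole initial ideal, and a monomial in \<open>?J\<close> is
  itself such a multiple.\<close>

lemma mon_dvd_init_mon:
  assumes B: "groebner_basis V ord I B" and ord: "monomial_order V ord"
    and I: "\<And>g. g \<in> I \<Longrightarrow> Poly_Mapping.keys g \<subseteq> mons V"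
    and f: "f \<in> I" "f \<noteq> (0 :: ('v, 'k::comm_ring_1) mpoly)"
  shows "\<exists>g\<in>B. mon_dvd (init_mon ord g) (init_mon ord f)"
proof -
  let ?R = "poly_ring V :: ('v, 'k) mpoly ring"
  let ?J = "{p. \<forall>s\<in>Poly_Mapping.keys p. s \<in> mons V \<and> (\<exists>g\<in>B. mon_dvd (init_mon ord g) s)} :: ('v, 'k) mpoly set"
  interpret cring ?R by (rule cring_poly_ring)
  have car: "carrier ?R = {p. Poly_Mapping.keys p \<subseteq> mons V}" by (simp add: poly_ring_def)
  have B': "B \<subseteq> I - {0}" using B by (simp add: groebner_basis_def)
  have in_mons: "init_mon ord g \<in> mons V" if "g \<in> I - {0}" for g
    using init_mon_max(1)[OF ord I] I that by blast
  have mul: "x * p \<in> ?J" if p: "p \<in> ?J" and x: "x \<in> carrier ?R" for p x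
  proof (clarify)
    fix s assume "s \<in> Poly_Mapping.keys (x * p)"
    then obtain u v where uv: "s = u + v" "u \<in> Poly_Mapping.keys x" "v \<in> Poly_Mapping.keys p"
      using keys_mult[of x p] by blast
    then obtain g where g: "g \<in> B" "mon_dvd (init_mon ord g) v" using p by blast
    then have "mon_dvd (init_mon ord g) s" unfolding uv by (auto simp: mon_dvd_iff intro: subset_mset.add_increasing)
    moreover have "s \<in> mons V" using uv p x by (auto simp: car plus_in_mons_iff)
    ultimately show "s \<in> mons V \<and> (\<exists>g\<in>B. mon_dvd (init_mon ord g) s)" using g by blast
  qed
  have "ideal ?J ?R"
  proof (rule idealI)
    show "ring ?R" by (rule ring_axioms)
    show "subgroup ?J (add_monoid ?R)"
    proof (rule add.subgroupI)
      show "?J \<subseteq> carrier ?R" by (auto simp: car)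
      show "?J \<noteq> {}" by (auto intro: exI[of _ 0])
      fix p assume p: "p \<in> ?J"
      then have "p \<in> carrier ?R" by (auto simp: car)
      then have "\<ominus>\<^bsub>?R\<^esub> p = - p" by (rule poly_ring_minus)
      then show "\<ominus>\<^bsub>?R\<^esub> p \<in> ?J" using p by (simp add: in_keys_iff)
      fix q assume q: "q \<in> ?J"
      show "p \<oplus>\<^bsub>?R\<^esub> q \<in> ?J" using p q keys_add[of p q] by (fastforce simp: poly_ring_def)
    qed
    fix p x assume "p \<in> ?J" "x \<in> carrier ?R"
    then have "x * p \<in> ?J" by (rule mul)
    then show "x \<otimes>\<^bsub>?R\<^esub> p \<in> ?J" "p \<otimes>\<^bsub>?R\<^esub> x \<in> ?J" by (simp_all add: poly_ring_def mult.commute)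
  qed
  moreover have "(\<lambda>g. mono_poly (init_mon ord g)) ` B \<subseteq> ?J"
    using in_mons[OF subsetD[OF B']] by (auto simp: mon_dvd_iff)
  ultimately have "Idl\<^bsub>?R\<^esub> ((\<lambda>g. mono_poly (init_mon ord g)) ` B) \<subseteq> ?J"
    by (rule genideal_minimal)
  moreover have "mono_poly (init_mon ord f) \<in> init_ideal V ord I"
    unfolding init_ideal_def
    by (rule subsetD[OF genideal_self]) (use in_mons f in \<open>auto simp: car\<close>)
  ultimately have "mono_poly (init_mon ord f) \<in> ?J"
    using B by (auto simp: groebner_basis_def)
  then show ?thesis by simp
qed

lemma groebner_basisI:
  assumes ord: "monomial_order V ord"
    and I: "\<And>g. g \<in> I \<Longrightarrow> Poly_Mapping.keys g \<subseteq> mons V"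
    and B: "finite B" "B \<subseteq> I - {0 :: ('v, 'k::comm_ring_1) mpoly}"
    and dvd: "\<And>f. f \<in> I \<Longrightarrow> f \<noteq> 0 \<Longrightarrow> \<exists>g\<in>B. mon_dvd (init_mon ord g) (init_mon ord f)"
  shows "groebner_basis V ord I B"
proof -
  let ?R = "poly_ring V :: ('v, 'k) mpoly ring"
  let ?J = "\<lambda>F. Idl\<^bsub>?R\<^esub> ((\<lambda>g. mono_poly (init_mon ord g)) ` F)"
  interpret cring ?R by (rule cring_poly_ring)
  have car: "carrier ?R = {p. Poly_Mapping.keys p \<subseteq> mons V}" by (simp add: poly_ring_def)
  have in_mons: "init_mon ord g \<in> mons V" if "g \<in> I - {0}" for g
    using init_mon_max(1)[OF ord I] I that by blast
  have carI: "(\<lambda>g. mono_poly (init_mon ord g)) ` (I - {0}) \<subseteq> carrier ?R"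
    using in_mons by (auto simp: car)
  then have carB: "(\<lambda>g. mono_poly (init_mon ord g)) ` B \<subseteq> carrier ?R"
    using B by blast
  interpret JB: ideal "?J B" ?R by (rule genideal_ideal[OF carB])
  have "?J (I - {0}) \<subseteq> ?J B"
  proof (rule genideal_minimal[OF JB.is_ideal], rule image_subsetI)
    fix f assume "f \<in> I - {0}"
    then have f: "f \<in> I" "f \<noteq> 0" by auto
    obtain g u where g: "g \<in> B" "init_mon ord f = init_mon ord g + u"
      using dvd[OF f] by (auto simp: mon_dvd_def)
    have "init_mon ord f \<in> mons V" using in_mons f by auto
    then have u: "mono_poly u \<in> carrier ?R" using g by (simp add: car plus_in_mons_iff)
    have "mono_poly (init_mon ord g) \<in> ?J B"
      using genideal_self[OF carB] g by auto
    from JB.I_r_closed[OF this u]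
    show "mono_poly (init_mon ord f) \<in> ?J B"
      by (simp add: g poly_ring_def mult_single)
  qed
  moreover have "?J B \<subseteq> ?J (I - {0})"
  proof (rule genideal_minimal)
    show "ideal (?J (I - {0})) ?R" by (rule genideal_ideal[OF carI])
    show "(\<lambda>g. mono_poly (init_mon ord g)) ` B \<subseteq> ?J (I - {0})"
      using genideal_self[OF carI] B by blast
  qed
  ultimately show ?thesis using B by (auto simp: groebner_basis_def init_ideal_def)
qed

section \<open>Fibres of toric ideals\<close>

text \<open>These are the standard monomials of a toric ideal (see
  \<open>fibre_min_iff_not_dvd\<close>), described without a Groebner basis.\<close>

definition fibre_min :: "'x set \<Rightarrow> 'x mon rel \<Rightarrow> ('x \<Rightarrow> 'v mon) \<Rightarrow> 'x mon \<Rightarrow> bool" where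
  "fibre_min X ord \<phi> s \<longleftrightarrow>
     s \<in> mons X \<and> (\<forall>t\<in>mons X. lin \<phi> t = lin \<phi> s \<longrightarrow> (s, t) \<in> ord)"

definition degree_homogeneous :: "'x set \<Rightarrow> ('x \<Rightarrow> 'v mon) \<Rightarrow> bool" where
  "degree_homogeneous X \<phi> \<longleftrightarrow>
     (\<forall>s\<in>mons X. \<forall>t\<in>mons X. lin \<phi> s = lin \<phi> t \<longrightarrow> mon_degree s = mon_degree t)"

text \<open>The weight vector \<open>w\<close> extends to an additive functional \<open>W\<close>
  with value 1 on every \<open>\<phi> x\<close>, so \<open>W (lin \<phi> s)\<close> counts the
  variables of \<open>s\<close> with multiplicity.\<close>

lemma configuration_homogeneous:
  assumes "configuration V (\<phi> ` X)"
  shows "degree_homogeneous X \<phi>"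
proof -
  obtain w :: "_ \<Rightarrow> real" where
    w: "\<forall>s\<in>\<phi> ` X. (\<Sum>v\<in>V. w v * real (Poly_Mapping.lookup s v)) = 1"
    using assms by (auto simp: configuration_def)
  define W where "W u = (\<Sum>v\<in>V. w v * real (Poly_Mapping.lookup u v))" for u
  have [simp]: "W 0 = 0" and W_plus: "W (s + t) = W s + W t" for s t
    by (simp_all add: W_def lookup_add distrib_left sum.distrib)
  have "W (\<Sum>x\<in>#M. \<phi> x) = real (size M)" if "set_mset M \<subseteq> X" for M
    using that w by (induction M) (auto simp: W_plus W_def[symmetric])
  then have W_lin: "W (lin \<phi> s) = real (mon_degree s)" if "s \<in> mons X" for s
    using that by (simp add: lin_def mon_degree_eq_size mons_iff)
  have "mon_degree s = mon_degree t"
    if "s \<in> mons X" "t \<in> mons X" "lin \<phi> s = lin \<phi> t" for s t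
    using W_lin[OF that(1)] W_lin[OF that(2)] that(3) by simp
  then show ?thesis unfolding degree_homogeneous_def by blast
qed

lemma fibre_min_in_mons: "fibre_min X ord \<phi> s \<Longrightarrow> s \<in> mons X"
  by (simp add: fibre_min_def)

lemma fibre_min_le:
  "fibre_min X ord \<phi> s \<Longrightarrow> t \<in> mons X \<Longrightarrow> lin \<phi> t = lin \<phi> s \<Longrightarrow> (s, t) \<in> ord"
  unfolding fibre_min_def by blast

lemma fibre_min_unique:
  assumes "monomial_order X ord" "fibre_min X ord \<phi> s" "fibre_min X ord \<phi> t" "lin \<phi> s = lin \<phi> t"
  shows "s = t"
proof (rule monomial_order_antisym[OF assms(1)])
  show "(s, t) \<in> ord" using fibre_min_le[OF assms(2)] fibre_min_in_mons[OF assms(3)] assms(4) by simp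
  show "(t, s) \<in> ord" using fibre_min_le[OF assms(3)] fibre_min_in_mons[OF assms(2)] assms(4) by simp
qed

text \<open>Homogeneity confines the fibre to one degree, so it is finite and the order has a
  minimum on it.\<close>

lemma fibre_min_exists:
  assumes ord: "monomial_order X ord" and X: "finite X" and hom: "degree_homogeneous X \<phi>"
    and s: "s \<in> mons X"
  shows "\<exists>t. fibre_min X ord \<phi> t \<and> lin \<phi> t = lin \<phi> s"
proof -
  let ?F = "{t \<in> mons X. lin \<phi> t = lin \<phi> s}"
  have "mon_degree t = mon_degree s" if "t \<in> ?F" for t
    using hom s that unfolding degree_homogeneous_def by blast
  then have "?F \<subseteq> {t \<in> mons X. mon_degree t \<le> mon_degree s}"
    by fastforce
  then have "finite ?F" using finite_mons_degree_le[OF X] finite_subset by blast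
  then obtain t where "t \<in> ?F" "\<forall>u\<in>?F. (t, u) \<in> ord"
    using monomial_order_has_min[OF ord, of ?F] s by blast
  then have "fibre_min X ord \<phi> t" "lin \<phi> t = lin \<phi> s" unfolding fibre_min_def by simp_all
  then show ?thesis by blast
qed

text \<open>If some \<open>s'\<close> in the fibre of \<open>s\<close> were smaller, then
  \<open>s' + u\<close> would be a smaller monomial in the fibre of
  \<open>t = s + u\<close>.\<close>

lemma fibre_min_dvd:
  assumes ord: "monomial_order X ord" and t: "fibre_min X ord \<phi> t" and st: "mon_dvd s t"
  shows "fibre_min X ord \<phi> s"
proof -
  obtain u where u: "t = s + u" using st by (auto simp: mon_dvd_def)
  have mons: "s \<in> mons X" "u \<in> mons X"
    using fibre_min_in_mons[OF t] u by (simp_all add: plus_in_mons_iff)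
  have "(s, s') \<in> ord" if s': "s' \<in> mons X" "lin \<phi> s' = lin \<phi> s" for s'
  proof -
    have "s' + u \<in> mons X" "lin \<phi> (s' + u) = lin \<phi> t"
      using s' mons u by (simp_all add: plus_in_mons_iff)
    then have le: "(s + u, s' + u) \<in> ord" using fibre_min_le[OF t] u by blast
    show ?thesis
    proof (rule ccontr)
      assume n: "(s, s') \<notin> ord"
      then have "(s', s) \<in> ord" using monomial_order_total[OF ord] s'(1) mons(1) by blast
      then have "(s' + u, s + u) \<in> ord"
        using monomial_order_plus[OF ord] s'(1) mons by blast
      then have "s' + u = s + u" using le by (rule monomial_order_antisym[OF ord])
      then show False using n \<open>(s', s) \<in> ord\<close> by simp
    qed
  qed
  then show ?thesis using mons unfolding fibre_min_def by blast
qed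

text \<open>The initial monomial of \<open>g\<close> shares its fibre with another, smaller term of
  \<open>g\<close>; so it is not minimal, and neither is any multiple of it.\<close>

lemma fibre_min_not_dvd:
  assumes ord: "monomial_order X ord" and s: "fibre_min X ord \<phi> s"
    and g: "g \<in> toric_ideal X V \<phi>" "g \<noteq> (0 :: ('x, 'k::comm_ring_1) mpoly)"
  shows "\<not> mon_dvd (init_mon ord g) s"
proof
  assume "mon_dvd (init_mon ord g) s"
  then have min: "fibre_min X ord \<phi> (init_mon ord g)" by (rule fibre_min_dvd[OF ord s])
  have keys: "Poly_Mapping.keys g \<subseteq> mons X" using g by (simp add: toric_ideal_iff)
  obtain t where t: "t \<in> Poly_Mapping.keys g" "t \<noteq> init_mon ord g" "lin \<phi> t = lin \<phi> (init_mon ord g)"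
    using toric_ideal_other_term[OF g(1) init_mon_max(1)[OF ord keys g(2)]] by blast
  have "(init_mon ord g, t) \<in> ord" using fibre_min_le[OF min] t keys by blast
  then show False
    using t(2) init_mon_max(2)[OF ord keys g(2) t(1)] monomial_order_antisym[OF ord] by blast
qed

text \<open>For the converse, let \<open>t\<close> be the minimum of the fibre of \<open>s\<close>.
  If \<open>s \<noteq> t\<close>, the difference of \<open>s\<close> and \<open>t\<close> lies in
  the ideal and has initial monomial \<open>s\<close>, so some \<open>init_mon ord g\<close> divides
  \<open>s\<close>.\<close>

lemma fibre_min_iff_not_dvd:
  assumes ord: "monomial_order X ord" and X: "finite X" and hom: "degree_homogeneous X \<phi>"
    and G: "groebner_basis X ord (toric_ideal X V \<phi> :: ('x, 'k::comm_ring_1) mpoly set) G"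
    and s: "s \<in> mons X"
  shows "fibre_min X ord \<phi> s \<longleftrightarrow> (\<forall>g\<in>G. \<not> mon_dvd (init_mon ord g) s)"
proof
  assume "fibre_min X ord \<phi> s"
  moreover have "G \<subseteq> toric_ideal X V \<phi> - {0}" using G by (simp add: groebner_basis_def)
  ultimately show "\<forall>g\<in>G. \<not> mon_dvd (init_mon ord g) s"
    using fibre_min_not_dvd[OF ord] by blast
next
  assume not_dvd: "\<forall>g\<in>G. \<not> mon_dvd (init_mon ord g) s"
  obtain t where t: "fibre_min X ord \<phi> t" "lin \<phi> t = lin \<phi> s"
    using fibre_min_exists[OF ord X hom s] by blast
  show "fibre_min X ord \<phi> s"
  proof (cases "s = t")
    case False
    let ?f = "mono_poly s - mono_poly t :: ('x, 'k) mpoly"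
    have f: "?f \<in> toric_ideal X V \<phi>"
      using s t fibre_min_in_mons[OF t(1)] by (simp add: binomial_in_toric_ideal_iff[OF False])
    have "?f \<noteq> 0" using keys_binomial[OF False, where 'k='k] by (metis insert_not_empty keys_zero)
    moreover have "Poly_Mapping.keys g \<subseteq> mons X" if "g \<in> toric_ideal X V \<phi>" for g :: "('x, 'k) mpoly"
      using that by (simp add: toric_ideal_iff)
    ultimately obtain g where "g \<in> G" "mon_dvd (init_mon ord g) (init_mon ord ?f)"
      using mon_dvd_init_mon[OF G ord _ f] by blast
    moreover have "(t, s) \<in> ord" using fibre_min_le[OF t(1) s] t(2) by simp
    then have "init_mon ord ?f = s" by (rule init_mon_binomial[OF ord False s])
    ultimately show ?thesis using not_dvd by auto
  qed (use t in simp)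
qed

text \<open>The initial monomial of \<open>f\<close> is not the minimum \<open>u\<close> of its
  fibre, because \<open>f\<close> has a smaller term there. As \<open>u\<close> avoids all initial
  monomials of \<open>G\<close>, uniqueness forbids that the initial monomial of \<open>f\<close>
  avoids them as well.\<close>

lemma toric_groebner_basisI:
  assumes ord: "monomial_order X ord" and X: "finite X" and hom: "degree_homogeneous X \<phi>"
    and G: "finite G" "G \<subseteq> toric_ideal X V \<phi> - {0 :: ('x, 'k::comm_ring_1) mpoly}"
    and unique: "\<And>s t. \<lbrakk>s \<in> mons X; t \<in> mons X; lin \<phi> s = lin \<phi> t;
        \<forall>g\<in>G. \<not> mon_dvd (init_mon ord g) s; \<forall>g\<in>G. \<not> mon_dvd (init_mon ord g) t\<rbrakk> \<Longrightarrow> s = t"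
  shows "groebner_basis X ord (toric_ideal X V \<phi>) G"
proof (rule groebner_basisI[OF ord _ G])
  show "Poly_Mapping.keys g \<subseteq> mons X" if "g \<in> toric_ideal X V \<phi>" for g :: "('x, 'k) mpoly"
    using that by (simp add: toric_ideal_iff)
  fix f :: "('x, 'k) mpoly" assume f: "f \<in> toric_ideal X V \<phi>" "f \<noteq> 0"
  then have keys: "Poly_Mapping.keys f \<subseteq> mons X" by (simp add: toric_ideal_iff)
  let ?s = "init_mon ord f"
  have s: "?s \<in> Poly_Mapping.keys f" by (rule init_mon_max(1)[OF ord keys f(2)])
  obtain t where t: "t \<in> Poly_Mapping.keys f" "t \<noteq> ?s" "lin \<phi> t = lin \<phi> ?s"
    using toric_ideal_other_term[OF f(1) s] by blast
  have ts: "(t, ?s) \<in> ord" by (rule init_mon_max(2)[OF ord keys f(2) t(1)])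
  obtain u where u: "fibre_min X ord \<phi> u" "lin \<phi> u = lin \<phi> ?s"
    using fibre_min_exists[OF ord X hom, of ?s] s keys by blast
  have "u \<noteq> ?s"
  proof
    assume "u = ?s"
    then have "(?s, t) \<in> ord" using fibre_min_le[of X ord \<phi> u t] u t keys by auto
    then show False using ts t(2) monomial_order_antisym[OF ord] by blast
  qed
  moreover have "\<forall>g\<in>G. \<not> mon_dvd (init_mon ord g) u"
    using fibre_min_not_dvd[OF ord u(1)] G(2) by blast
  ultimately show "\<exists>g\<in>G. mon_dvd (init_mon ord g) ?s"
    using unique[of u ?s] u fibre_min_in_mons[OF u(1)] s keys by blast
qed


section \<open>Lexicographic products of compatible preorders\<close>

text \<open>The last clause is an equivalence because in a lexicographic product the second preorder
  speaks exactly at the ties of the first; ties must be both preserved and reflected by adding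
  \<open>u\<close>.\<close>

definition compatible_preorder :: "'v set \<Rightarrow> 'v mon rel \<Rightarrow> bool" where
  "compatible_preorder V R \<longleftrightarrow>
     (\<forall>s\<in>mons V. \<forall>t\<in>mons V. (s, t) \<in> R \<or> (t, s) \<in> R) \<and>
     (\<forall>s\<in>mons V. \<forall>t\<in>mons V. \<forall>u\<in>mons V. (s, t) \<in> R \<longrightarrow> (t, u) \<in> R \<longrightarrow> (s, u) \<in> R) \<and>
     (\<forall>s\<in>mons V. (0, s) \<in> R) \<and>
     (\<forall>s\<in>mons V. \<forall>t\<in>mons V. \<forall>u\<in>mons V. (s + u, t + u) \<in> R \<longleftrightarrow> (s, t) \<in> R)"

definition lex_prod_rel :: "'v mon rel \<Rightarrow> 'v mon rel \<Rightarrow> 'v mon rel" (infixr \<open>\<then>\<then>\<close> 65) where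
  "R \<then>\<then> S = {(s, t). (s, t) \<in> R \<and> ((t, s) \<in> R \<longrightarrow> (s, t) \<in> S)}"

lemma compatible_preorder_UNIV [simp]: "compatible_preorder V UNIV"
  by (simp add: compatible_preorder_def)

lemma compatible_preorderD:
  assumes "compatible_preorder V R"
  shows "s \<in> mons V \<Longrightarrow> t \<in> mons V \<Longrightarrow> (s, t) \<in> R \<or> (t, s) \<in> R"
    and "(s, t) \<in> R \<Longrightarrow> (t, u) \<in> R \<Longrightarrow> s \<in> mons V \<Longrightarrow> t \<in> mons V \<Longrightarrow> u \<in> mons V \<Longrightarrow> (s, u) \<in> R"
    and "s \<in> mons V \<Longrightarrow> (0, s) \<in> R"
    and "s \<in> mons V \<Longrightarrow> t \<in> mons V \<Longrightarrow> u \<in> mons V \<Longrightarrow> (s + u, t + u) \<in> R \<longleftrightarrow> (s, t) \<in> R"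
  using assms unfolding compatible_preorder_def by (blast, blast, blast, blast)

lemma compatible_preorderI:
  assumes "\<And>s t. s \<in> mons V \<Longrightarrow> t \<in> mons V \<Longrightarrow> (s, t) \<in> R \<or> (t, s) \<in> R"
    and "\<And>s t u. (s, t) \<in> R \<Longrightarrow> (t, u) \<in> R \<Longrightarrow> s \<in> mons V \<Longrightarrow> t \<in> mons V \<Longrightarrow> u \<in> mons V \<Longrightarrow> (s, u) \<in> R"
    and "\<And>s. s \<in> mons V \<Longrightarrow> (0, s) \<in> R"
    and "\<And>s t u. s \<in> mons V \<Longrightarrow> t \<in> mons V \<Longrightarrow> u \<in> mons V \<Longrightarrow> (s + u, t + u) \<in> R \<longleftrightarrow> (s, t) \<in> R"
  shows "compatible_preorder V R"
  unfolding compatible_preorder_def using assms by blast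

lemma compatible_preorder_lex:
  assumes R: "compatible_preorder V R" and S: "compatible_preorder V S"
  shows "compatible_preorder V (R \<then>\<then> S)"
proof (rule compatible_preorderI)
  fix s t u assume m: "s \<in> mons V" "t \<in> mons V"
  show "(s, t) \<in> R \<then>\<then> S \<or> (t, s) \<in> R \<then>\<then> S"
    using compatible_preorderD(1)[OF R m] compatible_preorderD(1)[OF S m]
    by (auto simp: lex_prod_rel_def)
  assume u: "u \<in> mons V"
  show "((s + u, t + u) \<in> R \<then>\<then> S) = ((s, t) \<in> R \<then>\<then> S)"
    using compatible_preorderD(4)[OF R] compatible_preorderD(4)[OF S] m u
    by (simp add: lex_prod_rel_def)
next
  fix s t u assume st: "(s, t) \<in> R \<then>\<then> S" and tu: "(t, u) \<in> R \<then>\<then> S"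
    and m: "s \<in> mons V" "t \<in> mons V" "u \<in> mons V"
  note trans_R = compatible_preorderD(2)[OF R] and trans_S = compatible_preorderD(2)[OF S]
  have su: "(s, u) \<in> R" using trans_R[OF _ _ m] st tu by (auto simp: lex_prod_rel_def)
  moreover have "(s, u) \<in> S" if "(u, s) \<in> R"
  proof -
    have "(t, s) \<in> R" "(u, t) \<in> R"
      using trans_R[of t u s] trans_R[of u s t] that st tu m by (auto simp: lex_prod_rel_def)
    then show ?thesis using trans_S[OF _ _ m] st tu by (auto simp: lex_prod_rel_def)
  qed
  ultimately show "(s, u) \<in> R \<then>\<then> S" by (auto simp: lex_prod_rel_def)
next
  fix s assume "s \<in> mons V"
  then show "(0, s) \<in> R \<then>\<then> S"
    using compatible_preorderD(3)[OF R] compatible_preorderD(3)[OF S] by (simp add: lex_prod_rel_def)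
qed

lemma compatible_preorder_lex_list:
  "(\<And>R. R \<in> set Rs \<Longrightarrow> compatible_preorder V R) \<Longrightarrow> compatible_preorder V (foldr (\<then>\<then>) Rs UNIV)"
  by (induction Rs) (auto intro: compatible_preorder_lex)

lemma lex_listI: "(\<And>R. R \<in> set Rs \<Longrightarrow> (s, t) \<in> R) \<Longrightarrow> (s, t) \<in> foldr (\<then>\<then>) Rs UNIV"
  by (induction Rs) (auto simp: lex_prod_rel_def)

lemma lex_list_eqD:
  "\<lbrakk>(s, t) \<in> foldr (\<then>\<then>) Rs UNIV; (t, s) \<in> foldr (\<then>\<then>) Rs UNIV; R \<in> set Rs\<rbrakk> \<Longrightarrow> (s, t) \<in> R"
  by (induction Rs) (auto simp: lex_prod_rel_def)

lemma compatible_preorder_pullback: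
  assumes ord: "monomial_order W ord" and h: "\<And>s. s \<in> mons V \<Longrightarrow> h s \<in> mons W"
    and [simp]: "h 0 = 0" "\<And>s t. h (s + t) = h s + h t"
  shows "compatible_preorder V {(s, t). (h s, h t) \<in> ord}"
  unfolding compatible_preorder_def
proof (intro conjI ballI impI)
  fix s t u assume m: "s \<in> mons V" "t \<in> mons V" "u \<in> mons V"
  show "(s, t) \<in> {(s, t). (h s, h t) \<in> ord} \<or> (t, s) \<in> {(s, t). (h s, h t) \<in> ord}"
    using monomial_order_total[OF ord h h] m by simp
  show "(s, u) \<in> {(s, t). (h s, h t) \<in> ord}"
    if "(s, t) \<in> {(s, t). (h s, h t) \<in> ord}" "(t, u) \<in> {(s, t). (h s, h t) \<in> ord}"
    using that monomial_order_trans[OF ord] by auto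
  show "(0, s) \<in> {(s, t). (h s, h t) \<in> ord}"
    using ord m h by (simp add: monomial_order_def)
  \<comment> \<open>\<open>monomial_order\<close> only states that addition preserves the order;
    cancellation comes from totality and antisymmetry.\<close>
  have "(h s, h t) \<in> ord" if "(h s + h u, h t + h u) \<in> ord"
  proof (rule ccontr)
    assume n: "(h s, h t) \<notin> ord"
    then have "(h t, h s) \<in> ord" using monomial_order_total[OF ord h h] m by blast
    then have "(h t + h u, h s + h u) \<in> ord" using monomial_order_plus[OF ord] m h by blast
    then have "h t + h u = h s + h u" using that monomial_order_antisym[OF ord] by blast
    then show False using n \<open>(h t, h s) \<in> ord\<close> by simp
  qed
  moreover have "(h s + h u, h t + h u) \<in> ord" if "(h s, h t) \<in> ord"
    using monomial_order_plus[OF ord that] m h by blast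
  ultimately show "((s + u, t + u) \<in> {(s, t). (h s, h t) \<in> ord}) = ((s, t) \<in> {(s, t). (h s, h t) \<in> ord})"
    by auto
qed

lemma compatible_preorder_weight:
  fixes f :: "'v mon \<Rightarrow> int"
  assumes "\<And>s. s \<in> mons V \<Longrightarrow> 0 \<le> f s" "f 0 = 0" "\<And>s t. f (s + t) = f s + f t"
  shows "compatible_preorder V {(s, t). f s \<le> f t}"
  using assms by (auto simp: compatible_preorder_def)

text \<open>A lexicographic comparison of exponents, built one variable at a time, to break the ties
  that the four stages leave.\<close>

lemma compatible_preorder_separating:
  assumes "finite F"
  shows "\<exists>R. compatible_preorder V R \<and>
    (\<forall>s t. (s, t) \<in> R \<longrightarrow> (t, s) \<in> R \<longrightarrow> (\<forall>v\<in>F. Poly_Mapping.lookup s v = Poly_Mapping.lookup t v))"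
  using assms
proof (induction F)
  case empty
  show ?case by (rule exI[of _ UNIV]) simp
next
  case (insert v F)
  then obtain R where R: "compatible_preorder V R"
    "\<forall>s t. (s, t) \<in> R \<longrightarrow> (t, s) \<in> R \<longrightarrow> (\<forall>v\<in>F. Poly_Mapping.lookup s v = Poly_Mapping.lookup t v)"
    by blast
  let ?R = "{(s, t). int (Poly_Mapping.lookup s v) \<le> int (Poly_Mapping.lookup t v)}"
  have "compatible_preorder V ?R"
    by (rule compatible_preorder_weight) (auto simp: lookup_add)
  then have "compatible_preorder V (?R \<then>\<then> R)" using R by (intro compatible_preorder_lex)
  moreover have "\<forall>u\<in>insert v F. Poly_Mapping.lookup s u = Poly_Mapping.lookup t u"
    if "(s, t) \<in> ?R \<then>\<then> R" "(t, s) \<in> ?R \<then>\<then> R" for s t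
    using that R(2) by (auto simp: lex_prod_rel_def)
  ultimately show ?case by blast
qed

text \<open>Ties of \<open>R\<close> are broken by \<open>T\<close>, which separates monomials over
  \<open>V\<close>; strict inequalities of \<open>R\<close> are decided before \<open>T\<close> is
  consulted.\<close>

lemma monomial_order_refines:
  assumes "finite V" "compatible_preorder V R"
  shows "\<exists>ord. monomial_order V ord \<and>
    (\<forall>s\<in>mons V. \<forall>t\<in>mons V. (s, t) \<in> R \<longrightarrow> (t, s) \<notin> R \<longrightarrow> (s, t) \<in> ord)"
proof -
  obtain T where T: "compatible_preorder V T" "\<And>s t v. (s, t) \<in> T \<Longrightarrow> (t, s) \<in> T \<Longrightarrow> v \<in> V \<Longrightarrow>
      Poly_Mapping.lookup s v = Poly_Mapping.lookup t v"
    using compatible_preorder_separating[OF assms(1), where V=V] by blast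
  let ?S = "R \<then>\<then> T"
  have S: "compatible_preorder V ?S" using assms T by (intro compatible_preorder_lex)
  have anti: "s = t" if st: "(s, t) \<in> ?S" "(t, s) \<in> ?S" and m: "s \<in> mons V" "t \<in> mons V" for s t
  proof (rule poly_mapping_eqI)
    fix v
    have "(s, t) \<in> T" "(t, s) \<in> T" using st by (auto simp: lex_prod_rel_def)
    moreover have "Poly_Mapping.lookup u v = 0" if "v \<notin> V" "u \<in> mons V" for u
      using that by (auto simp: mons_def in_keys_iff)
    ultimately show "Poly_Mapping.lookup s v = Poly_Mapping.lookup t v"
      using T(2)[of s t v] m by (cases "v \<in> V") auto
  qed
  \<comment> \<open>A linear order on \<open>mons V\<close> may relate only elements of
    \<open>mons V\<close>, hence the intersection.\<close>
  have "monomial_order V (?S \<inter> mons V \<times> mons V)"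
    unfolding monomial_order_def linear_order_on_def partial_order_on_def preorder_on_def
  proof (intro conjI)
    show "refl_on (mons V) (?S \<inter> mons V \<times> mons V)"
      using compatible_preorderD(1)[OF S] by (auto simp: refl_on_def)
    show "trans (?S \<inter> mons V \<times> mons V)"
    proof (rule transI)
      fix s t u assume "(s, t) \<in> ?S \<inter> mons V \<times> mons V" "(t, u) \<in> ?S \<inter> mons V \<times> mons V"
      then show "(s, u) \<in> ?S \<inter> mons V \<times> mons V" using compatible_preorderD(2)[OF S, of s t u] by blast
    qed
    show "antisym (?S \<inter> mons V \<times> mons V)" using anti by (auto intro: antisymI)
    show "total_on (mons V) (?S \<inter> mons V \<times> mons V)"
      using compatible_preorderD(1)[OF S] by (auto simp: total_on_def)
    show "\<forall>s\<in>mons V. (0, s) \<in> ?S \<inter> mons V \<times> mons V"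
      using compatible_preorderD(3)[OF S] by simp
    show "\<forall>s\<in>mons V. \<forall>t\<in>mons V. \<forall>u\<in>mons V. (s, t) \<in> ?S \<inter> mons V \<times> mons V \<longrightarrow>
        (s + u, t + u) \<in> ?S \<inter> mons V \<times> mons V"
      using compatible_preorderD(4)[OF S] by (simp add: plus_in_mons_iff)
  qed blast
  then show ?thesis by (intro exI[of _ "?S \<inter> mons V \<times> mons V"]) (auto simp: lex_prod_rel_def)
qed

section \<open>Sorting words\<close>

text \<open>Cumulative counts suit sorting: they determine a word up to the order of its letters
  (\<open>mset_eq_if_cnt_le_eq\<close>), and dealing out a sorted word alternately to two words
  halves them, rounding up and down (\<open>cnt_le_parts\<close>).\<close>

definition cnt_le :: "'a::linorder list \<Rightarrow> 'a \<Rightarrow> nat" where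
  "cnt_le w c = length (filter (\<lambda>x. x \<le> c) w)"

text \<open>Odd and even refer to positions counted from one, as in the binomials of type (2); list
  indices start at zero.\<close>

definition odd_part :: "'a list \<Rightarrow> nat \<Rightarrow> 'a list" where
  "odd_part v r = map (\<lambda>l. v ! (2 * l)) [0..<r]"

definition even_part :: "'a list \<Rightarrow> nat \<Rightarrow> 'a list" where
  "even_part v r = map (\<lambda>l. v ! (2 * l + 1)) [0..<r]"

lemma parts_Cons:
  "odd_part (x # y # v) (Suc r) = x # odd_part v r"
  "even_part (x # y # v) (Suc r) = y # even_part v r"
  by (simp_all add: odd_part_def even_part_def map_upt_Suc One_nat_def del: upt_Suc)

lemma mset_parts: "length v = 2 * r \<Longrightarrow> mset (odd_part v r) + mset (even_part v r) = mset v"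
proof (induction r arbitrary: v)
  case 0
  then show ?case by (simp add: odd_part_def even_part_def)
next
  case (Suc r)
  then obtain x y v' where "v = x # y # v'" "length v' = 2 * r"
    by (metis length_Suc_conv mult_Suc_right add_2_eq_Suc)
  then show ?case using Suc.IH[of v'] by (auto simp: parts_Cons)
qed

text \<open>In a sorted word the letters satisfying a downward closed \<open>P\<close> form an
  initial segment, which alternation splits into halves, an extra letter going to the first part.
  The predicate is general because both \<open>x \<le> c\<close> and \<open>fst x \<le> c\<close>
  are needed.\<close>

lemma count_parts:
  fixes v :: "'a::linorder list"
  assumes "sorted v" "length v = 2 * r" "\<And>x y. x \<le> y \<Longrightarrow> P y \<Longrightarrow> P x"
  shows "length (filter P (odd_part v r)) = (length (filter P v) + 1) div 2"
    and "length (filter P (even_part v r)) = length (filter P v) div 2"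
proof -
  have "length (filter P (odd_part v r)) = (length (filter P v) + 1) div 2 \<and>
        length (filter P (even_part v r)) = length (filter P v) div 2"
    using assms(1,2)
  proof (induction r arbitrary: v)
    case 0
    then show ?case by (simp add: odd_part_def even_part_def)
  next
    case (Suc r)
    then obtain x y v' where v: "v = x # y # v'" "length v' = 2 * r"
      by (metis length_Suc_conv mult_Suc_right add_2_eq_Suc)
    have xy: "x \<le> y" "\<forall>z\<in>set v'. y \<le> z" "sorted v'" using Suc.prems v by auto
    have IH: "length (filter P (odd_part v' r)) = (length (filter P v') + 1) div 2"
        "length (filter P (even_part v' r)) = length (filter P v') div 2"
      using Suc.IH[OF xy(3) v(2)] by auto
    show ?case
    proof (cases "P y")
      case True
      then have "P x" using assms(3) xy by blast
      then show ?thesis using True IH by (simp add: v parts_Cons)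
    next
      case False
      then have "filter P v' = []" using assms(3) xy(2) by (auto simp: filter_empty_conv)
      then show ?thesis using False IH by (simp add: v parts_Cons)
    qed
  qed
  then show "length (filter P (odd_part v r)) = (length (filter P v) + 1) div 2"
    and "length (filter P (even_part v r)) = length (filter P v) div 2" by auto
qed

lemma cnt_le_parts:
  fixes v :: "'a::linorder list"
  assumes "sorted v" "length v = 2 * r"
  shows "cnt_le (odd_part v r) c = (cnt_le v c + 1) div 2"
    and "cnt_le (even_part v r) c = cnt_le v c div 2"
  unfolding cnt_le_def using assms by (rule count_parts; auto)+

lemma filter_mset_length: "length (filter P w) = size (filter_mset P (mset w))"
  by (simp flip: mset_filter)

lemma cnt_le_cong: "mset w = mset w' \<Longrightarrow> cnt_le w c = cnt_le w' c"
  by (simp add: cnt_le_def filter_mset_length)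

lemma cnt_le_append [simp]: "cnt_le (w @ w') c = cnt_le w c + cnt_le w' c"
  by (simp add: cnt_le_def)

lemma cnt_le_sort [simp]: "cnt_le (sort w) c = cnt_le w c"
  by (rule cnt_le_cong) simp

text \<open>The multiplicity of \<open>c\<close> is \<open>cnt_le w c\<close> minus the number of
  smaller letters, which induction on \<open>c\<close> has already matched. Testing occurring
  letters suffices, since any other letter has multiplicity zero in both words.\<close>

lemma mset_eq_if_cnt_le_eq:
  fixes w w' :: "'a::wellorder list"
  assumes "\<And>c. c \<in> set w \<union> set w' \<Longrightarrow> cnt_le w c = cnt_le w' c"
  shows "mset w = mset w'"
proof (rule multiset_eqI)
  fix c
  show "count (mset w) c = count (mset w') c"
  proof (induction c rule: less_induct)
    case (less c)
    have split: "cnt_le u c = size (filter_mset (\<lambda>x. x < c) (mset u)) + count (mset u) c" for u :: "'a list"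
    proof -
      have "filter_mset (\<lambda>x. x \<le> c) M = filter_mset (\<lambda>x. x < c) M + replicate_mset (count M c) c" for M
        by (rule multiset_eqI) (auto simp: not_less_iff_gr_or_eq)
      then show ?thesis by (simp add: cnt_le_def filter_mset_length)
    qed
    have "filter_mset (\<lambda>x. x < c) (mset w) = filter_mset (\<lambda>x. x < c) (mset w')"
      using less by (intro multiset_eqI) simp
    then show ?case
      using assms[of c] split[of w] split[of w'] by (metis UnI1 UnI2 add_left_cancel count_mset_0_iff)
  qed
qed

text \<open>The difference of two cumulative counts is, up to sign, the number of letters in the
  half-open interval between \<open>b\<close> and \<open>c\<close>. The sum runs over ordered pairs,
  so each interval counts twice.\<close>

definition energy :: "'a::linorder set \<Rightarrow> 'a list \<Rightarrow> int" where
  "energy L w = (\<Sum>b\<in>L. \<Sum>c\<in>L. (int (cnt_le w b) - int (cnt_le w c))\<^sup>2)"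

lemma energy_nonneg: "0 \<le> energy L w"
  by (simp add: energy_def sum_nonneg)

lemma energy_cong: "mset w = mset w' \<Longrightarrow> energy L w = energy L w'"
  unfolding energy_def by (simp add: cnt_le_cong[of w w'])

text \<open>With the sum fixed, the squares depend only on the difference, by \<open>2 * (u\<^sup>2
  + v\<^sup>2) = (u + v)\<^sup>2 + \<bar>u - v\<bar>\<^sup>2\<close>. The parity of the difference
  is fixed too, so a difference of at most one is the smallest possible.\<close>

lemma balanced_squares:
  fixes x y x' y' :: int
  assumes "x + y = x' + y'" "\<bar>x' - y'\<bar> \<le> 1"
  shows "x'\<^sup>2 + y'\<^sup>2 \<le> x\<^sup>2 + y\<^sup>2"
    and "x'\<^sup>2 + y'\<^sup>2 = x\<^sup>2 + y\<^sup>2 \<Longrightarrow> \<bar>x - y\<bar> = \<bar>x' - y'\<bar>"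
proof -
  have *: "2 * (u\<^sup>2 + v\<^sup>2) = (u + v)\<^sup>2 + \<bar>u - v\<bar>\<^sup>2" for u v :: int
    by (simp add: power2_eq_square algebra_simps)
  have "even (x - y) \<longleftrightarrow> even (x' - y')" using assms(1)
    by (metis even_add even_diff)
  then have "\<bar>x' - y'\<bar> \<le> \<bar>x - y\<bar>" using assms(2) by presburger
  then have "\<bar>x' - y'\<bar>\<^sup>2 \<le> \<bar>x - y\<bar>\<^sup>2" by (intro power_mono) auto
  then show "x'\<^sup>2 + y'\<^sup>2 \<le> x\<^sup>2 + y\<^sup>2" using *[of x y] *[of x' y'] assms(1) by simp
  assume "x'\<^sup>2 + y'\<^sup>2 = x\<^sup>2 + y\<^sup>2"
  then have "\<bar>x - y\<bar>\<^sup>2 = \<bar>x' - y'\<bar>\<^sup>2" using *[of x y] *[of x' y'] assms(1) by simp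
  then show "\<bar>x - y\<bar> = \<bar>x' - y'\<bar>" by (auto simp: power2_eq_iff)
qed

text \<open>
  Sorting two words balances the number of their letters in every interval, so it does not
  increase the sum of the squares of these numbers.
\<close>

lemma energy_sort:
  fixes w1 w2 :: "'a::wellorder list"
  assumes L: "finite L" "set w1 \<union> set w2 \<subseteq> L" and c0: "c0 \<in> L" "\<forall>c\<in>set w1 \<union> set w2. c0 < c"
    and len: "length w1 = r" "length w2 = r" and v: "v = sort (w1 @ w2)"
  shows "energy L (odd_part v r) + energy L (even_part v r) \<le> energy L w1 + energy L w2"
    and "energy L (odd_part v r) + energy L (even_part v r) = energy L w1 + energy L w2 \<Longrightarrow>
      mset w1 = mset (odd_part v r) \<and> mset w2 = mset (even_part v r) \<or>
      mset w1 = mset (even_part v r) \<and> mset w2 = mset (odd_part v r)"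
proof -
  let ?w1 = "odd_part v r" and ?w2 = "even_part v r"
  have sv: "sorted v" "length v = 2 * r" using v len by auto
  have N: "cnt_le v c = cnt_le w1 c + cnt_le w2 c" for c by (simp add: v)
  note parts = cnt_le_parts[OF sv]
  define D where "D w b c = int (cnt_le w b) - int (cnt_le w c)" for w :: "'a list" and b c
  define \<delta> where "\<delta> c = int (cnt_le v c mod 2)" for c
  have \<delta>: "\<delta> c = int (cnt_le ?w1 c) - int (cnt_le ?w2 c)" for c
    unfolding parts \<delta>_def by presburger
  have d01: "\<delta> c = 0 \<or> \<delta> c = 1" for c unfolding \<delta>_def by presburger
  have sum_eq: "int (cnt_le w1 c) + int (cnt_le w2 c) = int (cnt_le ?w1 c) + int (cnt_le ?w2 c)" for c
    unfolding parts N by presburger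
  have eq: "D w1 b c + D w2 b c = D ?w1 b c + D ?w2 b c" for b c
    using sum_eq[of b] sum_eq[of c] by (simp add: D_def)
  have diff: "D ?w1 b c - D ?w2 b c = \<delta> b - \<delta> c" for b c
    by (simp add: D_def \<delta>)
  have bal: "\<bar>D ?w1 b c - D ?w2 b c\<bar> \<le> 1" for b c
    using d01[of b] d01[of c] by (auto simp: diff)
  have E: "energy L u1 + energy L u2 = (\<Sum>b\<in>L. \<Sum>c\<in>L. (D u1 b c)\<^sup>2 + (D u2 b c)\<^sup>2)" for u1 u2
    by (simp add: energy_def D_def sum.distrib)
  have le: "(D ?w1 b c)\<^sup>2 + (D ?w2 b c)\<^sup>2 \<le> (D w1 b c)\<^sup>2 + (D w2 b c)\<^sup>2" for b c
    by (rule balanced_squares(1)[OF eq bal])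
  show "energy L ?w1 + energy L ?w2 \<le> energy L w1 + energy L w2"
    unfolding E by (intro sum_mono le)
  \<comment> \<open>No summand increases under sorting, so equal totals mean equal summands: the
    original pair is as balanced as the sorted one on every interval.\<close>
  assume eq_energy: "energy L ?w1 + energy L ?w2 = energy L w1 + energy L w2"
  have "(D ?w1 b c)\<^sup>2 + (D ?w2 b c)\<^sup>2 = (D w1 b c)\<^sup>2 + (D w2 b c)\<^sup>2" if bc: "b \<in> L" "c \<in> L" for b c
  proof -
    have "(\<Sum>c\<in>L. (D ?w1 b c)\<^sup>2 + (D ?w2 b c)\<^sup>2) = (\<Sum>c\<in>L. (D w1 b c)\<^sup>2 + (D w2 b c)\<^sup>2)"
      by (rule sum_mono_inv[OF eq_energy[unfolded E] _ bc(1) L(1)]) (intro sum_mono le)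
    then show ?thesis by (rule sum_mono_inv[OF _ le bc(2) L(1)])
  qed
  then have abs_eq: "\<bar>D w1 b c - D w2 b c\<bar> = \<bar>\<delta> b - \<delta> c\<bar>" if "b \<in> L" "c \<in> L" for b c
    using balanced_squares(2)[OF eq bal] that by (simp add: diff)
  define \<epsilon> where "\<epsilon> c = int (cnt_le w1 c) - int (cnt_le w2 c)" for c
  have \<epsilon>_diff: "\<bar>\<epsilon> b - \<epsilon> c\<bar> = \<bar>\<delta> b - \<delta> c\<bar>" if "b \<in> L" "c \<in> L" for b c
    using abs_eq[OF that] by (simp add: D_def \<epsilon>_def algebra_simps)
  \<comment> \<open>The letter \<open>c0\<close> lies below all letters of both words. Both
    differences vanish there, which turns the statement about
    \<open>\<epsilon> b - \<epsilon> c\<close> into one about \<open>\<epsilon>\<close>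
    itself.\<close>
  have "cnt_le w1 c0 = 0" "cnt_le w2 c0 = 0"
    using c0 by (fastforce simp: cnt_le_def filter_empty_conv dest: leD)+
  then have "\<epsilon> c0 = 0" "\<delta> c0 = 0" by (simp_all add: \<epsilon>_def \<delta>_def N)
  then have \<epsilon>_abs: "\<bar>\<epsilon> c\<bar> = \<delta> c" if "c \<in> L" for c
    using \<epsilon>_diff[OF that c0(1)] d01[of c] by auto
  have sets: "set ?w1 \<union> set ?w2 \<subseteq> L"
    using mset_parts[OF sv(2)] L(2) by (metis v set_append set_mset_mset set_mset_union set_sort)
  \<comment> \<open>The sign is the same at all letters: \<open>\<epsilon> b = -1\<close> and
    \<open>\<epsilon> c = 1\<close> would differ by 2, while
    \<open>\<delta> b = \<delta> c = 1\<close>. The common sign tells which of the two words is the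
    odd part.\<close>
  have "(\<forall>c\<in>L. \<epsilon> c = \<delta> c) \<or> (\<forall>c\<in>L. \<epsilon> c = - \<delta> c)"
  proof (rule ccontr)
    assume "\<not> ?thesis"
    then obtain b c where bc: "b \<in> L" "c \<in> L" "\<epsilon> b \<noteq> \<delta> b" "\<epsilon> c \<noteq> - \<delta> c" by blast
    then show False
      using \<epsilon>_abs[of b] \<epsilon>_abs[of c] \<epsilon>_diff[of b c] d01[of b] d01[of c] by auto
  qed
  then show "mset w1 = mset ?w1 \<and> mset w2 = mset ?w2 \<or> mset w1 = mset ?w2 \<and> mset w2 = mset ?w1"
  proof
    assume "\<forall>c\<in>L. \<epsilon> c = \<delta> c"
    then have "cnt_le w1 c = cnt_le ?w1 c \<and> cnt_le w2 c = cnt_le ?w2 c" if "c \<in> L" for c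
      using that sum_eq[of c] unfolding \<epsilon>_def \<delta> by force
    then show ?thesis using sets L(2) by (auto intro!: mset_eq_if_cnt_le_eq)
  next
    assume "\<forall>c\<in>L. \<epsilon> c = - \<delta> c"
    then have "cnt_le w1 c = cnt_le ?w2 c \<and> cnt_le w2 c = cnt_le ?w1 c" if "c \<in> L" for c
      using that sum_eq[of c] unfolding \<epsilon>_def \<delta> by force
    then show ?thesis using sets L(2) by (auto intro!: mset_eq_if_cnt_le_eq)
  qed
qed

text \<open>The disjunction stands outside the quantifier: the same word dominates at every letter.
  This is how the two halves of a sorted word are related.\<close>

definition interlaced :: "'a::linorder list \<Rightarrow> 'a list \<Rightarrow> bool" where
  "interlaced w w' \<longleftrightarrow>
     (\<forall>c. cnt_le w' c \<le> cnt_le w c \<and> cnt_le w c \<le> cnt_le w' c + 1) \<or>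
     (\<forall>c. cnt_le w c \<le> cnt_le w' c \<and> cnt_le w' c \<le> cnt_le w c + 1)"

lemma interlaced_refl: "interlaced w w"
  by (simp add: interlaced_def)

lemma interlaced_parts:
  fixes v :: "'a::linorder list"
  assumes "sorted v" "length v = 2 * r"
  shows "interlaced (odd_part v r) (even_part v r)" "interlaced (even_part v r) (odd_part v r)"
proof -
  have "(n + 1) div 2 \<ge> n div 2" "(n + 1) div 2 \<le> n div 2 + 1" for n :: nat by presburger+
  then show "interlaced (odd_part v r) (even_part v r)" "interlaced (even_part v r) (odd_part v r)"
    by (simp_all add: interlaced_def cnt_le_parts[OF assms])
qed

lemma interlaced_cong: "mset w = mset u \<Longrightarrow> mset w' = mset u' \<Longrightarrow> interlaced w w' = interlaced u u'"
  unfolding interlaced_def by (simp add: cnt_le_cong[of w u] cnt_le_cong[of w' u'])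

text \<open>If \<open>f i < g i\<close> at one place, then \<open>f j \<le> g j\<close> everywhere:
  before \<open>i\<close> by \<open>f j \<le> f i + 1 \<le> g i \<le> g j\<close>, after it by
  \<open>f j \<le> f i < g i \<le> g j + 1\<close>. The sums would then differ.\<close>

lemma near_constant_seq_unique:
  fixes f g :: "nat \<Rightarrow> nat"
  assumes f: "\<And>i j. i \<le> j \<Longrightarrow> j < p \<Longrightarrow> f j \<le> f i \<and> f i \<le> f j + 1"
    and g: "\<And>i j. i \<le> j \<Longrightarrow> j < p \<Longrightarrow> g j \<le> g i \<and> g i \<le> g j + 1"
    and sum: "(\<Sum>i<p. f i) = (\<Sum>i<p. g i)" and i: "i < p"
  shows "f i = g i"
proof -
  have "\<not> f i < g i" if f: "\<And>i j. i \<le> j \<Longrightarrow> j < p \<Longrightarrow> f j \<le> f i \<and> f i \<le> f j + 1"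
    and g: "\<And>i j. i \<le> j \<Longrightarrow> j < p \<Longrightarrow> g j \<le> g i \<and> g i \<le> g j + 1"
    and sum: "(\<Sum>i<p. f i) = (\<Sum>i<p. g i)" for f g :: "nat \<Rightarrow> nat"
  proof
    assume lt: "f i < g i"
    have "f j \<le> g j" if "j < p" for j
    proof (cases "j \<le> i")
      case True
      then show ?thesis using f[OF True i] g[OF True i] lt by linarith
    next
      case False
      then have "i \<le> j" by simp
      then show ?thesis using f[OF _ that] g[OF _ that] lt by fastforce
    qed
    then have "(\<Sum>i<p. f i) < (\<Sum>i<p. g i)"
      using lt i by (intro sum_strict_mono_ex1) auto
    then show False using sum by simp
  qed
  from this[of f g] this[of g f] f g sum show ?thesis by (metis linorder_neqE_nat)
qed

text \<open>Arrange the words by decreasing total count. For each letter \<open>c\<close> the values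
  \<open>cnt_le w c\<close> then decrease weakly, by at most one in all, and their sum is the count
  in the concatenation; \<open>near_constant_seq_unique\<close> recovers every value.\<close>

lemma pairwise_interlaced_unique:
  fixes ws us :: "'a::wellorder list list"
  assumes ws: "\<And>w w'. w \<in> set ws \<Longrightarrow> w' \<in> set ws \<Longrightarrow> interlaced w w'"
    and us: "\<And>w w'. w \<in> set us \<Longrightarrow> w' \<in> set us \<Longrightarrow> interlaced w w'"
    and len: "length ws = length us" and letters: "mset (concat ws) = mset (concat us)"
  shows "image_mset mset (mset ws) = image_mset mset (mset us)"
proof -
  define L where "L = set (concat ws)"
  have fin: "finite L" by (simp add: L_def)
  have L: "set w \<subseteq> L" if "w \<in> set ws \<union> set us" for w
  proof -
    have "set (concat ws) = set (concat us)" using letters by (rule mset_eq_setD)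
    then show ?thesis using that by (auto simp: L_def)
  qed
  \<comment> \<open>The minus sign makes \<open>sort_key\<close> put dominating words first; for an
    interlaced pair the total count over \<open>L\<close> shows which word dominates.\<close>
  define key where "key w = - int (\<Sum>c\<in>L. cnt_le w c)" for w
  have mono: "cnt_le (ys ! j) c \<le> cnt_le (ys ! i) c \<and> cnt_le (ys ! i) c \<le> cnt_le (ys ! j) c + 1"
    if ij: "i \<le> j" "j < length ys" and ys: "ys = sort_key key xs" and c: "c \<in> L"
      and il: "\<And>w w'. w \<in> set xs \<Longrightarrow> w' \<in> set xs \<Longrightarrow> interlaced w w'" for xs ys i j c
  proof -
    let ?w = "ys ! i" and ?u = "ys ! j"
    have in_set: "?w \<in> set xs" "?u \<in> set xs" using ij unfolding ys
      by (metis le_less_trans nth_mem set_sort)+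
    have "sorted (map key ys)" by (simp add: ys)
    then have "key ?w \<le> key ?u" using ij sorted_nth_mono[of "map key ys" i j] by simp
    then have le: "(\<Sum>c\<in>L. cnt_le ?u c) \<le> (\<Sum>c\<in>L. cnt_le ?w c)" unfolding key_def by linarith
    from il[OF in_set] show ?thesis unfolding interlaced_def
    proof
      \<comment> \<open>Domination in the unexpected direction is compatible with the keys only if
        all counts over \<open>L\<close> agree.\<close>
      assume *: "\<forall>c. cnt_le ?w c \<le> cnt_le ?u c \<and> cnt_le ?u c \<le> cnt_le ?w c + 1"
      then have "(\<Sum>c\<in>L. cnt_le ?w c) \<le> (\<Sum>c\<in>L. cnt_le ?u c)" by (intro sum_mono) auto
      then have "cnt_le ?w c = cnt_le ?u c"
        using sum_mono_inv[of "cnt_le ?w" L "cnt_le ?u" c] * le c fin by auto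
      then show ?thesis by simp
    qed auto
  qed
  define ys zs where "ys = sort_key key ws" and "zs = sort_key key us"
  have len': "length ys = length ws" "length zs = length ws" using len by (simp_all add: ys_def zs_def)
  have col: "(\<Sum>i<length ys. cnt_le (ys ! i) c) = cnt_le (concat ys) c" for ys :: "'a list list" and c
    by (induction ys rule: rev_induct) (auto simp: cnt_le_def nth_append)
  have "mset (concat ys) = mset (concat ws)" "mset (concat zs) = mset (concat us)"
    by (simp_all add: ys_def zs_def mset_concat sum_mset_sum_list[symmetric])
  then have col_eq: "cnt_le (concat ys) c = cnt_le (concat zs) c" for c
    using letters by (intro cnt_le_cong) simp
  have "mset (ys ! i) = mset (zs ! i)" if i: "i < length ws" for i
  proof (rule mset_eq_if_cnt_le_eq)
    fix c assume c: "c \<in> set (ys ! i) \<union> set (zs ! i)"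
    have "ys ! i \<in> set ws" "zs ! i \<in> set us" using i len'
      by (metis ys_def nth_mem set_sort, metis zs_def nth_mem set_sort)
    then have cL: "c \<in> L" using c L by blast
    show "cnt_le (ys ! i) c = cnt_le (zs ! i) c"
    proof (rule near_constant_seq_unique[of "length ws" "\<lambda>i. cnt_le (ys ! i) c" "\<lambda>i. cnt_le (zs ! i) c", OF _ _ _ i])
      show "(\<Sum>i<length ws. cnt_le (ys ! i) c) = (\<Sum>i<length ws. cnt_le (zs ! i) c)"
        using col[of ys c] col[of zs c] col_eq len' by simp
    qed (use mono[OF _ _ ys_def cL ws] mono[OF _ _ zs_def cL us] len' in auto)
  qed
  then have "map mset ys = map mset zs" using len' by (intro nth_equalityI) auto
  then have "mset (map mset ys) = mset (map mset zs)" by simp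
  then show ?thesis by (simp add: ys_def zs_def)
qed

text \<open>Sorting inside each block makes the whole concatenation sorted, hence determined by its
  multiset; the lengths then tell where to cut.\<close>

lemma ordered_blocks_unique:
  fixes xss yss :: "'a::linorder list list"
  assumes len: "map length xss = map length yss" and elems: "mset (concat xss) = mset (concat yss)"
    and "sorted_wrt (\<lambda>xs ys. \<forall>x\<in>set xs. \<forall>y\<in>set ys. x \<le> y) xss"
    and "sorted_wrt (\<lambda>xs ys. \<forall>x\<in>set xs. \<forall>y\<in>set ys. x \<le> y) yss"
  shows "map mset xss = map mset yss"
proof -
  have sorted: "sorted (concat (map sort xss))"
    if "sorted_wrt (\<lambda>xs ys. \<forall>x\<in>set xs. \<forall>y\<in>set ys. x \<le> y) xss" for xss :: "'a list list"
    using that by (induction xss) (auto simp: sorted_append)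
  have ms: "mset (concat (map sort xss)) = mset (concat xss)" for xss :: "'a list list"
    by (induction xss) auto
  have "concat (map sort xss) = concat (map sort yss)"
    using sorted[OF assms(3)] sorted[OF assms(4)] elems ms[of xss] ms[of yss]
    by (metis properties_for_sort)
  moreover have "length xss = length yss" using len by (metis length_map)
  moreover have "\<forall>(x, y)\<in>set (zip (map sort xss) (map sort yss)). length x = length y"
    using len by (auto simp: set_zip) (metis length_map nth_map)
  ultimately have "map sort xss = map sort yss" by (intro concat_injective) auto
  then have "map mset (map sort xss) = map mset (map sort yss)" by simp
  then show ?thesis by (simp add: comp_def)
qed


section \<open>Splitting and distributing letters\<close>

lemma list_split_lengths:
  "length ys = sum_list qs \<Longrightarrow> \<exists>yss. map length yss = qs \<and> concat yss = ys"
proof (induction qs arbitrary: ys)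
  case (Cons q qs)
  then obtain yss where "map length yss = qs" "concat yss = drop q ys"
    by (metis add_diff_cancel_left' length_drop sum_list.Cons)
  then show ?case using Cons.prems by (intro exI[of _ "take q ys # yss"]) auto
qed simp

text \<open>For type (1): a supply of letters is dealt out to words whose first components are
  prescribed, which is possible as soon as the first components match in total.\<close>

lemma image_mset_eq_sum_listD:
  "image_mset f M = (\<Sum>x\<leftarrow>xs. A x) \<Longrightarrow>
     \<exists>Ms. length Ms = length xs \<and> (\<forall>l<length xs. image_mset f (Ms ! l) = A (xs ! l)) \<and> M = sum_list Ms"
proof (induction xs arbitrary: M)
  case (Cons x xs)
  then obtain M1 M2 where M: "M = M1 + M2" "image_mset f M1 = A x" "image_mset f M2 = (\<Sum>x\<leftarrow>xs. A x)"
    using image_mset_eq_plusD[of f M] by (metis list.simps(9) sum_list.Cons)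
  from Cons.IH[OF M(3)] obtain Ms where "length Ms = length xs"
    "\<forall>l<length xs. image_mset f (Ms ! l) = A (xs ! l)" "M2 = sum_list Ms" by blast
  then show ?case using M by (intro exI[of _ "M1 # Ms"]) (auto simp: nth_Cons split: nat.split)
qed simp

lemma subset_mset_plusD:
  "A \<subseteq># B + C \<Longrightarrow> \<exists>A1 A2. A = A1 + A2 \<and> A1 \<subseteq># B \<and> A2 \<subseteq># C"
  by (rule exI[of _ "A \<inter># B"], rule exI[of _ "A - B"])
    (auto simp: multiset_eq_iff subseteq_mset_def, metis add.commute le_diff_conv)

text \<open>For type (4): a monomial dividing a product is shared out among the factors. Factors
  that contribute nothing are dropped, because type (4) demands \<open>q l \<ge> 1\<close>; hence
  only a submultiset of \<open>xs\<close> remains.\<close>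

lemma subset_mset_sum_listD:
  "A \<subseteq># (\<Sum>x\<leftarrow>xs. B x) \<Longrightarrow>
     \<exists>ys. A = (\<Sum>(x, C)\<leftarrow>ys. C) \<and> (\<forall>(x, C)\<in>set ys. C \<noteq> {#} \<and> C \<subseteq># B x) \<and> mset (map fst ys) \<subseteq># mset xs"
proof (induction xs arbitrary: A)
  case (Cons x xs)
  then obtain A1 A2 where A: "A = A1 + A2" "A1 \<subseteq># B x" "A2 \<subseteq># (\<Sum>x\<leftarrow>xs. B x)"
    using subset_mset_plusD[of A "B x" "\<Sum>x\<leftarrow>xs. B x"] by (simp, blast)
  from Cons.IH[OF A(3)] obtain ys where ys: "A2 = (\<Sum>(x, C)\<leftarrow>ys. C)"
    "\<forall>(x, C)\<in>set ys. C \<noteq> {#} \<and> C \<subseteq># B x" "mset (map fst ys) \<subseteq># mset xs" by blast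
  show ?case
  proof (cases "A1 = {#}")
    case True
    then show ?thesis using A ys
      by (intro exI[of _ ys]) (auto intro: subset_mset.order_trans[of _ "mset xs"])
  next
    case False
    then show ?thesis using A ys by (intro exI[of _ "(x, A1) # ys"]) auto
  qed
qed (auto intro: exI[of _ "[]"])

section \<open>Words and their monomials\<close>

lemma mon_mset_t_mon: "mon_mset (t_mon w) = image_mset fst (mset w)"
  by (induction w) (auto simp: t_mon_def)

lemma mon_mset_z_mon:
  "mon_mset (z_mon i w) = image_mset snd (filter_mset (\<lambda>x. fst x = i) (mset w))"
  by (induction w) (auto simp: z_mon_def)

lemma u_mon_eq_sum_mset: "u_mon m w = (\<Sum>x\<in>#mset w. m (fst x) (snd x))"
  by (simp add: u_mon_def case_prod_unfold flip: sum_mset_sum_list)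

lemma word_mon_append [simp]:
  "t_mon (w @ w') = t_mon w + t_mon w'" "z_mon i (w @ w') = z_mon i w + z_mon i w'"
  "u_mon m (w @ w') = u_mon m w + u_mon m w'"
  by (simp_all add: t_mon_def z_mon_def u_mon_def)

lemma word_mon_concat:
  "t_mon (concat ws) = (\<Sum>w\<leftarrow>ws. t_mon w)" "z_mon i (concat ws) = (\<Sum>w\<leftarrow>ws. z_mon i w)"
  "u_mon m (concat ws) = (\<Sum>w\<leftarrow>ws. u_mon m w)"
  by (induction ws) (simp_all, simp_all add: t_mon_def z_mon_def u_mon_def)

lemma t_mon_cong: "mset w = mset w' \<Longrightarrow> t_mon w = t_mon w'"
  by (simp add: mon_mset_t_mon flip: mon_mset_inject)

lemma z_mon_cong: "mset w = mset w' \<Longrightarrow> z_mon i w = z_mon i w'"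
  by (simp add: mon_mset_z_mon flip: mon_mset_inject)

lemma u_mon_cong: "mset w = mset w' \<Longrightarrow> u_mon m w = u_mon m w'"
  by (simp add: u_mon_eq_sum_mset)

lemma lookup_z_mon: "Poly_Mapping.lookup (z_mon i w) j = count (mset w) (i, j)"
  by (induction w) (auto simp: z_mon_def lookup_add lookup_single when_def split: if_splits)

lemma z_mon_map_Pair: "z_mon i (map (Pair i') js) = (if i' = i then (\<Sum>j\<leftarrow>js. var j) else 0)"
  by (induction js) (auto simp: z_mon_def)

lemma mon_degree_t_mon: "mon_degree (t_mon w) = length w"
  by (simp add: mon_degree_eq_size mon_mset_t_mon)

lemma lookup_t_mon: "Poly_Mapping.lookup (t_mon w) i = mon_degree (z_mon i w)"
  by (induction w) (auto simp: t_mon_def z_mon_def lookup_add lookup_single when_def)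

lemma z_mon_in_mons: "set w \<subseteq> letters d lam \<Longrightarrow> z_mon i w \<in> mons {1..lam i}"
  unfolding mons_iff mon_mset_z_mon by (auto simp: letters_def)

lemma u_mon_eq_sum:
  assumes "set w \<subseteq> letters d lam"
  shows "u_mon m w = (\<Sum>i\<in>{1..d}. lin (m i) (z_mon i w))"
  using assms
proof (induction w)
  case Nil
  then show ?case by (simp add: u_mon_def z_mon_def)
next
  case (Cons x w)
  obtain i j where x: "x = (i, j)" by (cases x)
  then have i: "i \<in> {1..d}" using Cons.prems by (auto simp: letters_def)
  have "z_mon i' (x # w) = (if i' = i then var j else 0) + z_mon i' w" for i'
    by (simp add: z_mon_def x)
  then have "(\<Sum>i'\<in>{1..d}. lin (m i') (z_mon i' (x # w)))
     = (\<Sum>i'\<in>{1..d}. if i' = i then m i j else 0) + (\<Sum>i'\<in>{1..d}. lin (m i') (z_mon i' w))"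
    by (simp add: sum.distrib if_distrib[of "lin _"] cong: if_cong)
  then show ?case using Cons i by (simp add: u_mon_def x)
qed

lemma finite_letters: "finite (letters d lam)"
proof -
  have "letters d lam = Sigma {1..d} (\<lambda>i. {1..lam i})" by (auto simp: letters_def)
  then show ?thesis by simp
qed

lemma mset_eq_if_z_mon_eq:
  assumes "set w \<subseteq> letters d lam" "set w' \<subseteq> letters d lam"
    and "\<And>i. i \<in> {1..d} \<Longrightarrow> z_mon i w = z_mon i w'"
  shows "mset w = mset w'"
proof (rule multiset_eqI)
  fix x :: letter
  obtain i j where x: "x = (i, j)" by (cases x)
  show "count (mset w) x = count (mset w') x"
  proof (cases "i \<in> {1..d}")
    case True
    then show ?thesis using assms(3) by (metis lookup_z_mon x)
  next
    case False
    then have "x \<notin> set w" "x \<notin> set w'" using assms(1,2) x by (auto simp: letters_def)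
    then show ?thesis by (metis count_mset_0_iff)
  qed
qed

lemma word_of_z_mons:
  assumes "\<And>i. i \<in> {1..d} \<Longrightarrow> z i \<in> mons {1..lam i}"
  shows "\<exists>w. set w \<subseteq> letters d lam \<and> (\<forall>i\<in>{1..d}. z_mon i w = z i)"
proof -
  define M where "M = (\<Sum>i\<in>{1..d}. image_mset (Pair i) (mon_mset (z i)))"
  obtain w where w: "mset w = M" using ex_mset by blast
  have "set w = set_mset M" by (metis w set_mset_mset)
  then have "set w \<subseteq> letters d lam"
    using assms by (fastforce simp: letters_def mons_def M_def set_mset_sum)
  moreover have "z_mon i w = z i" if i: "i \<in> {1..d}" for i
  proof -
    have "mon_mset (z_mon i w) = (\<Sum>i'\<in>{1..d}. image_mset snd (filter_mset (\<lambda>x. fst x = i) (image_mset (Pair i') (mon_mset (z i')))))"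
      unfolding mon_mset_z_mon w M_def
      by (induction d) (auto simp: sum.atLeast_Suc_atMost_Suc_shift)
    also have "\<dots> = (\<Sum>i'\<in>{1..d}. if i' = i then mon_mset (z i') else {#})"
      by (intro sum.cong) (auto simp: filter_mset_image_mset multiset.map_comp comp_def)
    finally show ?thesis using i by (simp add: mon_mset_inject)
  qed
  ultimately show ?thesis by blast
qed

lemma sum_disjoint_mons_eq:
  assumes "finite I" "disjoint_family_on U I" "\<And>i. i \<in> I \<Longrightarrow> f i \<in> mons (U i)"
    "\<And>i. i \<in> I \<Longrightarrow> g i \<in> mons (U i)" "(\<Sum>i\<in>I. f i) = (\<Sum>i\<in>I. g i)" "i \<in> I"
  shows "f i = (g i :: 'v mon)"
proof (rule poly_mapping_eqI)
  fix v
  have lookup: "Poly_Mapping.lookup (\<Sum>i\<in>I. h i) v = Poly_Mapping.lookup (h i) v"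
    if h: "\<And>i. i \<in> I \<Longrightarrow> h i \<in> mons (U i)" and v: "v \<in> U i" for h :: "_ \<Rightarrow> 'v mon"
  proof -
    have "Poly_Mapping.lookup (h i') v = 0" if "i' \<in> I - {i}" for i'
    proof -
      have "v \<notin> U i'" using that v assms(2,6) by (auto simp: disjoint_family_on_def)
      then show ?thesis using h[of i'] that by (auto simp: mons_def in_keys_iff)
    qed
    then have "(\<Sum>i'\<in>I - {i}. Poly_Mapping.lookup (h i') v) = 0" by (rule sum.neutral[OF ballI])
    then show ?thesis
      unfolding lookup_sum using sum.remove[OF assms(1,6), of "\<lambda>i. Poly_Mapping.lookup (h i) v"] by simp
  qed
  have "Poly_Mapping.lookup (h i) v = 0" if "h i \<in> mons (U i)" "v \<notin> U i" for h :: "_ \<Rightarrow> 'v mon"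
    using that by (auto simp: mons_def in_keys_iff)
  then show "Poly_Mapping.lookup (f i) v = Poly_Mapping.lookup (g i) v"
    using lookup[of f] lookup[of g] assms(3-6) by (cases "v \<in> U i") auto
qed

text \<open>Each step from \<open>f x + ?f\<close> over \<open>g x + ?f\<close> to
  \<open>g x + ?g\<close> goes up weakly, so equality of the ends collapses both steps. The equality
  case later detects that all labels involved are standard.\<close>

lemma monomial_order_sum_list:
  fixes xs :: "'a list"
  assumes ord: "monomial_order V ord"
    and "\<And>x. x \<in> set xs \<Longrightarrow> f x \<in> mons V \<and> g x \<in> mons V \<and> (f x, g x) \<in> ord"
  shows "((\<Sum>x\<leftarrow>xs. f x), (\<Sum>x\<leftarrow>xs. g x)) \<in> ord \<and>
    ((\<Sum>x\<leftarrow>xs. f x) = (\<Sum>x\<leftarrow>xs. g x) \<longrightarrow> (\<forall>x\<in>set xs. f x = g x))"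
  using assms(2)
proof (induction xs)
  case Nil
  then show ?case using monomial_order_refl[OF ord zero_in_mons] by simp
next
  case (Cons x xs)
  let ?f = "\<Sum>x\<leftarrow>xs. f x" and ?g = "\<Sum>x\<leftarrow>xs. g x"
  have mons_sum: "(\<Sum>x\<leftarrow>ys. h x) \<in> mons V" if "\<forall>x\<in>set ys. h x \<in> mons V" for h and ys :: "'a list"
    using that by (induction ys) (auto simp: plus_in_mons_iff)
  have x: "f x \<in> mons V \<and> g x \<in> mons V \<and> (f x, g x) \<in> ord" by (rule Cons.prems) simp
  have xs: "f y \<in> mons V \<and> g y \<in> mons V \<and> (f y, g y) \<in> ord" if "y \<in> set xs" for y
    by (rule Cons.prems) (simp add: that)
  have m: "?f \<in> mons V" "?g \<in> mons V" "f x \<in> mons V" "g x \<in> mons V"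
    using mons_sum[of xs f] mons_sum[of xs g] x xs by blast+
  have IH: "(?f, ?g) \<in> ord" "?f = ?g \<Longrightarrow> \<forall>x\<in>set xs. f x = g x" using Cons.IH[OF xs] by auto
  have 1: "(f x + ?f, g x + ?f) \<in> ord"
    using monomial_order_plus[OF ord] x m by blast
  have "(?f + g x, ?g + g x) \<in> ord"
    using monomial_order_plus[OF ord IH(1)] m by blast
  then have 2: "(g x + ?f, g x + ?g) \<in> ord" by (simp add: add.commute)
  have "f x = g x \<and> ?f = ?g" if eq: "f x + ?f = g x + ?g"
  proof -
    have "(g x + ?f, f x + ?f) \<in> ord" using 2 eq by simp
    then have "f x + ?f = g x + ?f" using 1 monomial_order_antisym[OF ord] by blast
    then have "f x = g x" by (rule add_right_imp_eq)
    moreover from this eq have "?f = ?g" by (metis add_left_imp_eq)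
    ultimately show ?thesis by blast
  qed
  then have "f x + ?f = g x + ?g \<Longrightarrow> \<forall>y\<in>set (x # xs). f y = g y" using IH(2) by (metis set_ConsD)
  then show ?case using monomial_order_trans[OF ord 1 2] by (metis list.simps(9) sum_list.Cons)
qed

lemma sum_lessThan_conv_sum_list: "(\<Sum>l<p. f l) = (\<Sum>l\<leftarrow>[0..<p]. f l)" for f :: "nat \<Rightarrow> 'b::comm_monoid_add"
  by (simp add: interv_sum_list_conv_sum_set_nat lessThan_atLeast0)

text \<open>A binomial in \<open>B\<close> may have either of its two monomials as initial monomial;
  membership up to sign in \<open>marked_in\<close> absorbs this.\<close>

lemma marked_in_of_basis:
  assumes ord: "monomial_order V ord" and g: "g \<in> B" "binomial_poly g" "g \<noteq> (0 :: ('v, 'k::comm_ring_1) mpoly)"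
    and keys: "Poly_Mapping.keys g \<subseteq> mons V"
  shows "\<exists>t. marked_in ord B (init_mon ord g) t"
proof -
  obtain z1 z2 where z: "g = mono_poly z1 - mono_poly z2" using g by (auto simp: binomial_poly_def)
  have ne: "z1 \<noteq> z2" using g z by auto
  have m: "z1 \<in> mons V" "z2 \<in> mons V" using keys keys_binomial[OF ne, where 'k='k] z by auto
  show ?thesis
  proof (cases "(z2, z1) \<in> ord")
    case True
    then have "init_mon ord g = z1" unfolding z by (rule init_mon_binomial[OF ord ne m(1)])
    then show ?thesis using ne g(1) unfolding z by (auto simp: marked_in_def)
  next
    case False
    then have le: "(z1, z2) \<in> ord" using monomial_order_total[OF ord m] by blast
    have "init_mon ord g = z2"
      by (rule init_mon_eqI[OF ord])
        (use keys_binomial[OF ne, where 'k='k] le monomial_order_refl[OF ord m(2)] z in auto)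
    moreover have "init_mon ord (mono_poly z2 - mono_poly z1 :: ('v, 'k) mpoly) = z2"
      by (rule init_mon_binomial[OF ord ne[symmetric] m(2) le])
    ultimately show ?thesis using ne g(1) z by (auto simp: marked_in_def)
  qed
qed

lemma marked_inD:
  assumes ord: "monomial_order X ord" and B: "B \<subseteq> toric_ideal X V \<phi>"
    and st: "marked_in ord (B :: ('x, 'k::comm_ring_1) mpoly set) s t"
  shows "s \<noteq> t" "s \<in> mons X" "t \<in> mons X" "lin \<phi> s = lin \<phi> t" "(t, s) \<in> ord"
    "\<exists>g\<in>B. s \<in> Poly_Mapping.keys g"
proof -
  let ?p = "mono_poly s - mono_poly t :: ('x, 'k) mpoly"
  show ne: "s \<noteq> t" using st by (simp add: marked_in_def)
  have "?p \<in> toric_ideal X V \<phi> \<or> - ?p \<in> toric_ideal X V \<phi>"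
    using st B by (auto simp: marked_in_def)
  then have *: "s \<in> mons X \<and> t \<in> mons X \<and> lin \<phi> s = lin \<phi> t"
    using binomial_in_toric_ideal_iff[OF ne, where 'k='k]
      binomial_in_toric_ideal_iff[OF ne[symmetric], where 'k='k] by fastforce
  then show "s \<in> mons X" "t \<in> mons X" "lin \<phi> s = lin \<phi> t" by auto
  have keys: "Poly_Mapping.keys ?p = {s, t}" by (rule keys_binomial[OF ne])
  then have "?p \<noteq> 0" by (metis insert_not_empty keys_zero)
  then show "(t, s) \<in> ord"
    using init_mon_max(2)[OF ord, of ?p t] st keys * by (auto simp: marked_in_def)
  show "\<exists>g\<in>B. s \<in> Poly_Mapping.keys g"
    using st keys keys_binomial[OF ne[symmetric], where 'k='k] by (auto simp: marked_in_def)
qed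

lemma lin_sum_list: "lin \<phi> (\<Sum>x\<leftarrow>xs. f x) = (\<Sum>x\<leftarrow>xs. lin \<phi> (f x))"
  by (induction xs) auto

lemma lin_nonneg:
  fixes \<phi> :: "'x \<Rightarrow> int"
  assumes "\<And>x. x \<in> Poly_Mapping.keys s \<Longrightarrow> 0 \<le> \<phi> x"
  shows "0 \<le> lin \<phi> s"
proof -
  have "(\<forall>x\<in>#M. 0 \<le> \<phi> x) \<Longrightarrow> 0 \<le> (\<Sum>x\<in>#M. \<phi> x)" for M
    by (induction M) auto
  then show ?thesis using assms by (simp add: lin_def)
qed

lemma lex_prod_strictI:
  assumes "(t, s) \<in> R" "(s, t) \<in> R \<Longrightarrow> (t, s) \<in> S \<and> (s, t) \<notin> S"
  shows "(t, s) \<in> R \<then>\<then> S \<and> (s, t) \<notin> R \<then>\<then> S"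
  using assms by (auto simp: lex_prod_rel_def)

definition list_of_mset :: "'a multiset \<Rightarrow> 'a list" where
  "list_of_mset M = (SOME xs. mset xs = M)"

lemma mset_list_of_mset [simp]: "mset (list_of_mset M) = M"
  unfolding list_of_mset_def by (rule someI_ex) (rule ex_mset)

lemma set_list_of_mset [simp]: "set (list_of_mset M) = set_mset M"
  by (metis mset_list_of_mset set_mset_mset)

lemma mon_mset_var_list: "mon_mset (\<Sum>x\<leftarrow>xs. var x) = mset xs"
  by (induction xs) auto

lemma mset_eq_mon_mset_imp: "mset xs = mon_mset s \<Longrightarrow> (\<Sum>x\<leftarrow>xs. f x) = lin f s"
  by (simp add: lin_def flip: sum_mset_sum_list)

lemma sum_list_partition:
  fixes f :: "'a \<Rightarrow> 'b::comm_monoid_add"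
  assumes "distinct ks" "\<And>x. x \<in> set xs \<Longrightarrow> h x \<in> set ks"
  shows "(\<Sum>k\<leftarrow>ks. \<Sum>x\<leftarrow>filter (\<lambda>x. h x = k) xs. f x) = (\<Sum>x\<leftarrow>xs. f x)"
  using assms(2)
proof (induction xs)
  case (Cons x xs)
  have "(\<Sum>k\<leftarrow>ks. if h x = k then f x else 0) = (if h x \<in> set ks then f x else 0)"
    using assms(1) by (induction ks) auto
  moreover have "(\<Sum>k\<leftarrow>ks. \<Sum>x\<leftarrow>filter (\<lambda>x. h x = k) (x # xs). f x)
      = (\<Sum>k\<leftarrow>ks. (if h x = k then f x else 0) + (\<Sum>x\<leftarrow>filter (\<lambda>x. h x = k) xs. f x))"
    by (rule arg_cong[of _ _ sum_list]) simp
  ultimately show ?case using Cons by (simp add: sum_list_addf)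
qed simp

lemma mon_degree_sum_list: "mon_degree (\<Sum>x\<leftarrow>xs. f x) = (\<Sum>x\<leftarrow>xs. mon_degree (f x))"
  by (induction xs) auto

section \<open>Standard labels\<close>

locale nested_groebner =
  fixes d n r :: nat
    and a :: "nat \<Rightarrow> nat mon"
    and lam :: "nat \<Rightarrow> nat"
    and U :: "nat \<Rightarrow> 'u set"
    and m :: "nat \<Rightarrow> nat \<Rightarrow> 'u mon"
    and ord0 :: "nat mon rel"
    and G0 :: "(nat, 'k::field) mpoly set"
    and ord :: "nat \<Rightarrow> nat mon rel"
    and G :: "nat \<Rightarrow> (nat, 'k) mpoly set"
  assumes conf_a: "configuration {1..d} (a ` {1..n})" and inj_a: "inj_on a {1..n}"
    and deg_a: "\<forall>k\<in>{1..n}. mon_degree (a k) = r"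
    and disj_U: "disjoint_family_on U {1..d}"
    and conf_m: "\<And>i. i \<in> {1..d} \<Longrightarrow> configuration (U i) (m i ` {1..lam i})"
    and ord0: "monomial_order {1..n} ord0"
    and G0: "groebner_basis {1..n} ord0 (toric_ideal {1..n} {1..d} a) G0"
    and bin_G0: "\<forall>g\<in>G0. binomial_poly g"
    and ord: "\<And>i. i \<in> {1..d} \<Longrightarrow> monomial_order {1..lam i} (ord i)"
    and G: "\<And>i. i \<in> {1..d} \<Longrightarrow>
      groebner_basis {1..lam i} (ord i) (toric_ideal {1..lam i} (U i) (m i)) (G i)"
    and bin_G: "\<And>i g. i \<in> {1..d} \<Longrightarrow> g \<in> G i \<Longrightarrow> binomial_poly g"
begin

abbreviation "lab \<equiv> label d n a lam"
abbreviation "slab \<equiv> std_label d n a lam ord G"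
abbreviation "X \<equiv> nested_configuration d lam (a ` {1..n}) m"
abbreviation "marked \<equiv> nested_marked_binomials d n r a lam m ord0 G0 ord G"
abbreviation "umon \<equiv> u_mon m"
abbreviation "stdz i \<equiv> fibre_min {1..lam i} (ord i) (m i)"

lemma hom_m: "i \<in> {1..d} \<Longrightarrow> degree_homogeneous {1..lam i} (m i)"
  by (rule configuration_homogeneous[OF conf_m])

lemma hom_a: "degree_homogeneous {1..n} a"
  by (rule configuration_homogeneous[OF conf_a])

lemma G0_subset: "G0 \<subseteq> toric_ideal {1..n} {1..d} a"
  using G0 by (auto simp: groebner_basis_def)

lemma G_subset: "i \<in> {1..d} \<Longrightarrow> G i \<subseteq> toric_ideal {1..lam i} (U i) (m i)"
  using G by (auto simp: groebner_basis_def)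

lemma stdz_iff: "i \<in> {1..d} \<Longrightarrow> z \<in> mons {1..lam i} \<Longrightarrow>
    stdz i z \<longleftrightarrow> (\<forall>g\<in>G i. \<not> mon_dvd (init_mon (ord i) g) z)"
  by (rule fibre_min_iff_not_dvd[OF ord _ hom_m G]) auto

lemma lab_letters: "lab k w \<Longrightarrow> set w \<subseteq> letters d lam"
  by (simp add: label_def)

lemma lab_z_mons: "lab k w \<Longrightarrow> z_mon i w \<in> mons {1..lam i}"
  by (rule z_mon_in_mons[OF lab_letters])

lemma lab_cong: "mset w = mset w' \<Longrightarrow> lab k w \<Longrightarrow> lab k w'"
  by (auto simp: label_def t_mon_cong[of w w'] dest: mset_eq_setD)

lemma lab_length: "lab k w \<Longrightarrow> length w = r"
  using deg_a mon_degree_t_mon[of w] by (auto simp: label_def)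

text \<open>Trades the divisibility condition of \<open>std_label\<close> for minimality in fibres,
  which passes to divisors and is unique in each fibre.\<close>

lemma slab_iff: "slab k w \<longleftrightarrow> lab k w \<and> (\<forall>i\<in>{1..d}. stdz i (z_mon i w))"
  unfolding std_label_def using stdz_iff lab_z_mons by blast

lemma slab_lab: "slab k w \<Longrightarrow> lab k w"
  by (simp add: slab_iff)

lemma slab_cong: "mset w = mset w' \<Longrightarrow> slab k w \<Longrightarrow> slab k w'"
  using lab_cong[of w w' k] unfolding slab_iff by (simp add: z_mon_cong[of w w'])

lemma lin_m_in_mons: "i \<in> {1..d} \<Longrightarrow> z \<in> mons {1..lam i} \<Longrightarrow> lin (m i) z \<in> mons (U i)"
  using conf_m[of i] unfolding configuration_def lin_def
  by (intro sum_mset_in_mons) (auto simp: mons_iff image_subset_iff)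

text \<open>The summands live in the pairwise disjoint variable sets \<open>U i\<close>, so their
  sum determines each of them.\<close>

lemma lin_m_eqI:
  assumes "\<And>i. i \<in> {1..d} \<Longrightarrow> z i \<in> mons {1..lam i}" "\<And>i. i \<in> {1..d} \<Longrightarrow> z' i \<in> mons {1..lam i}"
    and "(\<Sum>i\<in>{1..d}. lin (m i) (z i)) = (\<Sum>i\<in>{1..d}. lin (m i) (z' i))" and "i \<in> {1..d}"
  shows "lin (m i) (z i) = lin (m i) (z' i)"
  using assms(3,4) lin_m_in_mons assms(1,2)
  by (intro sum_disjoint_mons_eq[OF _ disj_U, of "\<lambda>i. lin (m i) (z i)" "\<lambda>i. lin (m i) (z' i)"]) auto

text \<open>Each \<open>B_i\<close> is a configuration, so the image fixes the number of letters
  with first component \<open>i\<close>, and this number is the exponent of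
  \<open>t_i\<close>.\<close>

lemma t_mon_eqI:
  assumes "set w \<subseteq> letters d lam" "set w' \<subseteq> letters d lam"
    and eq: "\<And>i. i \<in> {1..d} \<Longrightarrow> lin (m i) (z_mon i w) = lin (m i) (z_mon i w')"
  shows "t_mon w = t_mon w'"
proof (rule poly_mapping_eqI)
  fix i
  show "Poly_Mapping.lookup (t_mon w) i = Poly_Mapping.lookup (t_mon w') i"
  proof (cases "i \<in> {1..d}")
    case True
    then show ?thesis
      using hom_m[OF True] eq[OF True] z_mon_in_mons[OF assms(1)] z_mon_in_mons[OF assms(2)]
      unfolding lookup_t_mon degree_homogeneous_def by blast
  next
    case False
    then have "z_mon i w = 0" "z_mon i w' = 0"
      using assms(1,2) by (auto simp: letters_def poly_mapping_eq_iff fun_eq_iff lookup_z_mon)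
    then show ?thesis by (simp add: lookup_t_mon)
  qed
qed

lemma umon_eq_iff:
  assumes "set w \<subseteq> letters d lam" "set w' \<subseteq> letters d lam"
  shows "umon w = umon w' \<longleftrightarrow> (\<forall>i\<in>{1..d}. lin (m i) (z_mon i w) = lin (m i) (z_mon i w'))"
proof
  assume "umon w = umon w'"
  then show "\<forall>i\<in>{1..d}. lin (m i) (z_mon i w) = lin (m i) (z_mon i w')"
    using lin_m_eqI[of "\<lambda>i. z_mon i w" "\<lambda>i. z_mon i w'"] z_mon_in_mons assms
    by (simp add: u_mon_eq_sum)
next
  assume "\<forall>i\<in>{1..d}. lin (m i) (z_mon i w) = lin (m i) (z_mon i w')"
  then show "umon w = umon w'" using assms by (simp add: u_mon_eq_sum)
qed

text \<open>The image of a label determines its \<open>t_mon\<close>, and \<open>a\<close> is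
  injective; hence the superscript is a function of the variable.\<close>

lemma lab_unique:
  assumes "lab k w" "lab k' w'" "umon w = umon w'"
  shows "k = k'"
proof -
  have "t_mon w = t_mon w'"
    using umon_eq_iff[OF lab_letters lab_letters] assms by (intro t_mon_eqI lab_letters) blast+
  then have "a k = a k'" using assms by (simp add: label_def)
  then show ?thesis using inj_onD[OF inj_a] assms(1,2) unfolding label_def by blast
qed

lemma slab_unique:
  assumes "slab k w" "slab k' w'" "umon w = umon w'"
  shows "mset w = mset w'"
proof (rule mset_eq_if_z_mon_eq)
  note L = lab_letters[OF slab_lab[OF assms(1)]] lab_letters[OF slab_lab[OF assms(2)]]
  show "set w \<subseteq> letters d lam" "set w' \<subseteq> letters d lam" by (fact L)+
  fix i assume i: "i \<in> {1..d}"
  have "lin (m i) (z_mon i w) = lin (m i) (z_mon i w')" using umon_eq_iff[OF L] assms(3) i by blast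
  then show "z_mon i w = z_mon i w'"
    using fibre_min_unique[OF ord[OF i]] assms(1,2) i unfolding slab_iff by blast
qed

text \<open>Replace each \<open>z_mon i w\<close> by the minimum of its fibre and reassemble a word
  from these minima. Degrees are kept, so the word has the same \<open>t_mon\<close> and is again a
  label for \<open>k\<close>.\<close>

lemma slab_exists:
  assumes "lab k w"
  shows "\<exists>w'. slab k w' \<and> umon w' = umon w"
proof -
  have "\<exists>z. stdz i z \<and> lin (m i) z = lin (m i) (z_mon i w)" if "i \<in> {1..d}" for i
    using fibre_min_exists[OF ord[OF that] _ hom_m[OF that] lab_z_mons[OF assms]] by simp
  then obtain z where z: "\<And>i. i \<in> {1..d} \<Longrightarrow> stdz i (z i)"
    "\<And>i. i \<in> {1..d} \<Longrightarrow> lin (m i) (z i) = lin (m i) (z_mon i w)" by metis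
  obtain w' where w': "set w' \<subseteq> letters d lam" "\<forall>i\<in>{1..d}. z_mon i w' = z i"
    using word_of_z_mons[of d z lam] fibre_min_in_mons[OF z(1)] by blast
  have eq: "lin (m i) (z_mon i w') = lin (m i) (z_mon i w)" if "i \<in> {1..d}" for i
    using z(2)[OF that] w'(2) that by simp
  have "t_mon w' = t_mon w" by (rule t_mon_eqI[OF w'(1) lab_letters[OF assms] eq])
  then have "lab k w'" using assms w'(1) by (simp add: label_def)
  then have "slab k w'" using z(1) w'(2) unfolding slab_iff by simp
  moreover have "umon w' = umon w"
    using umon_eq_iff[OF w'(1) lab_letters[OF assms]] eq by blast
  ultimately show ?thesis by blast
qed

lemma lab_in_X: "lab k w \<Longrightarrow> umon w \<in> X"
  by (auto simp: nested_configuration_def label_def)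

lemma X_lab: "x \<in> X \<Longrightarrow> \<exists>k w. lab k w \<and> umon w = x"
  unfolding nested_configuration_def label_def by blast

lemma finite_X: "finite X"
proof -
  have "finite {w. set w \<subseteq> letters d lam \<and> length w = r}"
    by (rule finite_lists_length_eq[OF finite_letters])
  moreover have "X \<subseteq> umon ` {w. set w \<subseteq> letters d lam \<and> length w = r}"
    using X_lab lab_length lab_letters by blast
  ultimately show ?thesis by (rule finite_surj)
qed

text \<open>By \<open>slab_unique\<close> the choice is determined up to the order of the letters,
  so values of \<open>slabel\<close> are compared through \<open>mset\<close>.\<close>

definition slabel :: "'u mon \<Rightarrow> letter list" where
  "slabel x = (SOME w. \<exists>k. slab k w \<and> umon w = x)"

definition index :: "'u mon \<Rightarrow> nat" where
  "index x = (SOME k. slab k (slabel x))"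

lemma slabel:
  assumes "x \<in> X"
  shows "slab (index x) (slabel x)" "umon (slabel x) = x"
proof -
  have "\<exists>w k. slab k w \<and> umon w = x" using X_lab[OF assms] slab_exists by blast
  then have *: "\<exists>k. slab k (slabel x) \<and> umon (slabel x) = x"
    unfolding slabel_def by (rule someI_ex)
  then show "umon (slabel x) = x" by blast
  from * have "\<exists>k. slab k (slabel x)" by blast
  then show "slab (index x) (slabel x)" unfolding index_def by (rule someI_ex)
qed

lemma index_umon: "lab k w \<Longrightarrow> index (umon w) = k"
  by (metis lab_in_X lab_unique slab_lab slabel)

lemma slabel_umon: "slab k w \<Longrightarrow> mset (slabel (umon w)) = mset w"
  by (metis lab_in_X slab_lab slab_unique slabel)

lemma z_mon_slabel:
  assumes "lab k w" "i \<in> {1..d}"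
  shows "stdz i (z_mon i (slabel (umon w)))"
    and "lin (m i) (z_mon i (slabel (umon w))) = lin (m i) (z_mon i w)"
    and "(z_mon i (slabel (umon w)), z_mon i w) \<in> ord i"
proof -
  note sl = slabel[OF lab_in_X[OF assms(1)]]
  show *: "stdz i (z_mon i (slabel (umon w)))" using sl(1) assms(2) unfolding slab_iff by blast
  show eq: "lin (m i) (z_mon i (slabel (umon w))) = lin (m i) (z_mon i w)"
    using umon_eq_iff[OF lab_letters[OF slab_lab[OF sl(1)]] lab_letters[OF assms(1)]] sl(2) assms(2)
    by blast
  show "(z_mon i (slabel (umon w)), z_mon i w) \<in> ord i"
    by (rule fibre_min_le[OF * lab_z_mons[OF assms(1)] eq[symmetric]])
qed

section \<open>The four quantities compared by the order\<close>

definition Zmon :: "nat \<Rightarrow> 'u mon mon \<Rightarrow> nat mon" where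
  "Zmon i = lin (\<lambda>x. z_mon i (slabel x))"

definition Ymon :: "'u mon mon \<Rightarrow> nat mon" where
  "Ymon = lin (\<lambda>x. var (index x))"

text \<open>Essentially minus the sum of \<open>index x * j\<close> over all letters. The inner sum,
  whose bound \<open>i\<close> shadows that of the letter, is one constant bounding every
  \<open>j\<close>; it makes the weight nonnegative, as a compatible preorder requires.\<close>

definition inversions :: "'u mon mon \<Rightarrow> int" where
  "inversions = lin (\<lambda>x. \<Sum>(i, j)\<leftarrow>slabel x. int (index x) * ((\<Sum>i\<in>{1..d}. int (lam i)) - int j))"

text \<open>The extra point \<open>(0, 0)\<close> lies below all letters, which start at
  \<open>(1, 1)\<close>; it supplies the \<open>c0\<close> of \<open>energy_sort\<close>.\<close>

definition total_energy :: "'u mon mon \<Rightarrow> int" where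
  "total_energy = lin (\<lambda>x. energy (insert (0, 0) (letters d lam)) (slabel x))"

section \<open>The monomial order of the nested configuration\<close>

abbreviation xmon :: "letter list list \<Rightarrow> 'u mon mon" where
  "xmon ws \<equiv> (\<Sum>w\<leftarrow>ws. x_var m w)"

lemma lin_xmon: "lin \<phi> (xmon ws) = (\<Sum>w\<leftarrow>ws. \<phi> (umon w))"
  by (simp add: lin_sum_list)

lemma Zmon_0 [simp]: "Zmon i 0 = 0" and Zmon_plus [simp]: "Zmon i (s + t) = Zmon i s + Zmon i t"
  and Ymon_0 [simp]: "Ymon 0 = 0" and Ymon_plus [simp]: "Ymon (s + t) = Ymon s + Ymon t"
  by (simp_all add: Zmon_def Ymon_def)

lemma Zmon_in_mons: "s \<in> mons X \<Longrightarrow> Zmon i s \<in> mons {1..lam i}"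
  unfolding Zmon_def lin_def
  by (intro sum_mset_in_mons lab_z_mons[OF slab_lab[OF slabel(1)]]) (auto simp: mons_def)

lemma Ymon_in_mons: "s \<in> mons X \<Longrightarrow> Ymon s \<in> mons {1..n}"
  unfolding Ymon_def lin_def
  by (intro sum_mset_in_mons) (use slab_lab[OF slabel(1)] in \<open>auto simp: mons_def label_def\<close>)

lemma xmon_in_mons: "(\<And>w. w \<in> set ws \<Longrightarrow> \<exists>k. lab k w) \<Longrightarrow> xmon ws \<in> mons X"
proof (induction ws)
  case (Cons w ws)
  obtain k where "lab k w" using Cons.prems[of w] by auto
  moreover have "xmon ws \<in> mons X" by (rule Cons.IH) (use Cons.prems in auto)
  ultimately show ?case by (simp add: plus_in_mons_iff lab_in_X)
qed simp

text \<open>Standard labels are minimal in their fibres, so letters of arbitrary labels only give an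
  upper bound for \<open>Zmon\<close>. If the bound is attained, it is attained word by word, and
  each word was standard at \<open>i\<close> already.\<close>

lemma Zmon_labs:
  assumes ws: "\<And>w. w \<in> set ws \<Longrightarrow> \<exists>k. lab k w" and i: "i \<in> {1..d}"
  shows "(Zmon i (xmon ws), z_mon i (concat ws)) \<in> ord i"
    and "Zmon i (xmon ws) = z_mon i (concat ws) \<Longrightarrow> w \<in> set ws \<Longrightarrow> stdz i (z_mon i w)"
proof -
  have *: "z_mon i (slabel (umon w)) \<in> mons {1..lam i} \<and> z_mon i w \<in> mons {1..lam i} \<and>
      (z_mon i (slabel (umon w)), z_mon i w) \<in> ord i" if w: "w \<in> set ws" for w
    using ws[OF w] z_mon_slabel(3)[OF _ i] lab_z_mons lab_z_mons[OF slab_lab[OF slabel(1)[OF lab_in_X]]]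
    by blast
  note sums = monomial_order_sum_list[OF ord[OF i], of ws "\<lambda>w. z_mon i (slabel (umon w))" "z_mon i", OF *]
  show "(Zmon i (xmon ws), z_mon i (concat ws)) \<in> ord i"
    using sums unfolding Zmon_def lin_xmon word_mon_concat by blast
  assume "Zmon i (xmon ws) = z_mon i (concat ws)" and w: "w \<in> set ws"
  then have "z_mon i (slabel (umon w)) = z_mon i w"
    using sums w unfolding Zmon_def lin_xmon word_mon_concat by blast
  moreover obtain k where "lab k w" using ws[OF w] by blast
  ultimately show "stdz i (z_mon i w)" using z_mon_slabel(1)[OF _ i] by metis
qed

lemma Zmon_slabs:
  assumes "\<And>w. w \<in> set ws \<Longrightarrow> \<exists>k. slab k w"
  shows "Zmon i (xmon ws) = z_mon i (concat ws)"
proof -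
  have "z_mon i (slabel (umon w)) = z_mon i w" if "w \<in> set ws" for w
    using assms[OF that] slabel_umon z_mon_cong by blast
  then show ?thesis
    unfolding Zmon_def lin_xmon word_mon_concat by (simp cong: map_cong)
qed

definition Zrel :: "'u mon mon rel" where
  "Zrel = foldr (\<then>\<then>) (map (\<lambda>i. {(s, t). (Zmon i s, Zmon i t) \<in> ord i}) [1..<Suc d]) UNIV"

definition Yrel :: "'u mon mon rel" where
  "Yrel = {(s, t). (Ymon s, Ymon t) \<in> ord0}"

definition xrel :: "'u mon mon rel" where
  "xrel = Zrel \<then>\<then> Yrel \<then>\<then> {(s, t). inversions s \<le> inversions t} \<then>\<then>
     {(s, t). total_energy s \<le> total_energy t}"

lemma ZrelI: "(\<And>i. i \<in> {1..d} \<Longrightarrow> (Zmon i s, Zmon i t) \<in> ord i) \<Longrightarrow> (s, t) \<in> Zrel"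
  unfolding Zrel_def by (rule lex_listI) auto

lemma Zrel_eqD:
  assumes "(s, t) \<in> Zrel" "(t, s) \<in> Zrel" "i \<in> {1..d}"
  shows "(Zmon i s, Zmon i t) \<in> ord i"
proof -
  have "{(s, t). (Zmon i s, Zmon i t) \<in> ord i}
      \<in> set (map (\<lambda>i. {(s, t). (Zmon i s, Zmon i t) \<in> ord i}) [1..<Suc d])"
    unfolding set_map by (rule imageI) (use assms(3) in \<open>simp del: upt_Suc\<close>)
  from lex_list_eqD[OF assms(1,2)[unfolded Zrel_def] this] show ?thesis by simp
qed

definition inv_weight :: "nat \<Rightarrow> letter list \<Rightarrow> int" where
  "inv_weight k w = (\<Sum>(i, j)\<leftarrow>w. int k * ((\<Sum>i\<in>{1..d}. int (lam i)) - int j))"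

lemma inv_weight_cong: "mset w = mset w' \<Longrightarrow> inv_weight k w = inv_weight k w'"
  unfolding inv_weight_def by (simp flip: sum_mset_sum_list)

lemma inv_weight_nonneg: "set w \<subseteq> letters d lam \<Longrightarrow> 0 \<le> inv_weight k w"
proof -
  have "int j \<le> (\<Sum>i\<in>{1..d}. int (lam i))" if "(i, j) \<in> letters d lam" for i j
  proof -
    have "int (lam i) \<le> (\<Sum>i\<in>{1..d}. int (lam i))"
      by (rule member_le_sum) (use that in \<open>auto simp: letters_def\<close>)
    then show ?thesis using that by (auto simp: letters_def)
  qed
  then show ?thesis if "set w \<subseteq> letters d lam"
    using that unfolding inv_weight_def by (intro sum_list_nonneg) auto
qed

lemma inversions_eq: "inversions = lin (\<lambda>x. inv_weight (index x) (slabel x))"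
  by (simp add: inversions_def inv_weight_def)

lemma compatible_xrel: "compatible_preorder X xrel"
  unfolding xrel_def
proof (intro compatible_preorder_lex)
  show "compatible_preorder X Zrel"
    unfolding Zrel_def
  proof (rule compatible_preorder_lex_list)
    fix R assume "R \<in> set (map (\<lambda>i. {(s, t). (Zmon i s, Zmon i t) \<in> ord i}) [1..<Suc d])"
    then obtain i where i: "i \<in> {1..d}" and R: "R = {(s, t). (Zmon i s, Zmon i t) \<in> ord i}"
      unfolding set_map set_upt atLeastLessThanSuc_atLeastAtMost by blast
    show "compatible_preorder X R"
      unfolding R by (rule compatible_preorder_pullback[OF ord[OF i], of X "Zmon i", OF Zmon_in_mons]) simp_all
  qed
  show "compatible_preorder X Yrel"
    unfolding Yrel_def by (rule compatible_preorder_pullback[OF ord0, of X Ymon, OF Ymon_in_mons]) simp_all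
  show "compatible_preorder X {(s, t). inversions s \<le> inversions t}"
  proof (rule compatible_preorder_weight)
    show "0 \<le> inversions s" if "s \<in> mons X" for s
      unfolding inversions_eq
      by (intro lin_nonneg inv_weight_nonneg lab_letters[OF slab_lab[OF slabel(1)]])
        (use that in \<open>auto simp: mons_def\<close>)
  qed (simp_all add: inversions_eq)
  show "compatible_preorder X {(s, t). total_energy s \<le> total_energy t}"
  proof (rule compatible_preorder_weight)
    show "0 \<le> total_energy s" for s
      unfolding total_energy_def by (intro lin_nonneg energy_nonneg)
  qed (simp_all add: total_energy_def)
qed

text \<open>With the same letters on both sides, the left one in standard labels,
  \<open>Zmon\<close> is computed exactly on one side and bounded on the other. A tie therefore
  certifies that the arbitrary labels are standard.\<close>

lemma Zrel_labs:
  assumes ws: "\<And>w. w \<in> set ws \<Longrightarrow> \<exists>k. slab k w" and ws': "\<And>w. w \<in> set ws' \<Longrightarrow> \<exists>k. lab k w"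
    and eq: "mset (concat ws) = mset (concat ws')"
  shows "(xmon ws', xmon ws) \<in> Zrel"
    and "(xmon ws, xmon ws') \<in> Zrel \<Longrightarrow> w \<in> set ws' \<Longrightarrow> lab k w \<Longrightarrow> slab k w"
proof -
  have Z: "Zmon i (xmon ws) = z_mon i (concat ws')" for i
    using Zmon_slabs[OF ws] z_mon_cong[OF eq] by simp
  show le: "(xmon ws', xmon ws) \<in> Zrel"
    by (rule ZrelI) (use Zmon_labs(1)[OF ws'] Z in simp)
  assume ge: "(xmon ws, xmon ws') \<in> Zrel" and w: "w \<in> set ws'" "lab k w"
  have "stdz i (z_mon i w)" if i: "i \<in> {1..d}" for i
  proof -
    have "Zmon i (xmon ws') = Zmon i (xmon ws)"
      using Zrel_eqD[OF le ge i] Zrel_eqD[OF ge le i] by (rule monomial_order_antisym[OF ord[OF i]])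
    then show ?thesis using Zmon_labs(2)[OF ws' i] Z w(1) by metis
  qed
  then show "slab k w" using w(2) unfolding slab_iff by blast
qed

section \<open>The marked binomials are decreasing\<close>

lemma lin_xmon_id: "lin (\<lambda>x. x) (xmon ws) = umon (concat ws)"
  by (simp add: lin_xmon word_mon_concat)

lemma Ymon_xmon: "list_all2 lab ks ws \<Longrightarrow> Ymon (xmon ws) = (\<Sum>k\<leftarrow>ks. var k)"
  by (induction rule: list_all2_induct) (auto simp: Ymon_def index_umon)

lemma inversions_x_var: "slab k w \<Longrightarrow> inversions (x_var m w) = inv_weight k w"
  by (simp add: inversions_eq index_umon[OF slab_lab] inv_weight_cong[OF slabel_umon])

lemma energy_x_var: "slab k w \<Longrightarrow> total_energy (x_var m w) = energy (insert (0, 0) (letters d lam)) w"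
  by (simp add: total_energy_def energy_cong[OF slabel_umon])

definition reducing :: "'u mon mon \<Rightarrow> 'u mon mon \<Rightarrow> bool" where
  "reducing s t \<longleftrightarrow> s \<in> mons X \<and> t \<in> mons X \<and> lin (\<lambda>x. x) s = lin (\<lambda>x. x) t \<and>
     (t, s) \<in> xrel \<and> (s, t) \<notin> xrel"

text \<open>Common frame for types (1)-(3), which rearrange letters. Only a tie in
  \<open>Zrel\<close> needs work, and there \<open>rest\<close> may use that every label on the
  right is standard, so that its superscripts, weights and energies are those of the word as
  written.\<close>

lemma reducing_wordsI:
  assumes ws: "\<And>w. w \<in> set ws \<Longrightarrow> \<exists>k. slab k w" and ws': "\<And>w. w \<in> set ws' \<Longrightarrow> \<exists>k. lab k w"
    and eq: "mset (concat ws) = mset (concat ws')"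
    and rest: "\<lbrakk>\<And>k w. w \<in> set ws' \<Longrightarrow> lab k w \<Longrightarrow> slab k w\<rbrakk> \<Longrightarrow>
      (xmon ws', xmon ws) \<in> R \<and> (xmon ws, xmon ws') \<notin> R"
    and R: "xrel = Zrel \<then>\<then> R"
  shows "reducing (xmon ws) (xmon ws')"
proof -
  have "(xmon ws', xmon ws) \<in> xrel \<and> (xmon ws, xmon ws') \<notin> xrel"
    unfolding R by (rule lex_prod_strictI) (use Zrel_labs[OF ws ws' eq] rest in blast)+
  moreover have "xmon ws \<in> mons X" "xmon ws' \<in> mons X"
    using xmon_in_mons[OF ws'] xmon_in_mons ws slab_lab by blast+
  ultimately show ?thesis
    unfolding reducing_def lin_xmon_id using u_mon_cong[OF eq] by simp
qed

lemma Yrel_refl: "s \<in> mons X \<Longrightarrow> t \<in> mons X \<Longrightarrow> Ymon s = Ymon t \<Longrightarrow> (s, t) \<in> Yrel"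
  using monomial_order_refl[OF ord0 Ymon_in_mons] by (simp add: Yrel_def)

lemma type1E:
  assumes "(s, t) \<in> type1 d n a lam m ord0 G0 ord G"
  obtains ks ks' ws ws' where "s = xmon ws" "t = xmon ws'" "list_all2 slab ks ws" "list_all2 lab ks' ws'"
    "marked_in ord0 G0 (\<Sum>k\<leftarrow>ks. var k) (\<Sum>k\<leftarrow>ks'. var k)" "mset (concat ws) = mset (concat ws')"
proof -
  obtain p k k' w w' where *: "s = (\<Sum>l<p. x_var m (w l))" "t = (\<Sum>l<p. x_var m (w' l))"
    "\<forall>l<p. slab (k l) (w l)" "\<forall>l<p. lab (k' l) (w' l)"
    "marked_in ord0 G0 (\<Sum>l<p. var (k l)) (\<Sum>l<p. var (k' l))"
    "sort (concat (map w [0..<p])) = sort (concat (map w' [0..<p]))"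
    using assms unfolding type1_def by blast
  show ?thesis
  proof (rule that)
    show "s = xmon (map w [0..<p])" "t = xmon (map w' [0..<p])"
      using * by (simp_all add: sum_lessThan_conv_sum_list comp_def)
    show "list_all2 slab (map k [0..<p]) (map w [0..<p])" "list_all2 lab (map k' [0..<p]) (map w' [0..<p])"
      using *(3,4) by (simp_all add: list_all2_conv_all_nth)
    show "marked_in ord0 G0 (\<Sum>k\<leftarrow>map k [0..<p]. var k) (\<Sum>k\<leftarrow>map k' [0..<p]. var k)"
      using *(5) by (simp add: sum_lessThan_conv_sum_list comp_def)
    show "mset (concat (map w [0..<p])) = mset (concat (map w' [0..<p]))"
      using *(6) by (metis mset_sort)
  qed
qed

lemma list_all2_ex: "list_all2 P ks ws \<Longrightarrow> w \<in> set ws \<Longrightarrow> \<exists>k. P k w"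
  by (auto simp: list_all2_conv_all_nth in_set_conv_nth)

lemma reducing_type1:
  assumes "(s, t) \<in> type1 d n a lam m ord0 G0 ord G"
  shows "reducing s t"
proof -
  obtain ks ks' ws ws' where *: "s = xmon ws" "t = xmon ws'" "list_all2 slab ks ws" "list_all2 lab ks' ws'"
    "marked_in ord0 G0 (\<Sum>k\<leftarrow>ks. var k) (\<Sum>k\<leftarrow>ks'. var k)" "mset (concat ws) = mset (concat ws')"
    by (rule type1E[OF assms])
  note mk = marked_inD[OF ord0 G0_subset *(5)]
  have "list_all2 lab ks ws" using *(3) by (rule list_all2_mono) (rule slab_lab)
  then have Y: "Ymon s = (\<Sum>k\<leftarrow>ks. var k)" "Ymon t = (\<Sum>k\<leftarrow>ks'. var k)"
    using *(4) by (simp_all add: *(1,2) Ymon_xmon)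
  have "(t, s) \<in> Yrel" using mk(5) by (simp add: Yrel_def Y)
  moreover have "(s, t) \<notin> Yrel"
    using mk(1) monomial_order_antisym[OF ord0 mk(5)] by (auto simp: Yrel_def Y)
  ultimately have lt: "(xmon ws', xmon ws) \<in> Yrel \<then>\<then> S \<and> (xmon ws, xmon ws') \<notin> Yrel \<then>\<then> S" for S
    unfolding *(1,2) by (simp add: lex_prod_rel_def)
  show ?thesis unfolding *(1,2)
    by (rule reducing_wordsI[OF _ _ *(6) lt xrel_def])
      (use list_all2_ex[OF *(3)] list_all2_ex[OF *(4)] in blast)+
qed

lemma lab_swap:
  assumes "lab k w" "l < length w" "fst y = fst (w ! l)" "y \<in> letters d lam"
  shows "lab k (w[l := y])"
proof -
  have "map fst (w[l := y]) = map fst w"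
    using assms(2,3) by (simp add: map_update) (metis list_update_id nth_map)
  then have "t_mon (w[l := y]) = t_mon w"
    by (metis mon_mset_inject mon_mset_t_mon mset_map)
  moreover have "set (w[l := y]) \<subseteq> letters d lam"
    using assms(1,4) set_update_subset_insert[of w l y] by (auto simp: label_def)
  ultimately show ?thesis using assms(1) by (simp add: label_def)
qed

lemma inv_weight_swap:
  assumes "l < length w"
  shows "inv_weight k (w[l := y]) = inv_weight k w + int k * (int (snd (w ! l)) - int (snd y))"
proof -
  let ?f = "\<lambda>x. int k * ((\<Sum>i\<in>{1..d}. int (lam i)) - int (snd x))"
  have I: "inv_weight k v = (\<Sum>x\<in>#mset v. ?f x)" for v
    by (simp add: inv_weight_def case_prod_unfold flip: sum_mset_sum_list)
  define N where "N = mset w - {#w ! l#}"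
  have N: "mset w = add_mset (w ! l) N" "mset (w[l := y]) = add_mset y N"
    using assms by (simp_all add: N_def mset_update)
  show ?thesis unfolding I[of w] I[of "w[l := y]"] N by (simp add: algebra_simps)
qed

lemma mset_swap:
  assumes "l < length w" "l' < length w'"
  shows "mset (w[l := w' ! l']) + mset (w'[l' := w ! l]) = mset w + mset w'"
proof -
  define N N' where "N = mset w - {#w ! l#}" and "N' = mset w' - {#w' ! l'#}"
  have "mset w = add_mset (w ! l) N" "mset w' = add_mset (w' ! l') N'"
    "mset (w[l := w' ! l']) = add_mset (w' ! l') N" "mset (w'[l' := w ! l]) = add_mset (w ! l) N'"
    using assms by (simp_all add: N_def N'_def mset_update)
  then show ?thesis by simp
qed

lemma reducing_type3:
  assumes "(s, t) \<in> type3 d n a lam m ord G"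
  shows "reducing s t"
proof -
  obtain k k' w w' l l' where s: "s = x_var m w + x_var m w'"
    and t: "t = x_var m (w[l := w' ! l']) + x_var m (w'[l' := w ! l])"
    and w: "slab k w" "slab k' w'" "k < k'" "l < length w" "l' < length w'"
      "fst (w ! l) = fst (w' ! l')" "snd (w ! l) > snd (w' ! l')"
    using assms unfolding type3_def by blast
  let ?v = "w[l := w' ! l']" and ?v' = "w'[l' := w ! l]"
  have letters: "w ! l \<in> letters d lam" "w' ! l' \<in> letters d lam"
    using lab_letters[OF slab_lab] w(1,2,4,5) nth_mem by blast+
  have v: "lab k ?v" "lab k' ?v'"
    by (rule lab_swap[OF slab_lab[OF w(1)] w(4) w(6)[symmetric] letters(2)])
      (rule lab_swap[OF slab_lab[OF w(2)] w(5) w(6) letters(1)])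
  have "(xmon [?v, ?v'], xmon [w, w']) \<in> Yrel \<then>\<then> {(s, t). inversions s \<le> inversions t} \<then>\<then> S \<and>
      (xmon [w, w'], xmon [?v, ?v']) \<notin> Yrel \<then>\<then> {(s, t). inversions s \<le> inversions t} \<then>\<then> S"
    if std: "\<And>k u. u \<in> set [?v, ?v'] \<Longrightarrow> lab k u \<Longrightarrow> slab k u" for S
  proof (intro lex_prod_strictI)
    have "list_all2 lab [k, k'] [w, w']" "list_all2 lab [k, k'] [?v, ?v']"
      using v slab_lab[OF w(1)] slab_lab[OF w(2)] by simp_all
    then have "Ymon (xmon [?v, ?v']) = Ymon (xmon [w, w'])" by (simp only: Ymon_xmon)
    moreover have "xmon [w, w'] \<in> mons X" "xmon [?v, ?v'] \<in> mons X"
      using v slab_lab[OF w(1)] slab_lab[OF w(2)] by (auto intro!: xmon_in_mons simp del: sum_list.Cons list.map)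
    ultimately show "(xmon [?v, ?v'], xmon [w, w']) \<in> Yrel" by (intro Yrel_refl)
    have "slab k ?v" "slab k' ?v'" using std v by auto
    \<comment> \<open>The exchange adds \<open>int k\<close> times the difference of the two second
      components for \<open>w\<close> and subtracts \<open>int k'\<close> times it for
      \<open>w'\<close>.\<close>
    then have "inversions (xmon [?v, ?v']) = inversions (xmon [w, w']) + (int k - int k') * (int (snd (w ! l)) - int (snd (w' ! l')))"
      using w by (simp add: inversions_eq[THEN fun_cong] del: lin_var)
        (simp add: inversions_eq[THEN fun_cong, symmetric] inversions_x_var inv_weight_swap algebra_simps del: lin_var)
    moreover have "(int k - int k') * (int (snd (w ! l)) - int (snd (w' ! l'))) < 0"
      using w by (intro mult_neg_pos) auto
    ultimately have lt: "inversions (xmon [?v, ?v']) < inversions (xmon [w, w'])" by linarith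
    then show "(xmon [?v, ?v'], xmon [w, w']) \<in> {(s, t). inversions s \<le> inversions t}" by simp
    show "(xmon [?v, ?v'], xmon [w, w']) \<in> S \<and> (xmon [w, w'], xmon [?v, ?v']) \<notin> S"
      if "(xmon [w, w'], xmon [?v, ?v']) \<in> {(s, t). inversions s \<le> inversions t}"
      using that lt by simp
  qed
  then have "reducing (xmon [w, w']) (xmon [?v, ?v'])"
    by (intro reducing_wordsI[OF _ _ _ _ xrel_def])
      (use v w mset_swap[OF w(4,5)] in \<open>auto simp del: sum_list.Cons list.map\<close>)
  then show ?thesis by (simp add: s t)
qed

text \<open>Both words have the same first components, so for every \<open>c\<close> an even number
  of letters of \<open>v\<close> has \<open>fst x \<le> c\<close>. As \<open>fst\<close> is monotone
  in the lexicographic order, \<open>count_parts\<close> halves these numbers exactly, and both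
  parts have the \<open>t_mon\<close> of \<open>w1\<close>.\<close>

lemma parts_lab:
  assumes w: "lab k w1" "lab k w2" and v: "v = sort (w1 @ w2)"
  shows "lab k (odd_part v r)" "lab k (even_part v r)"
proof -
  have sv: "sorted v" "length v = 2 * r" using v lab_length[OF w(1)] lab_length[OF w(2)] by auto
  have mono: "fst x \<le> c" if "x \<le> y" "fst y \<le> c" for x y :: letter and c
    using that by (auto simp: less_eq_prod_def)
  have fst_w: "mset (map fst w1) = mset (map fst w2)"
    using w mon_mset_t_mon[of w1] mon_mset_t_mon[of w2] by (simp add: label_def)
  have cnt: "cnt_le (map fst u) c = length (filter (\<lambda>x. fst x \<le> c) u)" for u :: "letter list" and c
    by (simp add: cnt_le_def filter_map comp_def)
  have cnt_v: "length (filter (\<lambda>x. fst x \<le> c) v) = 2 * cnt_le (map fst w1) c" for c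
  proof -
    have "length (filter (\<lambda>x. fst x \<le> c) v) = length (filter (\<lambda>x. fst x \<le> c) (w1 @ w2))"
      unfolding v filter_mset_length by simp
    also have "\<dots> = cnt_le (map fst w1) c + cnt_le (map fst w2) c" by (simp add: cnt)
    finally show ?thesis using cnt_le_cong[OF fst_w] by simp
  qed
  have fst_parts: "mset (map fst u) = mset (map fst w1)" if "u = odd_part v r \<or> u = even_part v r" for u
  proof (rule mset_eq_if_cnt_le_eq)
    fix c
    have "length (filter (\<lambda>x. fst x \<le> c) (odd_part v r)) = (length (filter (\<lambda>x. fst x \<le> c) v) + 1) div 2"
      by (rule count_parts(1)[OF sv]) (rule mono)
    moreover have "length (filter (\<lambda>x. fst x \<le> c) (even_part v r)) = length (filter (\<lambda>x. fst x \<le> c) v) div 2"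
      by (rule count_parts(2)[OF sv]) (rule mono)
    ultimately show "cnt_le (map fst u) c = cnt_le (map fst w1) c"
      using that cnt_v[of c] cnt[of u c] by auto
  qed
  have "set (odd_part v r) \<union> set (even_part v r) = set v"
    by (metis mset_parts[OF sv(2)] set_mset_mset set_mset_union)
  then have sub: "set (odd_part v r) \<union> set (even_part v r) \<subseteq> letters d lam"
    using lab_letters[OF w(1)] lab_letters[OF w(2)] v by auto
  have "t_mon u = t_mon w1" if "u = odd_part v r \<or> u = even_part v r" for u
    using fst_parts[OF that] by (metis mon_mset_inject mon_mset_t_mon mset_map)
  then show "lab k (odd_part v r)" "lab k (even_part v r)"
    using w(1) sub unfolding label_def by auto
qed

lemma type2E:
  assumes "(s, t) \<in> type2 d n r a lam m ord G"
  obtains k w1 w2 v where "s = xmon [w1, w2]" "t = xmon [odd_part v r, even_part v r]" "slab k w1" "slab k w2"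
    "v = sort (w1 @ w2)" "s \<noteq> t"
  using assms unfolding type2_def odd_part_def even_part_def by auto

lemma zero_below_letters: "x \<in> letters d lam \<Longrightarrow> (0, 0) < x"
  by (auto simp: letters_def less_prod_def)

lemma reducing_type2:
  assumes "(s, t) \<in> type2 d n r a lam m ord G"
  shows "reducing s t"
proof -
  obtain k w1 w2 v where s: "s = xmon [w1, w2]" and t: "t = xmon [odd_part v r, even_part v r]"
    and w: "slab k w1" "slab k w2" and v: "v = sort (w1 @ w2)" and ne: "s \<noteq> t"
    by (rule type2E[OF assms])
  let ?v = "odd_part v r" and ?v' = "even_part v r"
  note lw = slab_lab[OF w(1)] slab_lab[OF w(2)]
  note lv = parts_lab[OF lw v]
  have len: "length v = 2 * r" using v lab_length[OF lw(1)] lab_length[OF lw(2)] by simp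
  have ms: "mset ?v + mset ?v' = mset w1 + mset w2" using mset_parts[OF len] by (simp add: v)
  have std: "(xmon [?v, ?v'], xmon [w1, w2]) \<in> Yrel \<then>\<then> {(s, t). inversions s \<le> inversions t} \<then>\<then>
        {(s, t). total_energy s \<le> total_energy t} \<and>
      (xmon [w1, w2], xmon [?v, ?v']) \<notin> Yrel \<then>\<then> {(s, t). inversions s \<le> inversions t} \<then>\<then>
        {(s, t). total_energy s \<le> total_energy t}"
    if std: "\<And>k u. u \<in> set [?v, ?v'] \<Longrightarrow> lab k u \<Longrightarrow> slab k u"
  proof (intro lex_prod_strictI)
    have "list_all2 lab [k, k] [w1, w2]" "list_all2 lab [k, k] [?v, ?v']"
      using lv lw by simp_all
    then have "Ymon (xmon [?v, ?v']) = Ymon (xmon [w1, w2])" by (simp only: Ymon_xmon)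
    moreover have "xmon [w1, w2] \<in> mons X" "xmon [?v, ?v'] \<in> mons X"
      using lv lw by (auto intro!: xmon_in_mons simp del: sum_list.Cons list.map)
    ultimately show "(xmon [?v, ?v'], xmon [w1, w2]) \<in> Yrel" by (intro Yrel_refl)
    have sv: "slab k ?v" "slab k ?v'" using std lv by auto
    have inv_plus: "inversions (s + t) = inversions s + inversions t" for s t
      by (simp add: inversions_eq)
    have energy_plus: "total_energy (s + t) = total_energy s + total_energy t" for s t
      by (simp add: total_energy_def)
    \<comment> \<open>Both variables carry the same superscript \<open>k\<close>, so the weight
      depends only on the letters taken together.\<close>
    have "inv_weight k (?v @ ?v') = inv_weight k (w1 @ w2)" using ms by (intro inv_weight_cong) simp
    then have "inversions (xmon [?v, ?v']) = inversions (xmon [w1, w2])"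
      using sv w by (simp add: inv_plus inversions_x_var inv_weight_def)
    then show "(xmon [?v, ?v'], xmon [w1, w2]) \<in> {(s, t). inversions s \<le> inversions t}" by simp
    let ?L = "insert (0, 0) (letters d lam)"
    have E: "total_energy (xmon [?v, ?v']) = energy ?L ?v + energy ?L ?v'"
      "total_energy (xmon [w1, w2]) = energy ?L w1 + energy ?L w2"
      using sv w by (simp_all add: energy_plus energy_x_var)
    have L: "finite ?L" "set w1 \<union> set w2 \<subseteq> ?L" "(0, 0) \<in> ?L" "\<forall>c\<in>set w1 \<union> set w2. (0, 0) < c"
      using finite_letters lab_letters[OF lw(1)] lab_letters[OF lw(2)] zero_below_letters by auto
    note sort = energy_sort[OF L lab_length[OF lw(1)] lab_length[OF lw(2)] v]
    \<comment> \<open>Equal energies would mean that the pair was sorted from the start; its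
      binomial would be zero and is excluded from type (2).\<close>
    have "energy ?L ?v + energy ?L ?v' \<noteq> energy ?L w1 + energy ?L w2"
    proof
      assume "energy ?L ?v + energy ?L ?v' = energy ?L w1 + energy ?L w2"
      then have "umon w1 = umon ?v \<and> umon w2 = umon ?v' \<or> umon w1 = umon ?v' \<and> umon w2 = umon ?v"
        using sort(2) u_mon_cong by blast
      then have "s = t" unfolding s t by (auto simp: add.commute)
      then show False using ne by simp
    qed
    then have "total_energy (xmon [?v, ?v']) < total_energy (xmon [w1, w2])"
      using sort(1) E by linarith
    then show "(xmon [?v, ?v'], xmon [w1, w2]) \<in> {(s, t). total_energy s \<le> total_energy t} \<and>
        (xmon [w1, w2], xmon [?v, ?v']) \<notin> {(s, t). total_energy s \<le> total_energy t}" by simp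
  qed
  show ?thesis unfolding s t
  proof (rule reducing_wordsI[OF _ _ _ std xrel_def])
    show "\<exists>k. slab k u" if "u \<in> set [w1, w2]" for u using that w by auto
    show "\<exists>k. lab k u" if "u \<in> set [?v, ?v']" for u using that lv by auto
    show "mset (concat [w1, w2]) = mset (concat [?v, ?v'])" using ms by simp
  qed
qed

text \<open>An entry \<open>(k, M, j, j', M')\<close> stands for one factor of a binomial of type (4).\<close>

lemma type4E:
  assumes "type4 d n a lam m ord G i z z' s t"
  obtains ts where "i \<in> {1..d}" "marked_in (ord i) (G i) z z'"
    "\<forall>(k, M, j, j', M') \<in> set ts. j \<noteq> [] \<and> length j' = length j \<and>
       slab k (M @ map (Pair i) j @ M') \<and> lab k (M @ map (Pair i) j' @ M')"
    "z = (\<Sum>(k, M, j, j', M')\<leftarrow>ts. \<Sum>c\<leftarrow>j. var c)" "z' = (\<Sum>(k, M, j, j', M')\<leftarrow>ts. \<Sum>c\<leftarrow>j'. var c)"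
    "s = xmon (map (\<lambda>(k, M, j, j', M'). M @ map (Pair i) j @ M') ts)"
    "t = xmon (map (\<lambda>(k, M, j, j', M'). M @ map (Pair i) j' @ M') ts)"
  using assms unfolding type4_def
proof (elim conjE exE)
  fix p :: nat and k M M' q j j'
  assume *: "i \<in> {1..d}" "marked_in (ord i) (G i) z z'"
    "\<forall>l<p. q l \<ge> 1 \<and> length (j l) = q l \<and> length (j' l) = q l"
    "\<forall>l<p. slab (k l) (M l @ map (Pair i) (j l) @ M' l)"
    "\<forall>l<p. lab (k l) (M l @ map (Pair i) (j' l) @ M' l)"
    "z = (\<Sum>l<p. \<Sum>c\<leftarrow>j l. var c)" "z' = (\<Sum>l<p. \<Sum>c\<leftarrow>j' l. var c)"
    "s = (\<Sum>l<p. x_var m (M l @ map (Pair i) (j l) @ M' l))"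
    "t = (\<Sum>l<p. x_var m (M l @ map (Pair i) (j' l) @ M' l))"
  define ts where "ts = map (\<lambda>l. (k l, M l, j l, j' l, M' l)) [0..<p]"
  show thesis
  proof (rule that[of ts])
    show "\<forall>(k, M, j, j', M') \<in> set ts. j \<noteq> [] \<and> length j' = length j \<and>
       slab k (M @ map (Pair i) j @ M') \<and> lab k (M @ map (Pair i) j' @ M')"
      using *(3-5) by (fastforce simp: ts_def)
  qed (use * in \<open>simp_all add: ts_def sum_lessThan_conv_sum_list comp_def\<close>)
qed

lemma type4I:
  assumes "i \<in> {1..d}" "marked_in (ord i) (G i) z z'"
    "\<forall>(k, M, j, j', M') \<in> set ts. j \<noteq> [] \<and> length j' = length j \<and>
       slab k (M @ map (Pair i) j @ M') \<and> lab k (M @ map (Pair i) j' @ M')"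
    "z = (\<Sum>(k, M, j, j', M')\<leftarrow>ts. \<Sum>c\<leftarrow>j. var c)" "z' = (\<Sum>(k, M, j, j', M')\<leftarrow>ts. \<Sum>c\<leftarrow>j'. var c)"
    "s = xmon (map (\<lambda>(k, M, j, j', M'). M @ map (Pair i) j @ M') ts)"
    "t = xmon (map (\<lambda>(k, M, j, j', M'). M @ map (Pair i) j' @ M') ts)"
  shows "type4 d n a lam m ord G i z z' s t"
proof -
  let ?k = "\<lambda>l. fst (ts ! l)" and ?M = "\<lambda>l. fst (snd (ts ! l))" and ?j = "\<lambda>l. fst (snd (snd (ts ! l)))"
    and ?j' = "\<lambda>l. fst (snd (snd (snd (ts ! l))))" and ?M' = "\<lambda>l. snd (snd (snd (snd (ts ! l))))"
  have sum: "(\<Sum>x\<leftarrow>ts. f x) = (\<Sum>l<length ts. f (ts ! l))" for f :: "_ \<Rightarrow> 'z::comm_monoid_add"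
    by (simp add: sum_list_sum_nth lessThan_atLeast0)
  have "\<forall>l<length ts. ?j l \<noteq> [] \<and> length (?j' l) = length (?j l) \<and>
      slab (?k l) (?M l @ map (Pair i) (?j l) @ ?M' l) \<and> lab (?k l) (?M l @ map (Pair i) (?j' l) @ ?M' l)"
    using assms(3) nth_mem by (fastforce simp: case_prod_unfold)
  then have 1: "\<forall>l<length ts. 1 \<le> length (?j l) \<and> length (?j l) = length (?j l) \<and> length (?j' l) = length (?j l)"
    "\<forall>l<length ts. slab (?k l) (?M l @ map (Pair i) (?j l) @ ?M' l)"
    "\<forall>l<length ts. lab (?k l) (?M l @ map (Pair i) (?j' l) @ ?M' l)"
    by (simp_all add: Suc_le_eq One_nat_def)
  have 2: "z = (\<Sum>l<length ts. \<Sum>c\<leftarrow>?j l. var c)" "z' = (\<Sum>l<length ts. \<Sum>c\<leftarrow>?j' l. var c)"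
    "s = (\<Sum>l<length ts. x_var m (?M l @ map (Pair i) (?j l) @ ?M' l))"
    "t = (\<Sum>l<length ts. x_var m (?M l @ map (Pair i) (?j' l) @ ?M' l))"
    unfolding assms(4-7) by (simp_all add: sum case_prod_unfold comp_def)
  show ?thesis unfolding type4_def
    by (rule conjI, fact, rule conjI, fact, rule exI[of _ "length ts"], rule exI[of _ ?k],
        rule exI[of _ ?M], rule exI[of _ ?M'], rule exI[of _ "\<lambda>l. length (?j l)"],
        rule exI[of _ ?j], rule exI[of _ ?j']) (intro conjI; fact 1 2)
qed

text \<open>The decision falls in \<open>Zrel\<close>: replacing \<open>z\<close> by
  \<open>z'\<close> strictly lowers the \<open>i\<close>-th component and leaves the letters of the
  others alone, and passing to standard labels afterwards can only lower the components
  further.\<close>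

lemma reducing_type4:
  assumes "type4 d n a lam m ord G i z z' s t"
  shows "reducing s t"
proof -
  obtain ts where i: "i \<in> {1..d}" and mk: "marked_in (ord i) (G i) z z'"
    and ts: "\<forall>(k, M, j, j', M') \<in> set ts. j \<noteq> [] \<and> length j' = length j \<and>
       slab k (M @ map (Pair i) j @ M') \<and> lab k (M @ map (Pair i) j' @ M')"
    and z: "z = (\<Sum>(k, M, j, j', M')\<leftarrow>ts. \<Sum>c\<leftarrow>j. var c)" "z' = (\<Sum>(k, M, j, j', M')\<leftarrow>ts. \<Sum>c\<leftarrow>j'. var c)"
    and st: "s = xmon (map (\<lambda>(k, M, j, j', M'). M @ map (Pair i) j @ M') ts)"
      "t = xmon (map (\<lambda>(k, M, j, j', M'). M @ map (Pair i) j' @ M') ts)"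
    by (rule type4E[OF assms])
  let ?ws = "map (\<lambda>(k, M, j, j', M'). M @ map (Pair i) j @ M') ts"
    and ?ws' = "map (\<lambda>(k, M, j, j', M'). M @ map (Pair i) j' @ M') ts"
  have ws: "\<exists>k. slab k w" if "w \<in> set ?ws" for w using that ts by fastforce
  have ws': "\<exists>k. lab k w" if "w \<in> set ?ws'" for w using that ts by fastforce
  note mk' = marked_inD[OF ord[OF i] G_subset[OF i] mk]
  \<comment> \<open>The contribution of the strings \<open>M\<close>, \<open>M'\<close>, common to
    both sides. These strings may contain letters with first component \<open>i\<close> too, so
    \<open>rest i\<close> need not vanish.\<close>
  define rest where "rest i' = (\<Sum>(k, M, j, j', M')\<leftarrow>ts. z_mon i' M + z_mon i' M')" for i'
  have zc: "z_mon i' (concat ?ws) = rest i' + (if i' = i then z else 0)"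
    "z_mon i' (concat ?ws') = rest i' + (if i' = i then z' else 0)" for i'
    unfolding word_mon_concat rest_def z
    by (induction ts) (auto simp: z_mon_map_Pair ac_simps)
  have uc: "umon (concat ?ws) = (\<Sum>(k, M, j, j', M')\<leftarrow>ts. umon M + umon M') + lin (m i) z"
    "umon (concat ?ws') = (\<Sum>(k, M, j, j', M')\<leftarrow>ts. umon M + umon M') + lin (m i) z'"
  proof -
    have "umon (map (Pair i) j) = lin (m i) (\<Sum>c\<leftarrow>j. var c)" for j
      by (induction j) (auto simp: u_mon_def)
    then show "umon (concat ?ws) = (\<Sum>(k, M, j, j', M')\<leftarrow>ts. umon M + umon M') + lin (m i) z"
      "umon (concat ?ws') = (\<Sum>(k, M, j, j', M')\<leftarrow>ts. umon M + umon M') + lin (m i) z'"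
      unfolding word_mon_concat z by (induction ts) (auto simp: ac_simps)
  qed
  have m: "s \<in> mons X" "t \<in> mons X" unfolding st
    using xmon_in_mons[of ?ws'] ws' xmon_in_mons[of ?ws] ws slab_lab by blast+
  have Zs: "Zmon i' s = rest i' + (if i' = i then z else 0)" for i'
    using Zmon_slabs[of ?ws, OF ws] unfolding st zc by blast
  have Zt: "(Zmon i' t, rest i' + (if i' = i then z' else 0)) \<in> ord i'" if "i' \<in> {1..d}" for i'
    using Zmon_labs(1)[of ?ws', OF ws' that] unfolding st zc by blast
  have rest: "rest i' \<in> mons {1..lam i'}" if "i' \<in> {1..d}" for i'
    using Zmon_in_mons[OF m(1), of i'] unfolding Zs by (auto simp: plus_in_mons_iff split: if_splits)
  have le: "(rest i + z', rest i + z) \<in> ord i"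
    using monomial_order_plus[OF ord[OF i] mk'(5) mk'(3,2) rest[OF i]] by (simp add: add.commute)
  have ts: "(t, s) \<in> Zrel"
  proof (rule ZrelI)
    fix i' assume i': "i' \<in> {1..d}"
    show "(Zmon i' t, Zmon i' s) \<in> ord i'"
      using Zt[OF i'] le monomial_order_trans[OF ord[OF i']] unfolding Zs by (cases "i' = i") auto
  qed
  have nst: "(s, t) \<notin> Zrel"
  proof
    assume "(s, t) \<in> Zrel"
    then have "(rest i + z, Zmon i t) \<in> ord i" using Zrel_eqD[OF _ ts i] unfolding Zs by simp
    moreover have "(Zmon i t, rest i + z') \<in> ord i" using Zt[OF i] by simp
    ultimately have "(rest i + z, rest i + z') \<in> ord i"
      by (rule monomial_order_trans[OF ord[OF i]])
    then have "rest i + z = rest i + z'" using le by (rule monomial_order_antisym[OF ord[OF i]])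
    then show False using mk'(1) by simp
  qed
  have "(t, s) \<in> xrel \<and> (s, t) \<notin> xrel"
    unfolding xrel_def by (rule lex_prod_strictI) (use ts nst in blast)+
  then show ?thesis
    unfolding reducing_def using m uc mk'(4) unfolding st lin_xmon_id by simp
qed

lemma reducing_marked: "(s, t) \<in> marked \<Longrightarrow> reducing s t"
  unfolding nested_marked_binomials_def
  using reducing_type1 reducing_type2 reducing_type3 reducing_type4 by blast

section \<open>Monomials not divisible by a marked initial monomial\<close>

lemma lab_replace:
  assumes "lab k (M @ map (Pair i) j @ M')" "length j' = length j" "set (map (Pair i) j') \<subseteq> letters d lam"
  shows "lab k (M @ map (Pair i) j' @ M')"
proof -
  have "mon_mset (t_mon (map (Pair i) js)) = replicate_mset (length js) i" for js :: "nat list"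
    by (induction js) (auto simp: mon_mset_t_mon)
  then have "t_mon (map (Pair i) j') = t_mon (map (Pair i) j)"
    using assms(2) by (metis mon_mset_inject)
  then show ?thesis using assms(1,3) by (auto simp: label_def)
qed

text \<open>The order of letters in a label is immaterial, so the letters to be replaced may be
  moved to the end. This gives the shape required by type (4), with \<open>M'\<close> empty.\<close>

lemma slab_extract:
  assumes x: "x \<in> X" and C: "C \<subseteq># mon_mset (z_mon i (slabel x))"
  shows "slab (index x) (list_of_mset (mset (slabel x) - image_mset (Pair i) C) @ map (Pair i) (list_of_mset C) @ [])"
    and "umon (list_of_mset (mset (slabel x) - image_mset (Pair i) C) @ map (Pair i) (list_of_mset C) @ []) = x"
proof -
  have "image_mset (Pair i) C \<subseteq># image_mset (Pair i) (mon_mset (z_mon i (slabel x)))"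
    using C by (rule image_mset_subseteq_mono)
  also have "\<dots> = filter_mset (\<lambda>x. fst x = i) (mset (slabel x))"
    unfolding mon_mset_z_mon multiset.map_comp
    by (subst multiset.map_cong[OF refl, of _ _ id]) auto
  also have "\<dots> \<subseteq># mset (slabel x)" by simp
  finally have ms: "mset (list_of_mset (mset (slabel x) - image_mset (Pair i) C) @ map (Pair i) (list_of_mset C) @ [])
      = mset (slabel x)" by (simp add: subset_mset.diff_add)
  show "slab (index x) (list_of_mset (mset (slabel x) - image_mset (Pair i) C) @ map (Pair i) (list_of_mset C) @ [])"
    by (rule slab_cong[OF ms[symmetric] slabel(1)[OF x]])
  show "umon (list_of_mset (mset (slabel x) - image_mset (Pair i) C) @ map (Pair i) (list_of_mset C) @ []) = x"
    by (rule trans[OF u_mon_cong[OF ms] slabel(2)[OF x]])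
qed

definition irreducible_mon :: "'u mon mon \<Rightarrow> bool" where
  "irreducible_mon s \<longleftrightarrow> s \<in> mons X \<and> (\<forall>(s', t') \<in> marked. \<not> mon_dvd s' s)"

lemma irreducible_type:
  assumes "irreducible_mon s"
  shows "(s', t') \<in> type1 d n a lam m ord0 G0 ord G \<Longrightarrow> \<not> mon_dvd s' s"
    and "(s', t') \<in> type2 d n r a lam m ord G \<Longrightarrow> \<not> mon_dvd s' s"
    and "(s', t') \<in> type3 d n a lam m ord G \<Longrightarrow> \<not> mon_dvd s' s"
    and "type4 d n a lam m ord G i z z' s' t' \<Longrightarrow> \<not> mon_dvd s' s"
  using assms unfolding irreducible_mon_def nested_marked_binomials_def by blast+

text \<open>If an initial monomial \<open>?z\<close> divides \<open>Zmon i s\<close>, its letters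
  are shared out among variables of \<open>s\<close>, and each share is exchanged for an equally
  long piece of \<open>z'\<close>. This is a binomial of type (4) whose underlined monomial divides
  \<open>s\<close>.\<close>

lemma stdz_Zmon:
  assumes irr: "irreducible_mon s" and i: "i \<in> {1..d}"
  shows "stdz i (Zmon i s)"
proof (rule ccontr)
  assume "\<not> stdz i (Zmon i s)"
  have s: "s \<in> mons X" using irr by (simp add: irreducible_mon_def)
  obtain g where g: "g \<in> G i" "mon_dvd (init_mon (ord i) g) (Zmon i s)"
    using \<open>\<not> stdz i (Zmon i s)\<close> stdz_iff[OF i Zmon_in_mons[OF s]] by blast
  let ?z = "init_mon (ord i) g"
  have "g \<noteq> 0" using G[OF i] g(1) by (auto simp: groebner_basis_def)
  moreover have "Poly_Mapping.keys g \<subseteq> mons {1..lam i}"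
    using G_subset[OF i] g(1) toric_ideal_iff by blast
  ultimately obtain z' where mk: "marked_in (ord i) (G i) ?z z'"
    using marked_in_of_basis[OF ord[OF i] g(1) bin_G[OF i g(1)]] by blast
  note mk' = marked_inD[OF ord[OF i] G_subset[OF i] mk]
  obtain xs where xs: "mset xs = mon_mset s" using ex_mset by blast
  have xsX: "set xs \<subseteq> X" using s mset_eq_setD[of xs] by (metis mons_iff set_mset_mset xs)
  have "mon_mset ?z \<subseteq># (\<Sum>x\<leftarrow>xs. mon_mset (z_mon i (slabel x)))"
    using g(2) unfolding mon_dvd_iff Zmon_def mset_eq_mon_mset_imp[OF xs, symmetric]
    by (simp add: mon_mset_sum_list comp_def)
  then obtain ys where ys: "mon_mset ?z = (\<Sum>(x, C)\<leftarrow>ys. C)"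
    "\<forall>(x, C)\<in>set ys. C \<noteq> {#} \<and> C \<subseteq># mon_mset (z_mon i (slabel x))" "mset (map fst ys) \<subseteq># mset xs"
    using subset_mset_sum_listD by blast
  have ysX: "x \<in> X" if "(x, C) \<in> set ys" for x C
    using set_mset_mono[OF ys(3)] xsX that by force
  define zs where "zs = list_of_mset (mon_mset z')"
  \<comment> \<open>The toric ideal is homogeneous, so \<open>z'\<close> has exactly enough letters
    to be cut into pieces of the lengths of the shares.\<close>
  have "length zs = mon_degree z'" by (metis mon_degree_eq_size mset_list_of_mset size_mset zs_def)
  also have "\<dots> = mon_degree ?z"
    using hom_m[OF i] mk'(2-4) unfolding degree_homogeneous_def by metis
  also have "\<dots> = sum_list (map (size \<circ> snd) ys)"
    unfolding mon_degree_eq_size ys(1) by (induction ys) auto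
  finally obtain yss where yss: "map length yss = map (size \<circ> snd) ys" "concat yss = zs"
    using list_split_lengths by blast
  then have len: "length yss = length ys" by (metis length_map)
  have len_nth: "length j' = size C" if "((x, C), j') \<in> set (zip ys yss)" for x C j'
    using that yss(1) len by (auto simp: set_zip) (metis comp_apply nth_map snd_conv)
  define ts where "ts = map (\<lambda>((x, C), j'). (index x,
      list_of_mset (mset (slabel x) - image_mset (Pair i) C), list_of_mset C, j', [] :: letter list)) (zip ys yss)"
  let ?s = "xmon (map (\<lambda>(k, M, j, j', M'). M @ map (Pair i) j @ M') ts)"
  have t4: "type4 d n a lam m ord G i ?z z' ?s (xmon (map (\<lambda>(k, M, j, j', M'). M @ map (Pair i) j' @ M') ts))"
  proof (rule type4I[OF i mk _ _ _ refl refl])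
    show "\<forall>(k, M, j, j', M') \<in> set ts. j \<noteq> [] \<and> length j' = length j \<and>
       slab k (M @ map (Pair i) j @ M') \<and> lab k (M @ map (Pair i) j' @ M')"
    proof (clarify)
      fix k M j j' M' assume "(k, M, j, j', M') \<in> set ts"
      then obtain x C where x: "((x, C), j') \<in> set (zip ys yss)"
        and eqs: "k = index x" "M = list_of_mset (mset (slabel x) - image_mset (Pair i) C)"
          "j = list_of_mset C" "M' = []" by (auto simp: ts_def)
      have mem: "(x, C) \<in> set ys" "j' \<in> set yss" using x by (auto dest: set_zip_leftD set_zip_rightD)
      have C: "C \<noteq> {#}" "C \<subseteq># mon_mset (z_mon i (slabel x))" using ys(2) mem(1) by auto
      have sl: "slab k (M @ map (Pair i) j @ M')" unfolding eqs by (rule slab_extract(1)[OF ysX[OF mem(1)] C(2)])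
      have lj: "length j' = length j" using len_nth[OF x] eqs by (metis mset_list_of_mset size_mset)
      have "set j' \<subseteq> set zs" using mem(2) yss(2) by auto
      also have "\<dots> \<subseteq> {1..lam i}" using mk'(3) by (simp add: zs_def mons_def)
      finally have "set (map (Pair i) j') \<subseteq> letters d lam" using i by (auto simp: letters_def)
      then have "lab k (M @ map (Pair i) j' @ M')" using lab_replace[OF slab_lab[OF sl] lj] by blast
      moreover have "j \<noteq> []" using C(1) eqs by (metis mset.simps(1) mset_list_of_mset)
      ultimately show "j \<noteq> [] \<and> length j' = length j \<and>
         slab k (M @ map (Pair i) j @ M') \<and> lab k (M @ map (Pair i) j' @ M')" using sl lj by blast
    qed
    have "(\<Sum>(k, M, j, j', M')\<leftarrow>ts. \<Sum>c\<leftarrow>j. var c) = (\<Sum>(x, C)\<leftarrow>map fst (zip ys yss). \<Sum>c\<in>#C. var c)"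
      unfolding ts_def by (simp add: case_prod_unfold comp_def flip: sum_mset_sum_list)
    also have "\<dots> = (\<Sum>(x, C)\<leftarrow>ys. \<Sum>c\<in>#C. var c)" using len by simp
    also have "\<dots> = (\<Sum>c\<in>#(\<Sum>(x, C)\<leftarrow>ys. C). var c)" by (induction ys) auto
    finally show "?z = (\<Sum>(k, M, j, j', M')\<leftarrow>ts. \<Sum>c\<leftarrow>j. var c)" using ys(1) by (metis vars_mon_mset)
    have "(\<Sum>(k, M, j, j', M')\<leftarrow>ts. \<Sum>c\<leftarrow>j'. var c) = (\<Sum>j'\<leftarrow>map snd (zip ys yss). \<Sum>c\<leftarrow>j'. var c)"
      unfolding ts_def by (simp add: case_prod_unfold comp_def)
    also have "\<dots> = (\<Sum>j'\<leftarrow>yss. \<Sum>c\<leftarrow>j'. var c)" using len by simp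
    also have "\<dots> = (\<Sum>c\<leftarrow>concat yss. var c)" by (induction yss) auto
    also have "\<dots> = z'" using yss(2) mset_eq_mon_mset_imp[of zs z' var] by (simp add: zs_def)
    finally show "z' = (\<Sum>(k, M, j, j', M')\<leftarrow>ts. \<Sum>c\<leftarrow>j'. var c)" by simp
  qed
  \<comment> \<open>Rearranging a standard label does not change its variable, so \<open>?s\<close>
    is the product of the variables that contributed, each as often as it was used, and divides
    \<open>s\<close>.\<close>
  have "?s = (\<Sum>(x, C)\<leftarrow>map fst (zip ys yss). var x)"
    unfolding ts_def map_map
  proof (rule arg_cong[of _ _ sum_list], rule map_cong[OF refl])
    fix e assume e: "e \<in> set (zip ys yss)"
    obtain x C j' where [simp]: "e = ((x, C), j')" by (metis prod.exhaust)
    have "(x, C) \<in> set ys" using e by (auto dest: set_zip_leftD)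
    then have "umon (list_of_mset (mset (slabel x) - image_mset (Pair i) C) @ map (Pair i) (list_of_mset C) @ []) = x"
      using slab_extract(2)[OF ysX] ys(2) by fast
    then show "((\<lambda>w. x_var m w) \<circ> ((\<lambda>(k, M, j, j', M'). M @ map (Pair i) j @ M') \<circ> (\<lambda>((x, C), j'). (index x,
      list_of_mset (mset (slabel x) - image_mset (Pair i) C), list_of_mset C, j', [] :: letter list)))) e
       = ((\<lambda>(x, C). var x) \<circ> fst) e" by simp
  qed
  also have "\<dots> = (\<Sum>x\<leftarrow>map fst ys. var x)" using len by (simp add: case_prod_unfold comp_def)
  finally have "mon_mset ?s = mset (map fst ys)" by (simp only: mon_mset_var_list)
  then have "mon_dvd ?s s" using ys(3) xs by (simp add: mon_dvd_iff)
  then show False using irreducible_type(4)[OF irr t4] by blast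
qed

lemma type1I:
  assumes "list_all2 slab ks ws" "list_all2 lab ks' ws'" "length ws = length ws'"
    "marked_in ord0 G0 (\<Sum>k\<leftarrow>ks. var k) (\<Sum>k\<leftarrow>ks'. var k)" "mset (concat ws) = mset (concat ws')"
  shows "(xmon ws, xmon ws') \<in> type1 d n a lam m ord0 G0 ord G"
proof -
  let ?p = "length ws"
  have len: "length ks = ?p" "length ks' = ?p" "length ws' = ?p"
    using assms(1-3) by (auto dest: list_all2_lengthD)
  have sum: "(\<Sum>x\<leftarrow>xs. f x) = (\<Sum>l<length xs. f (xs ! l))" for f :: "'y \<Rightarrow> 'z::comm_monoid_add" and xs
    by (simp add: sum_list_sum_nth lessThan_atLeast0)
  have "(\<Sum>l<?p. x_var m (ws ! l), \<Sum>l<?p. x_var m (ws' ! l)) \<in> type1 d n a lam m ord0 G0 ord G"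
    unfolding type1_def mem_Collect_eq
  proof (intro exI conjI)
    show "(\<Sum>l<?p. x_var m (ws ! l), \<Sum>l<?p. x_var m (ws' ! l)) = (\<Sum>l<?p. x_var m (ws ! l), \<Sum>l<?p. x_var m (ws' ! l))" ..
    show "\<forall>l<?p. slab (ks ! l) (ws ! l)" "\<forall>l<?p. lab (ks' ! l) (ws' ! l)"
      using assms(1,2) len by (auto simp: list_all2_conv_all_nth)
    show "marked_in ord0 G0 (\<Sum>l<?p. var (ks ! l)) (\<Sum>l<?p. var (ks' ! l))"
      using assms(4) by (simp add: sum len)
    have "map ((!) ws) [0..<?p] = ws" "map ((!) ws') [0..<?p] = ws'"
      using len map_nth[of ws] map_nth[of ws'] by simp_all
    then show "sort (concat (map ((!) ws) [0..<?p])) = sort (concat (map ((!) ws') [0..<?p]))"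
      using assms(5) by (metis properties_for_sort sorted_sort mset_sort)
  qed
  then show ?thesis by (simp add: sum len)
qed

lemma lin_a_Ymon: "s \<in> mons X \<Longrightarrow> lin a (Ymon s) = lin (\<lambda>x. t_mon (slabel x)) s"
proof -
  assume s: "s \<in> mons X"
  have "lin a (Ymon s) = lin (\<lambda>x. a (index x)) s"
    by (simp add: Ymon_def lin_def[of _ s] lin_sum_mset)
  also have "\<dots> = lin (\<lambda>x. t_mon (slabel x)) s"
    by (rule lin_cong) (use s slab_lab[OF slabel(1)] in \<open>auto simp: mons_def label_def subset_iff\<close>)
  finally show ?thesis .
qed

text \<open>If an initial monomial of \<open>G0\<close> divides \<open>Ymon s\<close>, pick
  variables of \<open>s\<close> with these superscripts. Their letters can be regrouped into words
  with the superscripts of \<open>z'\<close>, in any way that respects first components, and the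
  result is a binomial of type (1).\<close>

lemma fibre_min_Ymon:
  assumes irr: "irreducible_mon s"
  shows "fibre_min {1..n} ord0 a (Ymon s)"
proof (rule ccontr)
  assume neg: "\<not> fibre_min {1..n} ord0 a (Ymon s)"
  have s: "s \<in> mons X" using irr by (simp add: irreducible_mon_def)
  obtain g where g: "g \<in> G0" "mon_dvd (init_mon ord0 g) (Ymon s)"
    using neg fibre_min_iff_not_dvd[OF ord0 _ hom_a G0 Ymon_in_mons[OF s]] by auto
  let ?z = "init_mon ord0 g"
  have "g \<noteq> 0" using G0 g(1) by (auto simp: groebner_basis_def)
  moreover have "Poly_Mapping.keys g \<subseteq> mons {1..n}"
    using G0_subset g(1) toric_ideal_iff by blast
  ultimately obtain z' where mk: "marked_in ord0 G0 ?z z'"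
    using marked_in_of_basis[OF ord0 g(1)] bin_G0 g(1) by blast
  note mk' = marked_inD[OF ord0 G0_subset mk]
  have "mon_mset (Ymon s) = image_mset index (mon_mset s)"
    by (simp add: Ymon_def lin_def mon_mset_sum_mset)
  then obtain R where "image_mset index (mon_mset s) = mon_mset ?z + R"
    using g(2) unfolding mon_dvd_iff by (metis mset_subset_eq_exists_conv)
  then obtain N where N: "N \<subseteq># mon_mset s" "mon_mset ?z = image_mset index N"
    using image_mset_eq_plusD[of index "mon_mset s"] by (metis mset_subset_eq_add_left)
  define xs where "xs = list_of_mset N"
  have xs: "mset xs = N" by (simp add: xs_def)
  have xsX: "set xs \<subseteq> X"
    using set_mset_mono[OF N(1)] s by (simp add: xs_def mons_def)
  define ks' where "ks' = list_of_mset (mon_mset z')"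
  have z: "?z = (\<Sum>k\<leftarrow>map index xs. var k)" "z' = (\<Sum>k\<leftarrow>ks'. var k)"
    using mset_eq_mon_mset_imp[of "map index xs" ?z var] mset_eq_mon_mset_imp[of ks' z' var] N(2) xs
    by (simp_all add: ks'_def)
  have "length ks' = mon_degree z'" by (metis mon_degree_eq_size mset_list_of_mset size_mset ks'_def)
  also have "\<dots> = mon_degree ?z"
    using hom_a mk'(2-4) unfolding degree_homogeneous_def by metis
  also have "\<dots> = length xs" unfolding mon_degree_eq_size N(2) by (simp flip: xs)
  finally have len: "length ks' = length xs" .
  let ?ws = "map slabel xs"
  have slab: "list_all2 slab (map index xs) ?ws"
    using xsX slabel(1) by (auto simp: list_all2_conv_all_nth subset_iff)
  \<comment> \<open>Both sides of the binomial from \<open>G0\<close> have the same image under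
    \<open>a\<close>; hence the available first components are exactly those that the new words
    require.\<close>
  have "t_mon (concat ?ws) = (\<Sum>x\<leftarrow>xs. a (index x))"
    unfolding word_mon_concat map_map
    by (rule arg_cong[of _ _ sum_list], rule map_cong[OF refl])
      (use xsX slab_lab[OF slabel(1)] in \<open>auto simp: label_def\<close>)
  also have "\<dots> = lin a ?z" unfolding z by (simp add: lin_sum_list comp_def)
  also have "\<dots> = (\<Sum>k\<leftarrow>ks'. a k)" unfolding mk'(4) by (simp add: z(2) lin_sum_list)
  finally have "image_mset fst (mset (concat ?ws)) = (\<Sum>k\<leftarrow>ks'. mon_mset (a k))"
    unfolding mon_mset_t_mon[symmetric] by (simp add: mon_mset_sum_list comp_def)
  then obtain Ms where Ms: "length Ms = length ks'"
    "\<forall>l<length ks'. image_mset fst (Ms ! l) = mon_mset (a (ks' ! l))" "mset (concat ?ws) = sum_list Ms"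
    using image_mset_eq_sum_listD by blast
  let ?ws' = "map list_of_mset Ms"
  have "set (concat ?ws) \<subseteq> letters d lam"
    using xsX lab_letters[OF slab_lab[OF slabel(1)]] by auto
  then have letters: "set_mset (sum_list Ms) \<subseteq> letters d lam" using Ms(3) by (metis set_mset_mset)
  have ks': "set ks' \<subseteq> {1..n}" using mk'(3) by (simp add: ks'_def mons_def)
  have lab: "list_all2 lab ks' ?ws'"
    unfolding list_all2_conv_all_nth
  proof (intro conjI allI impI)
    fix l assume l: "l < length ks'"
    have "mon_mset (t_mon (?ws' ! l)) = mon_mset (a (ks' ! l))"
      using Ms(1,2) l by (simp add: mon_mset_t_mon)
    moreover have "set (?ws' ! l) = set_mset (Ms ! l)" "Ms ! l \<in> set Ms" using Ms(1) l by simp_all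
    then have "set (?ws' ! l) \<subseteq> letters d lam" using letters by auto
    moreover have "ks' ! l \<in> {1..n}" using ks' l nth_mem by blast
    ultimately show "lab (ks' ! l) (?ws' ! l)" by (simp add: label_def mon_mset_inject)
  qed (simp add: Ms)
  have "mset (concat ?ws') = sum_list Ms" by (induction Ms) auto
  then have "(xmon ?ws, xmon ?ws') \<in> type1 d n a lam m ord0 G0 ord G"
    using type1I[OF slab lab] mk z Ms len by simp
  moreover have "mon_dvd (xmon ?ws) s"
  proof -
    have "xmon ?ws = (\<Sum>x\<leftarrow>xs. var x)"
      unfolding map_map by (rule arg_cong[of _ _ sum_list], rule map_cong[OF refl]) (use xsX slabel(2) in auto)
    then have "mon_mset (xmon ?ws) = N" using xs by (simp only: mon_mset_var_list)
    then show ?thesis using N(1) by (simp add: mon_dvd_iff)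
  qed
  ultimately show False using irreducible_type(1)[OF irr] by blast
qed

lemma pair_dvd:
  assumes "x \<in> Poly_Mapping.keys s" "x' \<in> Poly_Mapping.keys s" "x \<noteq> x'"
  shows "mon_dvd (var x + var x') s"
proof -
  have "{#x, x'#} \<subseteq># mon_mset s"
    using assms by (auto simp: subseteq_mset_def in_keys_iff)
  then show ?thesis by (simp add: mon_dvd_iff add_mset_commute)
qed

lemma irreducible_ordered:
  assumes irr: "irreducible_mon s" and x: "x \<in> Poly_Mapping.keys s" "x' \<in> Poly_Mapping.keys s"
    and k: "index x < index x'" and ij: "(i, j) \<in> set (slabel x)" "(i, j') \<in> set (slabel x')"
  shows "j \<le> j'"
proof (rule ccontr)
  assume "\<not> j \<le> j'"
  have X: "x \<in> X" "x' \<in> X" using irr x by (auto simp: irreducible_mon_def mons_def)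
  obtain l where l: "l < length (slabel x)" "slabel x ! l = (i, j)" using ij by (metis in_set_conv_nth)
  obtain l' where l': "l' < length (slabel x')" "slabel x' ! l' = (i, j')" using ij by (metis in_set_conv_nth)
  have "fst (slabel x ! l) = fst (slabel x' ! l')" "snd (slabel x ! l) > snd (slabel x' ! l')"
    using l l' \<open>\<not> j \<le> j'\<close> by simp_all
  then have "(x_var m (slabel x) + x_var m (slabel x'),
      x_var m ((slabel x)[l := slabel x' ! l']) + x_var m ((slabel x')[l' := slabel x ! l]))
      \<in> type3 d n a lam m ord G"
    unfolding type3_def mem_Collect_eq
    using slabel(1)[OF X(1)] slabel(1)[OF X(2)] k l(1) l'(1) by blast
  then obtain t where "(var x + var x', t) \<in> type3 d n a lam m ord G"
    using slabel(2)[OF X(1)] slabel(2)[OF X(2)] by auto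
  moreover have "x \<noteq> x'" using k by auto
  ultimately show False using irreducible_type(3)[OF irr] pair_dvd[OF x] by blast
qed

text \<open>Failure of type (2) only says that sorting does not change the two variables, not that
  it does not change their labels. But the monomials of the sorted words divide
  \<open>Zmon i s\<close>, which is standard by \<open>stdz_Zmon\<close>; so these words are
  standard labels and agree with \<open>slabel\<close> up to order.\<close>

lemma irreducible_interlaced:
  assumes irr: "irreducible_mon s" and x: "x \<in> Poly_Mapping.keys s" "x' \<in> Poly_Mapping.keys s"
    and k: "index x = index x'"
  shows "interlaced (slabel x) (slabel x')"
proof (cases "x = x'")
  case True
  then show ?thesis by (simp add: interlaced_refl)
next
  case False
  have X: "x \<in> X" "x' \<in> X" using irr x by (auto simp: irreducible_mon_def mons_def)
  have w: "slab (index x) (slabel x)" "slab (index x) (slabel x')"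
    using slabel(1)[OF X(1)] slabel(1)[OF X(2)] k by simp_all
  note lw = slab_lab[OF w(1)] slab_lab[OF w(2)]
  define v where "v = sort (slabel x @ slabel x')"
  have v: "sorted v" "length v = 2 * r"
    using lab_length[OF lw(1)] lab_length[OF lw(2)] by (simp_all add: v_def)
  note lv = parts_lab[OF lw v_def]
  have eq: "x_var m (slabel x) + x_var m (slabel x') = x_var m (odd_part v r) + x_var m (even_part v r)"
  proof (rule ccontr)
    assume "\<not> ?thesis"
    then have "(x_var m (slabel x) + x_var m (slabel x'),
        x_var m (odd_part v r) + x_var m (even_part v r)) \<in> type2 d n r a lam m ord G"
      unfolding type2_def odd_part_def even_part_def using w v_def by blast
    then have "\<not> mon_dvd (var x + var x') s"
      using irreducible_type(2)[OF irr] slabel(2)[OF X(1)] slabel(2)[OF X(2)] by simp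
    then show False using pair_dvd[OF x False] by blast
  qed
  have "mon_dvd (var x + var x') s" by (rule pair_dvd[OF x False])
  then obtain u where u: "s = var x + var x' + u" by (auto simp: mon_dvd_def)
  have std: "slab (index x) (odd_part v r)" "slab (index x) (even_part v r)"
  proof -
    have "stdz i (z_mon i y)" if i: "i \<in> {1..d}" and y: "y = odd_part v r \<or> y = even_part v r" for i y
    proof -
      have "Zmon i s = z_mon i (slabel x) + z_mon i (slabel x') + Zmon i u"
        unfolding u by (simp add: Zmon_def)
      also have "z_mon i (slabel x) + z_mon i (slabel x') = z_mon i (odd_part v r @ even_part v r)"
        using mset_parts[OF v(2)] by (subst word_mon_append(2)[symmetric], intro z_mon_cong) (simp add: v_def)
      finally have "mon_dvd (z_mon i y) (Zmon i s)"
        using y by (auto simp: mon_dvd_iff)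
      then show ?thesis using fibre_min_dvd[OF ord[OF i] stdz_Zmon[OF irr i]] by blast
    qed
    then show "slab (index x) (odd_part v r)" "slab (index x) (even_part v r)"
      using lv unfolding slab_iff by blast+
  qed
  have "{#x, x'#} = {#umon (odd_part v r), umon (even_part v r)#}"
    using arg_cong[OF eq, of mon_mset] slabel(2)[OF X(1)] slabel(2)[OF X(2)]
    by (simp add: add_mset_commute)
  then have "x = umon (odd_part v r) \<and> x' = umon (even_part v r) \<or>
      x = umon (even_part v r) \<and> x' = umon (odd_part v r)"
    by (auto simp: add_eq_conv_ex)
  then have "mset (slabel x) = mset (odd_part v r) \<and> mset (slabel x') = mset (even_part v r) \<or>
      mset (slabel x) = mset (even_part v r) \<and> mset (slabel x') = mset (odd_part v r)"
    using slabel_umon[OF std(1)] slabel_umon[OF std(2)] by blast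
  then show ?thesis using interlaced_parts[OF v] interlaced_cong by blast
qed

section \<open>What the image of a monomial determines\<close>

lemma lin_id_eq_sum_Zmon:
  assumes "s \<in> mons X"
  shows "lin (\<lambda>x. x) s = (\<Sum>i\<in>{1..d}. lin (m i) (Zmon i s))"
proof -
  have "(\<Sum>x\<in>#M. x) = (\<Sum>i\<in>{1..d}. lin (m i) (\<Sum>x\<in>#M. z_mon i (slabel x)))" if "set_mset M \<subseteq> X" for M
    using that
  proof (induction M)
    case (add x M)
    then have x: "x \<in> X" by simp
    have "x = (\<Sum>i\<in>{1..d}. lin (m i) (z_mon i (slabel x)))"
      by (rule trans[OF slabel(2)[OF x, symmetric] u_mon_eq_sum[OF lab_letters[OF slab_lab[OF slabel(1)[OF x]]]]])
    then show ?case using add by (simp add: sum.distrib)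
  qed simp
  then show ?thesis using assms by (simp add: lin_def[of _ s] Zmon_def mons_iff)
qed

lemma lin_m_Zmon_eq:
  assumes "s \<in> mons X" "t \<in> mons X" "lin (\<lambda>x. x) s = lin (\<lambda>x. x) t" "i \<in> {1..d}"
  shows "lin (m i) (Zmon i s) = lin (m i) (Zmon i t)"
  by (rule lin_m_eqI[OF Zmon_in_mons[OF assms(1)] Zmon_in_mons[OF assms(2)] _ assms(4)])
    (use lin_id_eq_sum_Zmon[OF assms(1)] lin_id_eq_sum_Zmon[OF assms(2)] assms(3) in simp)

text \<open>All letters of the standard labels, strung together as one word, have
  \<open>lin a (Ymon s)\<close> as their \<open>t_mon\<close>, so \<open>t_mon_eqI\<close> applies
  to the two words at once.\<close>

lemma lin_a_Ymon_eq:
  assumes st: "s \<in> mons X" "t \<in> mons X" "lin (\<lambda>x. x) s = lin (\<lambda>x. x) t"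
  shows "lin a (Ymon s) = lin a (Ymon t)"
proof -
  have word: "\<exists>w. set w \<subseteq> letters d lam \<and> t_mon w = lin a (Ymon s) \<and> (\<forall>i. z_mon i w = Zmon i s)"
    if s: "s \<in> mons X" for s
  proof (intro exI conjI allI)
    let ?w = "concat (map slabel (list_of_mset (mon_mset s)))"
    show "set ?w \<subseteq> letters d lam"
      using s lab_letters[OF slab_lab[OF slabel(1)]] by (auto simp: mons_def)
    show "t_mon ?w = lin a (Ymon s)" "z_mon i ?w = Zmon i s" for i
      using mset_eq_mon_mset_imp[of "list_of_mset (mon_mset s)" s]
      by (simp_all add: word_mon_concat comp_def lin_a_Ymon[OF s] Zmon_def)
  qed
  obtain w where w: "set w \<subseteq> letters d lam" "t_mon w = lin a (Ymon s)" "\<forall>i. z_mon i w = Zmon i s"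
    using word[OF st(1)] by blast
  obtain w' where w': "set w' \<subseteq> letters d lam" "t_mon w' = lin a (Ymon t)" "\<forall>i. z_mon i w' = Zmon i t"
    using word[OF st(2)] by blast
  have "t_mon w = t_mon w'"
    by (rule t_mon_eqI[OF w(1) w'(1)]) (use lin_m_Zmon_eq[OF st] w(3) w'(3) in simp)
  then show ?thesis using w(2) w'(2) by simp
qed

lemma mon_degree_Ymon: "mon_degree (Ymon s) = mon_degree s"
  by (simp add: mon_degree_eq_size Ymon_def lin_def mon_mset_sum_mset)

text \<open>The degree of \<open>s\<close> is the number of its superscripts, which the image
  controls through the homogeneity of \<open>a\<close>.\<close>

lemma homogeneous_X: "degree_homogeneous X (\<lambda>x. x)"
  unfolding degree_homogeneous_def
proof (intro ballI impI)
  fix s t assume st: "s \<in> mons X" "t \<in> mons X" "lin (\<lambda>x. x) s = lin (\<lambda>x. x) t"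
  have "mon_degree (Ymon s) = mon_degree (Ymon t)"
    using hom_a lin_a_Ymon_eq[OF st] Ymon_in_mons[OF st(1)] Ymon_in_mons[OF st(2)]
    unfolding degree_homogeneous_def by blast
  then show "mon_degree s = mon_degree t" by (simp add: mon_degree_Ymon)
qed

section \<open>Recovering the labels from the letters\<close>

definition words_at :: "'u mon list \<Rightarrow> nat \<Rightarrow> letter list list" where
  "words_at xs k = map slabel (filter (\<lambda>x. index x = k) xs)"

text \<open>By type (3) the blocks of an irreducible monomial come in weakly increasing order as
  \<open>k\<close> grows, which is the situation of \<open>ordered_blocks_unique\<close>.\<close>

definition block :: "'u mon list \<Rightarrow> nat \<Rightarrow> nat \<Rightarrow> nat list" where
  "block xs i k = map snd (filter (\<lambda>x. fst x = i) (concat (words_at xs k)))"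

lemma mset_block: "mset (block xs i k) = mon_mset (z_mon i (concat (words_at xs k)))"
  by (simp only: block_def mon_mset_z_mon mset_map mset_filter)

text \<open>A word with superscript \<open>k\<close> has as many letters with first component
  \<open>i\<close> as \<open>a k\<close> prescribes. With \<open>length_words_at\<close>, block
  lengths are thus known from \<open>Ymon\<close> before the blocks themselves are.\<close>

lemma length_block:
  assumes "set xs \<subseteq> X"
  shows "length (block xs i k) = length (words_at xs k) * Poly_Mapping.lookup (a k) i"
proof -
  have "length (filter (\<lambda>x. fst x = i) (concat (words_at xs k))) = mon_degree (z_mon i (concat (words_at xs k)))"
    by (simp add: mon_degree_eq_size mon_mset_z_mon filter_mset_length)
  also have "\<dots> = (\<Sum>w\<leftarrow>words_at xs k. mon_degree (z_mon i w))"
    unfolding word_mon_concat by (rule mon_degree_sum_list)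
  also have "\<dots> = (\<Sum>w\<leftarrow>words_at xs k. Poly_Mapping.lookup (a k) i)"
    by (rule arg_cong[of _ _ sum_list], rule map_cong[OF refl])
      (use assms slab_lab[OF slabel(1)] in \<open>auto simp: words_at_def label_def lookup_t_mon[symmetric] subset_iff\<close>)
  finally show ?thesis by (simp add: block_def sum_list_triv)
qed

lemma index_in: "x \<in> X \<Longrightarrow> index x \<in> {1..n}"
  using slab_lab[OF slabel(1)] by (simp add: label_def)

lemma length_words_at:
  assumes "mset xs = mon_mset s"
  shows "length (words_at xs k) = Poly_Mapping.lookup (Ymon s) k"
proof -
  have "Poly_Mapping.lookup (Ymon s) k = count (image_mset index (mset xs)) k"
    unfolding assms Ymon_def lin_def by (simp flip: count_mon_mset add: mon_mset_sum_mset)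
  also have "\<dots> = length (filter (\<lambda>x. index x = k) xs)" by (induction xs) auto
  finally show ?thesis by (simp add: words_at_def)
qed

lemma mset_concat_blocks:
  assumes "mset xs = mon_mset s" "set xs \<subseteq> X"
  shows "mset (concat (map (block xs i) [1..<Suc n])) = mon_mset (Zmon i s)"
proof -
  have "mset (concat (map (block xs i) [1..<Suc n])) = (\<Sum>k\<leftarrow>[1..<Suc n]. mset (block xs i k))"
    by (simp only: mset_concat map_map comp_def)
  also have "\<dots> = (\<Sum>k\<leftarrow>[1..<Suc n]. \<Sum>x\<leftarrow>filter (\<lambda>x. index x = k) xs. mon_mset (z_mon i (slabel x)))"
    unfolding mset_block word_mon_concat words_at_def mon_mset_sum_list map_map comp_def ..
  also have "\<dots> = (\<Sum>x\<leftarrow>xs. mon_mset (z_mon i (slabel x)))"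
    by (rule sum_list_partition) (use assms(2) index_in in \<open>auto simp: less_Suc_eq_le simp del: upt_Suc\<close>)
  also have "\<dots> = mon_mset (Zmon i s)"
    unfolding Zmon_def mset_eq_mon_mset_imp[OF assms(1), symmetric] by (simp add: mon_mset_sum_list comp_def)
  finally show ?thesis .
qed

lemma sorted_blocks:
  assumes irr: "irreducible_mon s" and xs: "mset xs = mon_mset s" and ks: "sorted_wrt (<) ks"
  shows "sorted_wrt (\<lambda>xs ys. \<forall>x\<in>set xs. \<forall>y\<in>set ys. x \<le> y) (map (block xs i) ks)"
  unfolding sorted_wrt_map
proof (rule sorted_wrt_mono_rel[OF _ ks], intro ballI)
  fix k k' j j' assume k: "k < k'" and j: "j \<in> set (block xs i k)" "j' \<in> set (block xs i k')"
  have keys: "set xs = Poly_Mapping.keys s" using xs by (metis set_mon_mset set_mset_mset)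
  obtain x where x: "x \<in> set xs" "index x = k" "(i, j) \<in> set (slabel x)"
    using j(1) by (auto simp: block_def words_at_def)
  obtain x' where x': "x' \<in> set xs" "index x' = k'" "(i, j') \<in> set (slabel x')"
    using j(2) by (auto simp: block_def words_at_def)
  show "j \<le> j'" using irreducible_ordered[OF irr _ _ _ x(3) x'(3)] x x' k keys by simp
qed

theorem irreducible_unique:
  assumes s: "irreducible_mon s" and t: "irreducible_mon t" and eq: "lin (\<lambda>x. x) s = lin (\<lambda>x. x) t"
  shows "s = t"
proof -
  have mons: "s \<in> mons X" "t \<in> mons X" using s t by (auto simp: irreducible_mon_def)
  have Z: "Zmon i s = Zmon i t" if i: "i \<in> {1..d}" for i
    by (rule fibre_min_unique[OF ord[OF i] stdz_Zmon[OF s i] stdz_Zmon[OF t i] lin_m_Zmon_eq[OF mons eq i]])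
  have Y: "Ymon s = Ymon t"
    by (rule fibre_min_unique[OF ord0 fibre_min_Ymon[OF s] fibre_min_Ymon[OF t] lin_a_Ymon_eq[OF mons eq]])
  define xs ys where "xs = list_of_mset (mon_mset s)" and "ys = list_of_mset (mon_mset t)"
  have xs: "mset xs = mon_mset s" and ys: "mset ys = mon_mset t" by (simp_all add: xs_def ys_def)
  have xsX: "set xs \<subseteq> X" and ysX: "set ys \<subseteq> X" using mons by (simp_all add: xs_def ys_def mons_def)
  have len: "length (words_at xs k) = length (words_at ys k)" for k
    using length_words_at[OF xs] length_words_at[OF ys] Y by simp
  have "mset (concat (words_at xs k)) = mset (concat (words_at ys k))" if k: "k \<in> {1..n}" for k
  proof (rule mset_eq_if_z_mon_eq)
    show "set (concat (words_at xs k)) \<subseteq> letters d lam" "set (concat (words_at ys k)) \<subseteq> letters d lam"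
      using xsX ysX lab_letters[OF slab_lab[OF slabel(1)]] by (auto simp: words_at_def)
    fix i assume i: "i \<in> {1..d}"
    have "map mset (map (block xs i) [1..<Suc n]) = map mset (map (block ys i) [1..<Suc n])"
    proof (rule ordered_blocks_unique)
      show "map length (map (block xs i) [1..<Suc n]) = map length (map (block ys i) [1..<Suc n])"
        by (simp only: map_map comp_def length_block[OF xsX] length_block[OF ysX] len)
      show "mset (concat (map (block xs i) [1..<Suc n])) = mset (concat (map (block ys i) [1..<Suc n]))"
        by (simp only: mset_concat_blocks[OF xs xsX] mset_concat_blocks[OF ys ysX] Z[OF i])
    qed (simp_all only: sorted_blocks[OF s xs sorted_wrt_upt] sorted_blocks[OF t ys sorted_wrt_upt])
    then have "mset (block xs i k) = mset (block ys i k)" using k by (simp del: upt_Suc)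
    then show "z_mon i (concat (words_at xs k)) = z_mon i (concat (words_at ys k))"
      by (simp add: mset_block mon_mset_inject)
  qed
  note letters = this
  have keys: "set xs = Poly_Mapping.keys s" "set ys = Poly_Mapping.keys t" by (simp_all add: xs_def ys_def)
  have words: "image_mset mset (mset (words_at xs k)) = image_mset mset (mset (words_at ys k))"
    if k: "k \<in> {1..n}" for k
  proof (rule pairwise_interlaced_unique[OF _ _ len letters[OF k]])
    show "interlaced w w'" if "w \<in> set (words_at xs k)" "w' \<in> set (words_at xs k)" for w w'
      using that irreducible_interlaced[OF s] keys by (auto simp: words_at_def)
    show "interlaced w w'" if "w \<in> set (words_at ys k)" "w' \<in> set (words_at ys k)" for w w'
      using that irreducible_interlaced[OF t] keys by (auto simp: words_at_def)
  qed
  \<comment> \<open>The map \<open>u_mon\<close> factors through the multiset of letters, so words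
    known up to order give back the variables.\<close>
  have recover: "image_mset (\<lambda>M. \<Sum>x\<in>#M. m (fst x) (snd x)) (image_mset mset (mset (words_at zs k)))
      = mset (filter (\<lambda>x. index x = k) zs)" if "set zs \<subseteq> X" for zs k
  proof -
    have "image_mset (\<lambda>M. \<Sum>x\<in>#M. m (fst x) (snd x)) (image_mset mset (mset (words_at zs k)))
        = image_mset (\<lambda>x. umon (slabel x)) (mset (filter (\<lambda>x. index x = k) zs))"
      by (simp add: words_at_def multiset.map_comp comp_def u_mon_eq_sum_mset)
    also have "\<dots> = image_mset (\<lambda>x. x) (mset (filter (\<lambda>x. index x = k) zs))"
      by (rule image_mset_cong) (use that slabel(2) in auto)
    finally show ?thesis by simp
  qed
  have same: "mset (filter (\<lambda>x. index x = k) xs) = mset (filter (\<lambda>x. index x = k) ys)" if "k \<in> {1..n}" for k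
    using recover[OF xsX, of k] recover[OF ysX, of k] words[OF that] by simp
  have "mset xs = mset ys"
  proof (rule multiset_eqI)
    fix x
    have count: "count (mset zs) x = count (mset (filter (\<lambda>y. index y = index x) zs)) x" for zs by simp
    show "count (mset xs) x = count (mset ys) x"
    proof (cases "x \<in> X")
      case True
      then show ?thesis using same[OF index_in[OF True]] count by metis
    next
      case False
      then have "x \<notin> set xs" "x \<notin> set ys" using xsX ysX by auto
      then show ?thesis by (metis count_mset_0_iff)
    qed
  qed
  then show ?thesis using xs ys by (simp add: mon_mset_inject)
qed

section \<open>The binomials of type (4) and the main theorem\<close>

text \<open>Every factor singles out at least one letter of \<open>z\<close>.\<close>

lemma type4_degree:
  assumes "type4 d n a lam m ord G i z z' s t"
  shows "mon_degree s \<le> mon_degree z"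
proof -
  obtain ts where ts: "\<forall>(k, M, j, j', M') \<in> set ts. j \<noteq> [] \<and> length j' = length j \<and>
       slab k (M @ map (Pair i) j @ M') \<and> lab k (M @ map (Pair i) j' @ M')"
    and z: "z = (\<Sum>(k, M, j, j', M')\<leftarrow>ts. \<Sum>c\<leftarrow>j. var c)"
    and s: "s = xmon (map (\<lambda>(k, M, j, j', M'). M @ map (Pair i) j @ M') ts)"
    by (rule type4E[OF assms])
  show ?thesis unfolding z s using ts
  proof (induction ts)
    case (Cons e ts)
    obtain k M j j' M' where e: "e = (k, M, j, j', M')" by (metis prod.exhaust)
    have "mon_degree (\<Sum>c\<leftarrow>j. var c) = length j" by (simp add: mon_degree_sum_list sum_list_triv)
    moreover have "1 \<le> length j" using Cons.prems by (simp add: e Suc_le_eq One_nat_def)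
    ultimately show ?case using Cons by (simp add: e)
  qed simp
qed

text \<open>With a single factor, \<open>z\<close> would divide the monomial of a standard label; it
  would then be standard itself and could not be an initial monomial.\<close>

lemma type4_not_one_factor:
  assumes "type4 d n a lam m ord G i z z' s t"
  shows "mon_degree s \<noteq> 1"
proof
  assume deg: "mon_degree s = 1"
  obtain ts where i: "i \<in> {1..d}" and mk: "marked_in (ord i) (G i) z z'"
    and ts: "\<forall>(k, M, j, j', M') \<in> set ts. j \<noteq> [] \<and> length j' = length j \<and>
       slab k (M @ map (Pair i) j @ M') \<and> lab k (M @ map (Pair i) j' @ M')"
    and z: "z = (\<Sum>(k, M, j, j', M')\<leftarrow>ts. \<Sum>c\<leftarrow>j. var c)"
    and s: "s = xmon (map (\<lambda>(k, M, j, j', M'). M @ map (Pair i) j @ M') ts)"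
    by (rule type4E[OF assms])
  have "mon_degree s = length ts"
    unfolding s by (simp add: mon_degree_sum_list sum_list_triv)
  then obtain e where "ts = [e]" using deg by (metis One_nat_def length_0_conv length_Suc_conv)
  moreover obtain k M j j' M' where "e = (k, M, j, j', M')" by (metis prod.exhaust)
  ultimately have e: "ts = [(k, M, j, j', M')]" by simp
  have "mon_dvd z (z_mon i (M @ map (Pair i) j @ M'))"
    unfolding z by (simp add: e mon_dvd_iff z_mon_map_Pair)
  moreover have "stdz i (z_mon i (M @ map (Pair i) j @ M'))"
    using ts i unfolding e slab_iff by simp
  ultimately have min: "stdz i z" using fibre_min_dvd[OF ord[OF i]] by blast
  note mk' = marked_inD[OF ord[OF i] G_subset[OF i] mk]
  have "(z, z') \<in> ord i" by (rule fibre_min_le[OF min mk'(3) mk'(4)[symmetric]])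
  then have "z = z'" using mk'(5) by (rule monomial_order_antisym[OF ord[OF i]])
  then show False using mk'(1) by blast
qed

lemma type4_quadratic:
  assumes "type4 d n a lam m ord G i z z' s t" "mon_degree z = 2"
  shows "mon_degree s = 2"
proof -
  have "mon_degree s \<noteq> 0"
  proof
    assume "mon_degree s = 0"
    obtain ts where "\<forall>(k, M, j, j', M') \<in> set ts. j \<noteq> [] \<and> length j' = length j \<and>
       slab k (M @ map (Pair i) j @ M') \<and> lab k (M @ map (Pair i) j' @ M')"
      and z: "z = (\<Sum>(k, M, j, j', M')\<leftarrow>ts. \<Sum>c\<leftarrow>j. var c)"
      and s: "s = xmon (map (\<lambda>(k, M, j, j', M'). M @ map (Pair i) j @ M') ts)"
      by (rule type4E[OF assms(1)])
    have "mon_degree s = length ts"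
      unfolding s by (simp add: mon_degree_sum_list sum_list_triv)
    then show False using \<open>mon_degree s = 0\<close> z assms(2) by simp
  qed
  then show ?thesis using type4_degree[OF assms(1)] type4_not_one_factor[OF assms(1)] assms(2) by linarith
qed

text \<open>All factors with the same variable \<open>x\<close> are merged into one.
  \<open>J x\<close> collects the letters they single out and \<open>J' x\<close>, in the same order
  of factors, their replacements; the binomial \<open>z - z'\<close> stays the same.\<close>

lemma type4_squarefree:
  assumes t4: "type4 d n a lam m ord G i z z' s t" and sq: "squarefree_mon z"
  shows "\<exists>s' t'. type4 d n a lam m ord G i z z' s' t' \<and> squarefree_mon s' \<and>
    Poly_Mapping.keys s' = Poly_Mapping.keys s"
proof -
  obtain ts where i: "i \<in> {1..d}" and mk: "marked_in (ord i) (G i) z z'"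
    and ts: "\<forall>(k, M, j, j', M') \<in> set ts. j \<noteq> [] \<and> length j' = length j \<and>
       slab k (M @ map (Pair i) j @ M') \<and> lab k (M @ map (Pair i) j' @ M')"
    and z: "z = (\<Sum>(k, M, j, j', M')\<leftarrow>ts. \<Sum>c\<leftarrow>j. var c)" "z' = (\<Sum>(k, M, j, j', M')\<leftarrow>ts. \<Sum>c\<leftarrow>j'. var c)"
    and s: "s = xmon (map (\<lambda>(k, M, j, j', M'). M @ map (Pair i) j @ M') ts)"
    by (rule type4E[OF t4])
  define h :: "nat \<times> letter list \<times> nat list \<times> nat list \<times> letter list \<Rightarrow> 'u mon"
    where "h = (\<lambda>(k, M, j, j', M'). umon (M @ map (Pair i) j @ M'))"
  define J where "J x = concat (map (\<lambda>(k, M, j, j', M'). j) (filter (\<lambda>e. h e = x) ts))" for x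
  define J' where "J' x = concat (map (\<lambda>(k, M, j, j', M'). j') (filter (\<lambda>e. h e = x) ts))" for x
  define xs where "xs = remdups (map h ts)"
  have dist: "distinct xs" and h_xs: "\<And>e. e \<in> set ts \<Longrightarrow> h e \<in> set xs" by (simp_all add: xs_def)
  have xsX: "x \<in> X" if "x \<in> set xs" for x
    using that ts slab_lab lab_in_X by (fastforce simp: xs_def h_def)
  have lenJ: "length (J' x) = length (J x)" for x
    unfolding J_def J'_def using ts by (induction ts) auto
  have J_ne: "J x \<noteq> []" if "x \<in> set xs" for x
    using that ts by (fastforce simp: xs_def J_def)
  have sumJ: "(\<Sum>x\<leftarrow>xs. \<Sum>c\<leftarrow>J x. var c) = z"
  proof -
    have "(\<Sum>c\<leftarrow>J x. var c) = (\<Sum>(k, M, j, j', M')\<leftarrow>filter (\<lambda>e. h e = x) ts. \<Sum>c\<leftarrow>j. var c)" for x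
      unfolding J_def by (induction ts) auto
    then show ?thesis using sum_list_partition[OF dist h_xs] unfolding z by simp
  qed
  have sumJ': "(\<Sum>x\<leftarrow>xs. \<Sum>c\<leftarrow>J' x. var c) = z'"
  proof -
    have "(\<Sum>c\<leftarrow>J' x. var c) = (\<Sum>(k, M, j, j', M')\<leftarrow>filter (\<lambda>e. h e = x) ts. \<Sum>c\<leftarrow>j'. var c)" for x
      unfolding J'_def by (induction ts) auto
    then show ?thesis using sum_list_partition[OF dist h_xs] unfolding z by simp
  qed
  have J_sub: "mset (J x) \<subseteq># mon_mset (z_mon i (slabel x))" if x: "x \<in> set xs" for x
  proof (rule mset_subset_eqI)
    fix c
    show "count (mset (J x)) c \<le> count (mon_mset (z_mon i (slabel x))) c"
    proof (cases "c \<in> set (J x)")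
      case True
      then obtain k M j j' M' where e: "(k, M, j, j', M') \<in> set ts" "h (k, M, j, j', M') = x" "c \<in> set j"
        by (auto simp: J_def)
      then have sl: "slab k (M @ map (Pair i) j @ M')" and u: "umon (M @ map (Pair i) j @ M') = x"
        using ts by (auto simp: h_def)
      have "(i, c) \<in># mset (M @ map (Pair i) j @ M')" using e(3) by simp
      then have "(i, c) \<in># mset (slabel x)" using slabel_umon[OF sl] u by simp
      then have "1 \<le> count (mon_mset (z_mon i (slabel x))) c"
        unfolding count_mon_mset lookup_z_mon by (simp add: Suc_le_eq One_nat_def)
      moreover have "mset (J x) \<subseteq># (\<Sum>x\<leftarrow>xs. mset (J x))"
        using x by (induction xs) (auto intro: subset_mset.add_increasing subset_mset.add_increasing2)
      then have "mset (J x) \<subseteq># mon_mset z"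
        unfolding sumJ[symmetric] mon_mset_sum_list map_map comp_def mon_mset_var_list by simp
      \<comment> \<open>Squarefreeness enters here: no letter is singled out twice, so the collected
        letters fit into one copy of the standard label of \<open>x\<close>.\<close>
      then have "count (mset (J x)) c \<le> 1"
        using sq unfolding squarefree_mon_def subseteq_mset_def by (metis count_mon_mset le_trans)
      ultimately show ?thesis by linarith
    next
      case False
      then have "count (mset (J x)) c = 0" by simp
      then show ?thesis by linarith
    qed
  qed
  define M where "M x = list_of_mset (mset (slabel x) - image_mset (Pair i) (mset (J x)))" for x
  have M: "slab (index x) (M x @ map (Pair i) (J x) @ [])" "umon (M x @ map (Pair i) (J x) @ []) = x"
    if x: "x \<in> set xs" for x
  proof -
    have ms: "mset (M x @ map (Pair i) (list_of_mset (mset (J x))) @ []) = mset (M x @ map (Pair i) (J x) @ [])"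
      by simp
    show "slab (index x) (M x @ map (Pair i) (J x) @ [])"
      using slab_extract(1)[OF xsX[OF x] J_sub[OF x]] slab_cong[OF ms] unfolding M_def by blast
    show "umon (M x @ map (Pair i) (J x) @ []) = x"
      using slab_extract(2)[OF xsX[OF x] J_sub[OF x]] u_mon_cong[OF ms] unfolding M_def by metis
  qed
  define us where "us = map (\<lambda>x. (index x, M x, J x, J' x, [] :: letter list)) xs"
  let ?s = "xmon (map (\<lambda>(k, M, j, j', M'). M @ map (Pair i) j @ M') us)"
  have "type4 d n a lam m ord G i z z' ?s (xmon (map (\<lambda>(k, M, j, j', M'). M @ map (Pair i) j' @ M') us))"
  proof (rule type4I[OF i mk _ _ _ refl refl])
    show "z = (\<Sum>(k, M, j, j', M')\<leftarrow>us. \<Sum>c\<leftarrow>j. var c)" "z' = (\<Sum>(k, M, j, j', M')\<leftarrow>us. \<Sum>c\<leftarrow>j'. var c)"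
      using sumJ sumJ' by (simp_all add: us_def comp_def)
    show "\<forall>(k, M, j, j', M') \<in> set us. j \<noteq> [] \<and> length j' = length j \<and>
       slab k (M @ map (Pair i) j @ M') \<and> lab k (M @ map (Pair i) j' @ M')"
    proof (clarify)
      fix k N j j' M' assume "(k, N, j, j', M') \<in> set us"
      then obtain x where x: "x \<in> set xs" and eqs: "k = index x" "N = M x" "j = J x" "j' = J' x" "M' = []"
        unfolding us_def set_map by blast
      have "set (map (Pair i) (J' x)) \<subseteq> letters d lam"
      proof -
        have *: "set (map (Pair i) j') \<subseteq> letters d lam" if "(k, N, j, j', M') \<in> set ts" for k N j j' M'
        proof -
          have "lab k (N @ map (Pair i) j' @ M')" using ts that by blast
          from lab_letters[OF this] show ?thesis by simp
        qed
        show ?thesis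
        proof
          fix y assume "y \<in> set (map (Pair i) (J' x))"
          then obtain k N j j' M' where "(k, N, j, j', M') \<in> set ts" "y \<in> set (map (Pair i) j')"
            by (auto simp: J'_def)
          then show "y \<in> letters d lam" using * by blast
        qed
      qed
      then have "lab (index x) (M x @ map (Pair i) (J' x) @ [])"
        by (rule lab_replace[OF slab_lab[OF M(1)[OF x]] lenJ])
      then show "j \<noteq> [] \<and> length j' = length j \<and>
         slab k (N @ map (Pair i) j @ M') \<and> lab k (N @ map (Pair i) j' @ M')"
        unfolding eqs using M(1)[OF x] J_ne[OF x] lenJ[of x] by blast
    qed
  qed
  moreover have s': "?s = (\<Sum>x\<leftarrow>xs. var x)"
    unfolding us_def map_map
    by (rule arg_cong[of _ _ sum_list], rule map_cong[OF refl]) (use M(2) in simp)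
  have "squarefree_mon ?s"
    unfolding squarefree_mon_def count_mon_mset[symmetric] s' mon_mset_var_list
    using dist by (simp add: distinct_count_atmost_1)
  moreover have "Poly_Mapping.keys ?s = Poly_Mapping.keys s"
  proof -
    have "s = (\<Sum>x\<leftarrow>map h ts. var x)"
      unfolding s map_map by (rule arg_cong[of _ _ sum_list], rule map_cong[OF refl]) (auto simp: h_def)
    then have "Poly_Mapping.keys s = set (map h ts)"
      by (metis mon_mset_var_list set_mon_mset set_mset_mset)
    moreover have "Poly_Mapping.keys ?s = set xs"
      unfolding s' by (metis mon_mset_var_list set_mon_mset set_mset_mset)
    ultimately show ?thesis by (simp add: xs_def)
  qed
  ultimately show ?thesis by blast
qed

lemma finite_marked: "finite marked"
proof -
  let ?E = "\<Union>g\<in>G0. Poly_Mapping.keys g" and ?K = "\<Union>i\<in>{1..d}. \<Union>g\<in>G i. Poly_Mapping.keys g"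
  have fin: "finite ?E" "finite ?K" using G0 G by (auto simp: groebner_basis_def)
  \<comment> \<open>The 2 covers types (2) and (3). The sums are crude bounds for the largest degree
    of a monomial in \<open>G0\<close> and in the \<open>G i\<close>, for types (1) and (4).\<close>
  let ?D = "2 + (\<Sum>z\<in>?E. mon_degree z) + (\<Sum>z\<in>?K. mon_degree z)"
  have degs: "mon_degree s \<le> ?D" if "(s, t) \<in> marked" for s t
  proof -
    consider "(s, t) \<in> type1 d n a lam m ord0 G0 ord G" | "(s, t) \<in> type2 d n r a lam m ord G"
      | "(s, t) \<in> type3 d n a lam m ord G" | i z z' where "type4 d n a lam m ord G i z z' s t"
      using \<open>(s, t) \<in> marked\<close> unfolding nested_marked_binomials_def by blast
    then show ?thesis
    proof cases
      case 1
      obtain ks ks' ws ws' where *: "s = xmon ws" "list_all2 slab ks ws"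
        "marked_in ord0 G0 (\<Sum>k\<leftarrow>ks. var k) (\<Sum>k\<leftarrow>ks'. var k)"
        by (rule type1E[OF 1])
      obtain g where "g \<in> G0" "(\<Sum>k\<leftarrow>ks. var k) \<in> Poly_Mapping.keys g"
        using marked_inD(6)[OF ord0 G0_subset *(3)] by blast
      then have "mon_degree (\<Sum>k\<leftarrow>ks. var k) \<le> (\<Sum>z\<in>?E. mon_degree z)"
        using fin(1) by (intro member_le_sum) auto
      moreover have "mon_degree s = mon_degree (\<Sum>k\<leftarrow>ks. var k)"
        using *(2) by (simp add: *(1) mon_degree_sum_list sum_list_triv list_all2_lengthD)
      ultimately show ?thesis by linarith
    next
      case 2
      then have "mon_degree s = 2" by (auto simp: type2_def)
      then show ?thesis by linarith
    next
      case 3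
      then have "mon_degree s = 2" by (auto simp: type3_def)
      then show ?thesis by linarith
    next
      case 4
      then have i: "i \<in> {1..d}" and mk: "marked_in (ord i) (G i) z z'" by (auto simp: type4_def)
      obtain g where "g \<in> G i" "z \<in> Poly_Mapping.keys g"
        using marked_inD(6)[OF ord[OF i] G_subset[OF i] mk] by blast
      then have "mon_degree z \<le> (\<Sum>z\<in>?K. mon_degree z)"
        using fin(2) i by (intro member_le_sum) auto
      then show ?thesis using type4_degree[OF 4] by linarith
    qed
  qed
  let ?F = "{s \<in> mons X. mon_degree s \<le> ?D}"
  have "marked \<subseteq> ?F \<times> ?F"
  proof (rule subrelI)
    fix s t assume st: "(s, t) \<in> marked"
    then have red: "s \<in> mons X" "t \<in> mons X" "lin (\<lambda>x. x) s = lin (\<lambda>x. x) t"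
      using reducing_marked unfolding reducing_def by blast+
    then have "mon_degree t = mon_degree s"
      using homogeneous_X unfolding degree_homogeneous_def by metis
    then show "(s, t) \<in> ?F \<times> ?F" using red degs[OF st] by simp
  qed
  then show ?thesis using finite_mons_degree_le[OF finite_X] finite_subset by blast
qed

theorem nested_groebner_basis:
  "\<exists>ordX. monomial_order X ordX \<and>
     groebner_basis X ordX (toric_ideal X V (\<lambda>x. x))
       {mono_poly s - mono_poly t :: ('u mon, 'k) mpoly | s t. (s, t) \<in> marked} \<and>
     (\<forall>(s, t) \<in> marked. init_mon ordX (mono_poly s - mono_poly t :: ('u mon, 'k) mpoly) = s)"
proof -
  let ?B = "{mono_poly s - mono_poly t :: ('u mon, 'k) mpoly | s t. (s, t) \<in> marked}"
  obtain ordX where ordX: "monomial_order X ordX"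
    "\<forall>s\<in>mons X. \<forall>t\<in>mons X. (s, t) \<in> xrel \<longrightarrow> (t, s) \<notin> xrel \<longrightarrow> (s, t) \<in> ordX"
    using monomial_order_refines[OF finite_X compatible_xrel] by blast
  have red: "s \<in> mons X" "t \<in> mons X" "lin (\<lambda>x. x) s = lin (\<lambda>x. x) t" "s \<noteq> t" "(t, s) \<in> ordX"
    if "(s, t) \<in> marked" for s t
    using reducing_marked[OF that] ordX(2) unfolding reducing_def by blast+
  have init: "init_mon ordX (mono_poly s - mono_poly t :: ('u mon, 'k) mpoly) = s" if "(s, t) \<in> marked" for s t
    using red[OF that] by (intro init_mon_binomial[OF ordX(1)])
  have "groebner_basis X ordX (toric_ideal X V (\<lambda>x. x)) ?B"
  proof (rule toric_groebner_basisI[OF ordX(1) finite_X homogeneous_X])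
    have "?B = (\<lambda>(s, t). mono_poly s - mono_poly t) ` marked" by auto
    then show "finite ?B" using finite_marked by simp
    show "?B \<subseteq> toric_ideal X V (\<lambda>x. x) - {0}"
    proof
      fix g assume "g \<in> ?B"
      then obtain s t where g: "g = mono_poly s - mono_poly t" and st: "(s, t) \<in> marked" by blast
      have "Poly_Mapping.keys g \<noteq> {}" unfolding g keys_binomial[OF red(4)[OF st]] by simp
      then have "g \<noteq> 0" by auto
      then show "g \<in> toric_ideal X V (\<lambda>x. x) - {0}"
        using red[OF st] unfolding g by (simp add: binomial_in_toric_ideal_iff)
    qed
    fix s t assume st: "s \<in> mons X" "t \<in> mons X" "lin (\<lambda>x. x) s = lin (\<lambda>x. x) t"
      "\<forall>g\<in>?B. \<not> mon_dvd (init_mon ordX g) s" "\<forall>g\<in>?B. \<not> mon_dvd (init_mon ordX g) t"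
    \<comment> \<open>Since \<open>init\<close> identifies the initial monomials with the underlined
      ones, avoiding them is irreducibility.\<close>
    have "irreducible_mon u" if "u \<in> mons X" "\<forall>g\<in>?B. \<not> mon_dvd (init_mon ordX g) u" for u
      unfolding irreducible_mon_def
    proof (intro conjI that(1), clarify)
      fix s' t' assume s't': "(s', t') \<in> marked" and dvd: "mon_dvd s' u"
      have "mono_poly s' - mono_poly t' \<in> ?B" using s't' by blast
      then have "\<not> mon_dvd (init_mon ordX (mono_poly s' - mono_poly t' :: ('u mon, 'k) mpoly)) u" using that(2) by blast
      then show False using dvd init[OF s't'] by simp
    qed
    then show "s = t" using irreducible_unique st by blast
  qed
  then show ?thesis using ordX(1) init by blast
qed

end

theorem theorem2p6:
  fixes d n r :: nat
    and a :: "nat \<Rightarrow> nat mon"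
    and lam :: "nat \<Rightarrow> nat"
    and U :: "nat \<Rightarrow> 'u set"
    and m :: "nat \<Rightarrow> nat \<Rightarrow> 'u mon"
    and ord0 :: "nat mon rel"
    and G0 :: "(nat, 'k::field) mpoly set"
    and ord :: "nat \<Rightarrow> nat mon rel"
    and G :: "nat \<Rightarrow> (nat, 'k) mpoly set"
  assumes "configuration {1..d} (a ` {1..n})" and "inj_on a {1..n}"
    and "\<forall>k\<in>{1..n}. mon_degree (a k) = r"
    and "\<forall>i\<in>{1..d}. \<exists>k\<in>{1..n}. mon_dvd (var i) (a k)"
    and "disjoint_family_on U {1..d}"
    and "\<forall>i\<in>{1..d}. configuration (U i) (m i ` {1..lam i}) \<and> inj_on (m i) {1..lam i}"
    and "monomial_order {1..n} ord0"
    and "groebner_basis {1..n} ord0 (toric_ideal {1..n} {1..d} a) G0"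
    and "\<forall>g\<in>G0. binomial_poly g"
    and "\<forall>i\<in>{1..d}. monomial_order {1..lam i} (ord i) \<and>
           groebner_basis {1..lam i} (ord i) (toric_ideal {1..lam i} (U i) (m i)) (G i) \<and>
           (\<forall>g\<in>G i. binomial_poly g)"
  shows "\<exists>ordX.
     monomial_order (nested_configuration d lam (a ` {1..n}) m) ordX \<and>
     groebner_basis (nested_configuration d lam (a ` {1..n}) m) ordX
       (toric_ideal (nested_configuration d lam (a ` {1..n}) m) (\<Union>i\<in>{1..d}. U i) (\<lambda>x. x))
       {mono_poly s - mono_poly t :: ('u mon, 'k) mpoly | s t.
          (s, t) \<in> nested_marked_binomials d n r a lam m ord0 G0 ord G} \<and>
     (\<forall>(s, t) \<in> nested_marked_binomials d n r a lam m ord0 G0 ord G.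
        init_mon ordX (mono_poly s - mono_poly t :: ('u mon, 'k) mpoly) = s) \<and>
     (\<forall>i z z' s t. type4 d n a lam m ord G i z z' s t \<longrightarrow>
        (mon_degree z = 2 \<longrightarrow> mon_degree s = 2) \<and>
        (squarefree_mon z \<longrightarrow>
           (\<exists>s' t'. type4 d n a lam m ord G i z z' s' t' \<and> squarefree_mon s' \<and>
              Poly_Mapping.keys s' = Poly_Mapping.keys s)))"
proof -
  interpret nested_groebner d n r a lam U m ord0 G0 ord G
    using assms by unfold_locales blast+
  obtain ordX where ordX: "monomial_order X ordX"
    "groebner_basis X ordX (toric_ideal X (\<Union>i\<in>{1..d}. U i) (\<lambda>x. x))
       {mono_poly s - mono_poly t :: ('u mon, 'k) mpoly | s t. (s, t) \<in> marked}"
    "\<forall>(s, t) \<in> marked. init_mon ordX (mono_poly s - mono_poly t :: ('u mon, 'k) mpoly) = s"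
    using nested_groebner_basis[of "\<Union>i\<in>{1..d}. U i"] by blast
  show ?thesis
  proof (rule exI[of _ ordX], intro conjI allI impI)
    fix i z z' s t assume t4: "type4 d n a lam m ord G i z z' s t"
    show "mon_degree s = 2" if "mon_degree z = 2" by (rule type4_quadratic[OF t4 that])
    show "\<exists>s' t'. type4 d n a lam m ord G i z z' s' t' \<and> squarefree_mon s' \<and>
        Poly_Mapping.keys s' = Poly_Mapping.keys s" if "squarefree_mon z"
      by (rule type4_squarefree[OF t4 that])
  qed (fact ordX)+
qed

end
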